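(* A (connected) totally umbilical surface in one of Thurston's eight 3-dimensional geometries $\mathbb{R}^3$, $S^3$, $H^3$, $S^2\times\mathbb{R}$, $H^2\times\mathbb{R}$, $\mathrm{Sol}$, $\mathrm{Nil}$, $\widetilde{SL}(2,\mathbb{R})$ is proper biharmonic if and only if it is a part of $S^2(1/\sqrt{2})$ in $S^3$.
   Context: All manifolds and maps are smooth. A map $\varphi:(M,g)\to(N,h)$ of Riemannian manifolds is biharmonic if for every compact $\Omega\subset M$ it is a critical point of the bienergy $E^2(\varphi,\Omega)=\frac12\int_\Omega|\tau(\varphi)|^2dx$, where $\tau(\varphi)=\mathrm{Trace}_g\nabla d\varphi$ is the tension field; equivalently $\mathrm{Trace}_{g}(\nabla^{\varphi}\nabla^{\varphi}-\nabla^{\varphi}_{\nabla^{M}})\tau(\varphi)-\mathrm{Trace}_{g}R^{N}(d\varphi,\tau(\varphi))d\varphi=0$, with $R^N(X,Y)Z=[\nabla^N_X,\nabla^N_Y]Z-\nabla^N_{[X,Y]}Z$. A surface (immersed 2-dimensional submanifold with induced metric) is biharmonic if its isometric immersion is a biharmonic map, and proper biharmonic if it is biharmonic but not minimal. A surface is totally umbilical if at every point its two principal curvatures coincide. Here $\mathbb{R}^3,S^3,H^3$ are the space forms of curvature $0,1,-1$; $S^2\times\mathbb{R}$ and $H^2\times\mathbb{R}$ are Riemannian products with $S^2$, $H^2$ of curvature $1$, $-1$; $\mathrm{Sol}=(\mathbb{R}^3,e^{2z}dx^2+e^{-2z}dy^2+dz^2)$; $\mathrm{Nil}$ and $\widetilde{SL}(2,\mathbb{R})$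 are the Bianchi-Cartan-Vranceanu spaces $\{1+m(x^2+y^2)>0\}\subset\mathbb{R}^3$ with metric $\frac{dx^2+dy^2}{[1+m(x^2+y^2)]^2}+\left[dz+\frac{l}{2}\frac{y\,dx-x\,dy}{1+m(x^2+y^2)}\right]^2$ with $m=0,l\neq0$ and with $m<0,l\ne0$, respectively. $S^2(1/\sqrt2)\subset S^3$ is the intersection of the unit sphere $S^3\subset\mathbb{R}^4$ with a hyperplane at distance $1/\sqrt2$ from the origin. "A part of" means an open piece. *)

theory Defs
  imports "HOL-Analysis.Analysis"
begin

section \<open>Smooth maps between Euclidean spaces\<close>

text \<open>Only used on open sets.\<close>

primrec Ck_on :: "nat \<Rightarrow> ('a::euclidean_space \<Rightarrow> 'b::real_normed_vector) \<Rightarrow> 'a set \<Rightarrow> bool" where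
  "Ck_on 0 f S \<longleftrightarrow> continuous_on S f"
| "Ck_on (Suc k) f S \<longleftrightarrow>
     f differentiable_on S \<and> (\<forall>v. Ck_on k (\<lambda>x. frechet_derivative f (at x) v) S)"

definition smooth_on :: "'a::euclidean_space set \<Rightarrow> ('a \<Rightarrow> 'b::real_normed_vector) \<Rightarrow> bool" where
  "smooth_on S f \<longleftrightarrow> (\<forall>k. Ck_on k f S)"

definition partial :: "'n \<Rightarrow> (real^'n \<Rightarrow> 'b::real_normed_vector) \<Rightarrow> real^'n \<Rightarrow> 'b" where
  "partial i f x = frechet_derivative f (at x) (axis i 1)"


section \<open>Riemannian manifolds\<close>

text \<open>
  A chart carries its domain, its coordinate map and the Gram matrix
  \<open>(g\<^sub>i\<^sub>j)\<close> of the metric, the latter as a function of the coordinates.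
\<close>

record ('p, 'n) metric_chart =
  chart_dom :: "'p set"
  coord :: "'p \<Rightarrow> real^'n"
  gram :: "real^'n \<Rightarrow> real^'n^'n"

record ('p, 'n) riem_space =
  top_of :: "'p topology"
  atlas :: "('p, 'n) metric_chart set"

definition chart_inv :: "('p, 'n) metric_chart \<Rightarrow> real^'n \<Rightarrow> 'p" where
  "chart_inv c = inv_into (chart_dom c) (coord c)"

text \<open>The metric with Gram matrix \<open>G\<close> at \<open>x\<close>, applied to two coordinate vectors.\<close>

definition metric_ip :: "(real^'n \<Rightarrow> real^'n^'n) \<Rightarrow> real^'n \<Rightarrow> real^'n \<Rightarrow> real^'n \<Rightarrow> real" where
  "metric_ip G x v w = (\<Sum>i\<in>UNIV. \<Sum>j\<in>UNIV. G x $ i $ j * v $ i * w $ j)"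

text \<open>
  Coordinate expression of a map \<open>\<phi>\<close> in a chart \<open>c\<close> of the source and a chart \<open>d\<close> of the
  target, and the part of the coordinate domain of \<open>c\<close> on which it is meaningful.
\<close>

definition loc_rep ::
  "('p, 'm::finite) metric_chart \<Rightarrow> ('q, 'n::finite) metric_chart \<Rightarrow> ('p \<Rightarrow> 'q) \<Rightarrow> real^'m \<Rightarrow> real^'n" where
  "loc_rep c d \<phi> = (\<lambda>x. coord d (\<phi> (chart_inv c x)))"

definition loc_dom ::
  "('p, 'm::finite) metric_chart \<Rightarrow> ('q, 'n::finite) metric_chart \<Rightarrow> ('p \<Rightarrow> 'q) \<Rightarrow> (real^'m) set" where
  "loc_dom c d \<phi> = coord c ` (chart_dom c \<inter> \<phi> -` chart_dom d)"

text \<open>\<open>\<phi>\<^sup>*h = g\<close>, read in the charts \<open>c\<close> (with Gram matrix of \<open>g\<close>) and \<open>d\<close> (of \<open>h\<close>).\<close>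

definition isometric_in_charts ::
  "('p, 'm::finite) metric_chart \<Rightarrow> ('q, 'n::finite) metric_chart \<Rightarrow> ('p \<Rightarrow> 'q) \<Rightarrow> bool" where
  "isometric_in_charts c d \<phi> \<longleftrightarrow>
     (\<forall>x \<in> loc_dom c d \<phi>. \<forall>i j. gram c x $ i $ j =
        metric_ip (gram d) (loc_rep c d \<phi> x)
          (partial i (loc_rep c d \<phi>) x) (partial j (loc_rep c d \<phi>) x))"

definition riemannian_manifold :: "('p, 'n::finite) riem_space \<Rightarrow> bool" where
  "riemannian_manifold M \<longleftrightarrow>
     Hausdorff_space (top_of M) \<and> second_countable (top_of M) \<and>
     (\<Union>c \<in> atlas M. chart_dom c) = topspace (top_of M) \<and>
     (\<forall>c \<in> atlas M.
        openin (top_of M) (chart_dom c) \<and> open (coord c ` chart_dom c) \<and>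
        homeomorphic_map (subtopology (top_of M) (chart_dom c))
          (top_of_set (coord c ` chart_dom c)) (coord c) \<and>
        smooth_on (coord c ` chart_dom c) (gram c) \<and>
        (\<forall>x \<in> coord c ` chart_dom c. transpose (gram c x) = gram c x \<and>
           (\<forall>v. v \<noteq> 0 \<longrightarrow> metric_ip (gram c) x v v > 0))) \<and>
     (\<forall>c \<in> atlas M. \<forall>d \<in> atlas M.
        smooth_on (loc_dom c d id) (loc_rep c d id) \<and> isometric_in_charts c d id)"

definition smooth_map :: "('p, 'm::finite) riem_space \<Rightarrow> ('q, 'n::finite) riem_space \<Rightarrow> ('p \<Rightarrow> 'q) \<Rightarrow> bool" where
  "smooth_map M N \<phi> \<longleftrightarrow>
     continuous_map (top_of M) (top_of N) \<phi> \<and>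
     (\<forall>c \<in> atlas M. \<forall>d \<in> atlas N. smooth_on (loc_dom c d \<phi>) (loc_rep c d \<phi>))"


section \<open>Levi-Civita connection, tension field and bitension field in coordinates\<close>

text \<open>\<open>christoffel G x k i j\<close> is \<open>\<Gamma>\<^sup>k\<^sub>i\<^sub>j(x)\<close>.\<close>

definition christoffel :: "(real^'n \<Rightarrow> real^'n^'n) \<Rightarrow> real^'n \<Rightarrow> 'n \<Rightarrow> 'n \<Rightarrow> 'n \<Rightarrow> real" where
  "christoffel G x k i j = (1/2) * (\<Sum>l\<in>UNIV. matrix_inv (G x) $ k $ l *
     (partial i (\<lambda>y. G y $ j $ l) x + partial j (\<lambda>y. G y $ i $ l) x
        - partial l (\<lambda>y. G y $ i $ j) x))"

text \<open>
  \<open>curvature G x a b c d\<close> is the \<open>d\<close>-th component of \<open>R(\<partial>\<^sub>a, \<partial>\<^sub>b)\<partial>\<^sub>c\<close> for the convention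
  \<open>R(X,Y)Z = [\<nabla>\<^sub>X, \<nabla>\<^sub>Y]Z - \<nabla>\<^bsub>[X,Y]\<^esub>Z\<close>.
\<close>

definition curvature :: "(real^'n \<Rightarrow> real^'n^'n) \<Rightarrow> real^'n \<Rightarrow> 'n \<Rightarrow> 'n \<Rightarrow> 'n \<Rightarrow> 'n \<Rightarrow> real" where
  "curvature G x a b c d =
     partial a (\<lambda>y. christoffel G y d b c) x - partial b (\<lambda>y. christoffel G y d a c) x
     + (\<Sum>e\<in>UNIV. christoffel G x d a e * christoffel G x e b c
                  - christoffel G x d b e * christoffel G x e a c)"

definition curvature_op ::
  "(real^'n \<Rightarrow> real^'n^'n) \<Rightarrow> real^'n \<Rightarrow> real^'n \<Rightarrow> real^'n \<Rightarrow> real^'n \<Rightarrow> real^'n" where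
  "curvature_op G x X Y Z = (\<chi> d. \<Sum>a\<in>UNIV. \<Sum>b\<in>UNIV. \<Sum>c\<in>UNIV.
     X $ a * Y $ b * Z $ c * curvature G x a b c d)"

text \<open>
  Below, \<open>G\<close> and \<open>H\<close> are the Gram matrices of source and target and \<open>f\<close> is the
  coordinate expression of the map. \<open>cov_deriv H f i V\<close> is \<open>\<nabla>\<^sup>f\<close> in direction \<open>\<partial>\<^sub>i\<close>
  of the vector field \<open>V\<close> along \<open>f\<close>.
\<close>

definition cov_deriv ::
  "(real^'n \<Rightarrow> real^'n^'n) \<Rightarrow> (real^'m \<Rightarrow> real^'n) \<Rightarrow> 'm \<Rightarrow> (real^'m \<Rightarrow> real^'n) \<Rightarrow> real^'m \<Rightarrow> real^'n" where
  "cov_deriv H f i V x = partial i V x +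
     (\<chi> a. \<Sum>b\<in>UNIV. \<Sum>c\<in>UNIV. christoffel H (f x) a b c * partial i f x $ b * V x $ c)"

text \<open>\<open>(\<nabla>df)(\<partial>\<^sub>i, \<partial>\<^sub>j)\<close>; for an isometric immersion this is its second fundamental form.\<close>

definition nabla_d ::
  "(real^'m \<Rightarrow> real^'m^'m) \<Rightarrow> (real^'n \<Rightarrow> real^'n^'n) \<Rightarrow> (real^'m \<Rightarrow> real^'n) \<Rightarrow>
   real^'m \<Rightarrow> 'm \<Rightarrow> 'm \<Rightarrow> real^'n" where
  "nabla_d G H f x i j = cov_deriv H f i (partial j f) x
     - (\<Sum>k\<in>UNIV. christoffel G x k i j *\<^sub>R partial k f x)"

definition tension ::
  "(real^'m \<Rightarrow> real^'m^'m) \<Rightarrow> (real^'n \<Rightarrow> real^'n^'n) \<Rightarrow> (real^'m \<Rightarrow> real^'n) \<Rightarrow> real^'m \<Rightarrow> real^'n" where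
  "tension G H f x =
     (\<Sum>i\<in>UNIV. \<Sum>j\<in>UNIV. matrix_inv (G x) $ i $ j *\<^sub>R nabla_d G H f x i j)"

definition bitension ::
  "(real^'m \<Rightarrow> real^'m^'m) \<Rightarrow> (real^'n \<Rightarrow> real^'n^'n) \<Rightarrow> (real^'m \<Rightarrow> real^'n) \<Rightarrow> real^'m \<Rightarrow> real^'n" where
  "bitension G H f x = (let \<tau> = tension G H f in
     (\<Sum>i\<in>UNIV. \<Sum>j\<in>UNIV. matrix_inv (G x) $ i $ j *\<^sub>R
        (cov_deriv H f i (cov_deriv H f j \<tau>) x
         - (\<Sum>k\<in>UNIV. christoffel G x k i j *\<^sub>R cov_deriv H f k \<tau> x)))
     - (\<Sum>i\<in>UNIV. \<Sum>j\<in>UNIV. matrix_inv (G x) $ i $ j *\<^sub>R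
        curvature_op H (f x) (partial i f x) (\<tau> x) (partial j f x)))"

text \<open>
  A map is biharmonic if it solves the Euler-Lagrange equation of the bienergy,
  \<open>Trace (\<nabla>\<nabla> - \<nabla>\<^sub>\<nabla>) \<tau> - Trace R(d\<phi>, \<tau>) d\<phi> = 0\<close>.
\<close>

definition biharmonic_map :: "('p, 'm::finite) riem_space \<Rightarrow> ('q, 'n::finite) riem_space \<Rightarrow> ('p \<Rightarrow> 'q) \<Rightarrow> bool" where
  "biharmonic_map M N \<phi> \<longleftrightarrow> smooth_map M N \<phi> \<and>
     (\<forall>c \<in> atlas M. \<forall>d \<in> atlas N. \<forall>x \<in> loc_dom c d \<phi>.
        bitension (gram c) (gram d) (loc_rep c d \<phi>) x = 0)"


section \<open>Surfaces in three-dimensional Riemannian manifolds\<close>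

text \<open>
  A surface is an abstract connected nonempty two-manifold \<open>M\<close> with an immersion \<open>\<phi>\<close>, not
  necessarily injective, \<open>M\<close> carrying the metric induced by \<open>\<phi>\<close>. That \<open>\<phi>\<close> is an immersion
  follows from positive definiteness of the metric of \<open>M\<close>.
\<close>

definition surface :: "('p, 2) riem_space \<Rightarrow> ('q, 3) riem_space \<Rightarrow> ('p \<Rightarrow> 'q) \<Rightarrow> bool" where
  "surface M N \<phi> \<longleftrightarrow>
     riemannian_manifold M \<and> connected_space (top_of M) \<and> topspace (top_of M) \<noteq> {} \<and>
     smooth_map M N \<phi> \<and> (\<forall>c \<in> atlas M. \<forall>d \<in> atlas N. isometric_in_charts c d \<phi>)"

definition unit_normal ::
  "(real^3 \<Rightarrow> real^3^3) \<Rightarrow> (real^2 \<Rightarrow> real^3) \<Rightarrow> real^2 \<Rightarrow> real^3 \<Rightarrow> bool" where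
  "unit_normal H f x \<xi> \<longleftrightarrow> metric_ip H (f x) \<xi> \<xi> = 1 \<and>
     (\<forall>i. metric_ip H (f x) (partial i f x) \<xi> = 0)"

text \<open>
  Matrix of the shape operator \<open>A\<close> with respect to the normal \<open>\<xi>\<close>:
  \<open>g(A X, Y) = h(B(X, Y), \<xi>)\<close> with \<open>B\<close> the second fundamental form.
\<close>

definition shape_operator ::
  "(real^2 \<Rightarrow> real^2^2) \<Rightarrow> (real^3 \<Rightarrow> real^3^3) \<Rightarrow> (real^2 \<Rightarrow> real^3) \<Rightarrow> real^2 \<Rightarrow> real^3 \<Rightarrow> real^2^2" where
  "shape_operator G H f x \<xi> =
     matrix_inv (G x) ** (\<chi> i j. metric_ip H (f x) (nabla_d G H f x i j) \<xi>)"

definition principal_curvature ::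
  "(real^2 \<Rightarrow> real^2^2) \<Rightarrow> (real^3 \<Rightarrow> real^3^3) \<Rightarrow> (real^2 \<Rightarrow> real^3) \<Rightarrow> real^2 \<Rightarrow> real^3 \<Rightarrow> real \<Rightarrow> bool" where
  "principal_curvature G H f x \<xi> k \<longleftrightarrow>
     (\<exists>v. v \<noteq> 0 \<and> shape_operator G H f x \<xi> *v v = k *\<^sub>R v)"

definition mean_curvature ::
  "(real^2 \<Rightarrow> real^2^2) \<Rightarrow> (real^3 \<Rightarrow> real^3^3) \<Rightarrow> (real^2 \<Rightarrow> real^3) \<Rightarrow> real^2 \<Rightarrow> real^3 \<Rightarrow> real" where
  "mean_curvature G H f x \<xi> = trace (shape_operator G H f x \<xi>) / 2"

text \<open>
  The shape operator is self-adjoint, hence diagonalizable: its two eigenvalues (with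
  multiplicity) coincide iff exactly one real number is an eigenvalue. Both unit normals at
  a point are considered, so that no orientation is needed.
\<close>

definition totally_umbilical :: "('p, 2) riem_space \<Rightarrow> ('q, 3) riem_space \<Rightarrow> ('p \<Rightarrow> 'q) \<Rightarrow> bool" where
  "totally_umbilical M N \<phi> \<longleftrightarrow>
     (\<forall>c \<in> atlas M. \<forall>d \<in> atlas N. \<forall>x \<in> loc_dom c d \<phi>. \<forall>\<xi>.
        unit_normal (gram d) (loc_rep c d \<phi>) x \<xi> \<longrightarrow>
        (\<exists>!k. principal_curvature (gram c) (gram d) (loc_rep c d \<phi>) x \<xi> k))"

definition minimal :: "('p, 2) riem_space \<Rightarrow> ('q, 3) riem_space \<Rightarrow> ('p \<Rightarrow> 'q) \<Rightarrow> bool" where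
  "minimal M N \<phi> \<longleftrightarrow>
     (\<forall>c \<in> atlas M. \<forall>d \<in> atlas N. \<forall>x \<in> loc_dom c d \<phi>. \<forall>\<xi>.
        unit_normal (gram d) (loc_rep c d \<phi>) x \<xi> \<longrightarrow>
        mean_curvature (gram c) (gram d) (loc_rep c d \<phi>) x \<xi> = 0)"

definition proper_biharmonic :: "('p, 2) riem_space \<Rightarrow> ('q, 3) riem_space \<Rightarrow> ('p \<Rightarrow> 'q) \<Rightarrow> bool" where
  "proper_biharmonic M N \<phi> \<longleftrightarrow> biharmonic_map M N \<phi> \<and> \<not> minimal M N \<phi>"


section \<open>The eight geometries\<close>

text \<open>
  Six of them live on an open set of \<open>\<real>\<^sup>3\<close> with global coordinates \<open>(x, y, z)\<close> and a metric
  that is a sum of squares of three one-forms, each given by its coefficients with respect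
  to \<open>dx, dy, dz\<close>.
\<close>

definition coord_space ::
  "(real^3) set \<Rightarrow> (real^3 \<Rightarrow> real^3) \<Rightarrow> (real^3 \<Rightarrow> real^3) \<Rightarrow> (real^3 \<Rightarrow> real^3) \<Rightarrow> (real^3, 3) riem_space" where
  "coord_space U \<alpha> \<beta> \<gamma> = \<lparr>top_of = top_of_set U, atlas =
     {\<lparr>chart_dom = U, coord = id, gram = (\<lambda>p. \<chi> i j.
         \<alpha> p $ i * \<alpha> p $ j + \<beta> p $ i * \<beta> p $ j + \<gamma> p $ i * \<gamma> p $ j)\<rparr>}\<rparr>"

definition Euclidean3 :: "(real^3, 3) riem_space" where
  "Euclidean3 = coord_space UNIV
     (\<lambda>p. vector [1, 0, 0]) (\<lambda>p. vector [0, 1, 0]) (\<lambda>p. vector [0, 0, 1])"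

text \<open>Upper half-space model.\<close>

definition Hyperbolic3 :: "(real^3, 3) riem_space" where
  "Hyperbolic3 = coord_space {p. p $ 3 > 0}
     (\<lambda>p. vector [1 / p $ 3, 0, 0]) (\<lambda>p. vector [0, 1 / p $ 3, 0]) (\<lambda>p. vector [0, 0, 1 / p $ 3])"

text \<open>Upper half-plane model \<open>y > 0\<close> for the first factor, \<open>z\<close> being the coordinate of the line.\<close>

definition H2_times_R :: "(real^3, 3) riem_space" where
  "H2_times_R = coord_space {p. p $ 2 > 0}
     (\<lambda>p. vector [1 / p $ 2, 0, 0]) (\<lambda>p. vector [0, 1 / p $ 2, 0]) (\<lambda>p. vector [0, 0, 1])"

definition Sol :: "(real^3, 3) riem_space" where
  "Sol = coord_space UNIV
     (\<lambda>p. vector [exp (p $ 3), 0, 0]) (\<lambda>p. vector [0, exp (- (p $ 3)), 0]) (\<lambda>p. vector [0, 0, 1])"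

text \<open>The Bianchi-Cartan-Vranceanu spaces.\<close>

definition BCV :: "real \<Rightarrow> real \<Rightarrow> (real^3, 3) riem_space" where
  "BCV m l = (let F = (\<lambda>p::real^3. 1 + m * ((p $ 1)\<^sup>2 + (p $ 2)\<^sup>2)) in
     coord_space {p. F p > 0}
       (\<lambda>p. vector [1 / F p, 0, 0]) (\<lambda>p. vector [0, 1 / F p, 0])
       (\<lambda>p. vector [l / 2 * (p $ 2 / F p), - (l / 2 * (p $ 1 / F p)), 1]))"

text \<open>
  \<open>S\<^sup>3 \<subseteq> \<real>\<^sup>4\<close> and \<open>S\<^sup>2 \<times> \<real> \<subseteq> \<real>\<^sup>3 \<times> \<real>\<close> carry the metric induced from the Euclidean inner product.
  They are covered by the two charts given by stereographic projection of the sphere from the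
  poles \<open>(0, \<dots>, 0, s)\<close>, \<open>s = 1, -1\<close>. These charts are onto \<open>\<real>\<^sup>3\<close>, so the inverses are
  unambiguous everywhere.
\<close>

definition embedded_chart ::
  "'p set \<Rightarrow> ('p::real_inner \<Rightarrow> real^3) \<Rightarrow> ('p, 3) metric_chart" where
  "embedded_chart U X = \<lparr>chart_dom = U, coord = X, gram = (\<lambda>x. \<chi> i j.
     partial i (inv_into U X) x \<bullet> partial j (inv_into U X) x)\<rparr>"

definition Sphere3 :: "(real^4, 3) riem_space" where
  "Sphere3 = \<lparr>top_of = top_of_set (sphere 0 1), atlas =
     (\<lambda>s. embedded_chart {p \<in> sphere 0 1. p $ 4 \<noteq> s}
        (\<lambda>p. (1 / (1 - s * p $ 4)) *\<^sub>R vector [p $ 1, p $ 2, p $ 3])) ` {1, -1}\<rparr>"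

definition S2_times_R :: "((real^3) \<times> real, 3) riem_space" where
  "S2_times_R = \<lparr>top_of = top_of_set (sphere 0 1 \<times> UNIV), atlas =
     (\<lambda>s. embedded_chart ({p \<in> sphere 0 1. p $ 3 \<noteq> s} \<times> UNIV)
        (\<lambda>(p, t). vector [p $ 1 / (1 - s * p $ 3), p $ 2 / (1 - s * p $ 3), t])) ` {1, -1}\<rparr>"

text \<open>
  \<open>S\<^sup>2(1/\<surd>2)\<close> is the section of \<open>S\<^sup>3\<close> by a hyperplane \<open>{p. u \<bullet> p = 1/\<surd>2}\<close>, \<open>u\<close> a unit
  vector, i.e. by any hyperplane at distance \<open>1/\<surd>2\<close> from the origin.
\<close>

definition part_of_small_sphere :: "('p, 2) riem_space \<Rightarrow> ('p \<Rightarrow> real^4) \<Rightarrow> bool" where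
  "part_of_small_sphere M \<phi> \<longleftrightarrow>
     (\<exists>u. norm u = 1 \<and>
        openin (top_of_set (sphere 0 1 \<inter> {p. u \<bullet> p = 1 / sqrt 2})) (\<phi> ` topspace (top_of M)))"

end

theory Submission
  imports Defs
begin

text \<open>
  Write \<open>A = h I\<close> for the shape operator of a totally umbilical surface with unit normal \<open>\<xi>\<close>, so that
  the tension field is \<open>2h\<xi>\<close>. Codazzi's equation gives \<open>grad h = Ric(\<xi>)\<^sup>\<top>\<close>, and the tangential part of
  the bitension field is then a multiple of \<open>h grad h\<close>; hence a biharmonic \<open>h\<close> is locally constant. Where
  \<open>h \<noteq> 0\<close>, the normal part yields \<open>2h\<^sup>2 = Ric(\<xi>, \<xi>)\<close>, and \<open>\<xi>\<close> is an eigenvector of the Ricci tensor.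

  In an orthonormal frame adapted to the geometry, each of the eight spaces has curvature
  \<open>R(X, Y)Z = S(X \<times> Y) \<times> Z\<close> with \<open>S = diag(s, s, t)\<close>, where \<open>(s, t)\<close> is \<open>(0,0)\<close> for \<open>\<real>\<^sup>3\<close>,
  \<open>(-1,-1)\<close> for \<open>S\<^sup>3\<close>, \<open>(1,1)\<close> for \<open>H\<^sup>3\<close>, \<open>(0,-1)\<close> for \<open>S\<^sup>2 \<times> \<real>\<close>, \<open>(0,1)\<close> for \<open>H\<^sup>2 \<times> \<real>\<close>, \<open>(1,-1)\<close> for Sol
  and \<open>(-l\<^sup>2/4, 3l\<^sup>2/4 - 4m)\<close> for the Bianchi-Cartan-Vranceanu spaces. Outside \<open>S\<^sup>3\<close>, either
  \<open>Ric(\<xi>, \<xi>) \<le> 0\<close> or the vertical Killing field forces \<open>h = 0\<close>. In \<open>S\<^sup>3\<close> one gets \<open>h\<^sup>2 = 1\<close>, so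
  \<open>\<xi> + h \<phi>\<close> is a locally constant vector of \<open>\<real>\<^sup>4\<close> of length \<open>\<surd>2\<close>, normal to the hyperplane that
  contains the surface.
\<close>

section \<open>Calculus of smooth maps\<close>

text \<open>All notions are given by Christoffel symbols in arbitrary charts, where the bitension
  field is intractable. In frame components the covariant derivative along the surface is the
  partial derivative plus a cross product with the pulled back connection form; the structure
  equations replace the ambient symbols, and those of the surface cancel except in the Laplacian of
  \<open>h\<close>. The tangential part consists of \<open>-6h grad h\<close> from the rough
  Laplacian and, through Codazzi, \<open>2h grad h\<close> from the curvature, so the factor -4 of
  \<open>h grad h\<close> is nonzero. Division by \<open>h\<close> is confined to open sets without
  zeros of \<open>h\<close>, hence the arguments by contradiction at a point. In the three-sphere
  the alternative \<open>h = 0\<close> or \<open>h^2 = 1\<close> is only local: a priori a surface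
  could be totally geodesic in one place and not in another. To exclude this, each piece is attached
  to a hyperplane at distance 0 or \<open>1/sqrt 2\<close>, and overlapping pieces are shown to
  share it once one of them has distance \<open>1/sqrt 2\<close>. Being a part of the small sphere
  is openness of the image of an immersion, which takes a separate local argument.\<close>

lemma frechet_derivative_eqI:
  "(f has_derivative f') (at x) \<Longrightarrow> frechet_derivative f (at x) = f'"
  by (metis frechet_derivative_at)

text \<open>Derivatives are taken at \<open>at x\<close> in the whole space, so on an open
  \<open>S\<close> they see only the values on \<open>S\<close>. The auxiliary claim
  \<open>D\<close> is one implication, with both functions generalised for the induction; symmetry
  gives the other.\<close>

lemma Ck_on_cong:
  assumes "open S" "\<And>x. x \<in> S \<Longrightarrow> f x = g x"
  shows "Ck_on k f S \<longleftrightarrow> Ck_on k g S"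
proof -
  have D: "Ck_on k f S \<Longrightarrow> \<forall>x\<in>S. f x = g x \<Longrightarrow> Ck_on k g S" for k and f g :: "'a \<Rightarrow> 'b"
  proof (induction k arbitrary: f g)
    case 0
    then show ?case by (auto cong: continuous_on_cong)
  next
    case (Suc k)
    have eq: "frechet_derivative f (at x) = frechet_derivative g (at x)" if "x \<in> S" for x
    proof (rule frechet_derivative_transform_within_open[OF _ \<open>open S\<close> that])
      show "f differentiable (at x)"
        using Suc.prems(1) that \<open>open S\<close> by (simp add: differentiable_on_eq_differentiable_at)
      show "\<And>x. x \<in> S \<Longrightarrow> f x = g x" using Suc.prems(2) by blast
    qed
    have "g differentiable_on S"
    proof -
      have "g differentiable (at x)" if "x \<in> S" for x
        using Suc.prems that \<open>open S\<close>
        by (intro has_derivative_transform_within_open[THEN differentiableI, of f "frechet_derivative f (at x)" x UNIV S g])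
           (simp_all add: differentiable_on_eq_differentiable_at frechet_derivative_works[symmetric])
      then show ?thesis using \<open>open S\<close> by (simp add: differentiable_on_eq_differentiable_at)
    qed
    moreover have "Ck_on k (\<lambda>x. frechet_derivative g (at x) v) S" for v
      by (rule Suc.IH[of "\<lambda>x. frechet_derivative f (at x) v"]) (use Suc.prems(1) eq in simp_all)
    ultimately show ?case by simp
  qed
  show ?thesis using D[of k f g] D[of k g f] assms(2) by auto
qed

text \<open>The closure proofs for products, compositions and special functions go through this
  rule: it trades \<open>frechet_derivative\<close> for any explicit derivative
  \<open>f'\<close>.\<close>

lemma Ck_on_SucI:
  assumes "open S" "\<And>x. x \<in> S \<Longrightarrow> (f has_derivative f' x) (at x)"
    "\<And>v. Ck_on k (\<lambda>x. f' x v) S"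
  shows "Ck_on (Suc k) f S"
proof -
  have "f differentiable_on S"
    using assms(1,2) by (metis differentiable_def differentiable_on_eq_differentiable_at)
  moreover have "Ck_on k (\<lambda>x. frechet_derivative f (at x) v) S" for v
    using assms(3)[of v] assms(1)
    by (subst Ck_on_cong[where g = "\<lambda>x. f' x v"]) (simp_all add: frechet_derivative_eqI[OF assms(2)])
  ultimately show ?thesis by simp
qed

lemma Ck_on_Suc_has_derivative:
  assumes "open S" "Ck_on (Suc k) f S" "x \<in> S"
  shows "(f has_derivative frechet_derivative f (at x)) (at x)"
  using assms by (simp add: differentiable_on_eq_differentiable_at frechet_derivative_works[symmetric])

lemma Ck_on_Suc_imp: "Ck_on (Suc k) f S \<Longrightarrow> Ck_on k f S"
proof (induction k arbitrary: f)
  case 0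
  then show ?case by (simp add: differentiable_imp_continuous_on)
next
  case (Suc k)
  then show ?case using Ck_on.simps(2) by blast
qed

lemma Ck_on_const: "open S \<Longrightarrow> Ck_on k (\<lambda>x. c) S"
  by (induction k arbitrary: c) auto

lemma Ck_on_add:
  assumes "open S" "Ck_on k f S" "Ck_on k g S"
  shows "Ck_on k (\<lambda>x. f x + g x) S"
  using assms(2,3)
proof (induction k arbitrary: f g)
  case 0
  then show ?case by (auto intro: continuous_on_add)
next
  case (Suc k)
  show ?case
    by (rule Ck_on_SucI[OF \<open>open S\<close> has_derivative_add
          [OF Ck_on_Suc_has_derivative[OF \<open>open S\<close> Suc.prems(1)]
              Ck_on_Suc_has_derivative[OF \<open>open S\<close> Suc.prems(2)]]])
       (use Suc in \<open>auto intro!: Suc.IH\<close>)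
qed

lemma Ck_on_sum:
  assumes "open S" "\<And>i. i \<in> I \<Longrightarrow> Ck_on k (f i) S"
  shows "Ck_on k (\<lambda>x. \<Sum>i\<in>I. f i x) S"
  using assms by (induction I rule: infinite_finite_induct) (auto intro: Ck_on_const Ck_on_add)

text \<open>The product rule gives two terms of the same bilinear shape, each with one
  differentiated factor, so the induction hypothesis applies once \<open>f\<close> and
  \<open>g\<close> are generalised. Scalar multiples, inner products, matrix-vector products and
  cross products are instances.\<close>

lemma Ck_on_bilinear:
  assumes "open S" "bounded_bilinear b" "Ck_on k f S" "Ck_on k g S"
  shows "Ck_on k (\<lambda>x. b (f x) (g x)) S"
  using assms(3,4)
proof (induction k arbitrary: f g)
  case 0
  then show ?case
    using bounded_bilinear.continuous_on[OF assms(2)] by simp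
next
  case (Suc k)
  show ?case
  proof (rule Ck_on_SucI[OF \<open>open S\<close> bounded_bilinear.FDERIV[OF assms(2)
          Ck_on_Suc_has_derivative[OF \<open>open S\<close> Suc.prems(1)]
          Ck_on_Suc_has_derivative[OF \<open>open S\<close> Suc.prems(2)]]])
    show "Ck_on k (\<lambda>x. b (f x) (frechet_derivative g (at x) v)
        + b (frechet_derivative f (at x) v) (g x)) S" for v
      using Suc.prems Ck_on_Suc_imp[OF Suc.prems(1)] Ck_on_Suc_imp[OF Suc.prems(2)]
      by (intro Ck_on_add[OF \<open>open S\<close>] Suc.IH) auto
  qed auto
qed

lemma Ck_on_linear:
  assumes "open S" "bounded_linear b" "Ck_on k f S"
  shows "Ck_on k (\<lambda>x. b (f x)) S"
  using assms(3)
proof (induction k arbitrary: f)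
  case 0
  then show ?case
    using bounded_linear.continuous_on[OF assms(2)] by simp
next
  case (Suc k)
  show ?case
  proof (rule Ck_on_SucI[OF \<open>open S\<close> bounded_linear.has_derivative[OF assms(2)
          Ck_on_Suc_has_derivative[OF \<open>open S\<close> Suc.prems]]])
    show "Ck_on k (\<lambda>x. b (frechet_derivative f (at x) v)) S" for v
      using Suc.prems by (intro Suc.IH) auto
  qed auto
qed

lemma Ck_on_ident: "open S \<Longrightarrow> Ck_on k (\<lambda>x. x) S"
  by (cases k) (auto intro: Ck_on_const)

lemma Ck_on_compose:
  fixes f :: "'a::euclidean_space \<Rightarrow> 'b::euclidean_space" and g :: "'b \<Rightarrow> 'c::real_normed_vector"
  assumes "open S" "open T" "f ` S \<subseteq> T" "Ck_on k f S" "Ck_on k g T"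
  shows "Ck_on k (\<lambda>x. g (f x)) S"
  using assms(4,5)
proof (induction k arbitrary: g)
  case 0
  then show ?case
    using assms(3) by (auto intro: continuous_on_compose2)
next
  case (Suc k)
  let ?f' = "\<lambda>x. frechet_derivative f (at x)" and ?g' = "\<lambda>y. frechet_derivative g (at y)"
  have g: "(g has_derivative ?g' (f x)) (at (f x))" if "x \<in> S" for x
    using that assms(2,3) Suc.prems(2) Ck_on_Suc_has_derivative by blast
  \<comment> \<open>In \<open>g' (f x) (f' x v)\<close> both the base point and the argument depend
    on \<open>x\<close>. Expanding the argument in \<open>Basis\<close> separates them into scalar
    coefficients times the functions \<open>g' (f x) b\<close>, to which the induction hypothesis
    applies.\<close>
  have "(\<lambda>v. ?g' (f x) (?f' x v)) = (\<lambda>v. \<Sum>b\<in>Basis. (?f' x v \<bullet> b) *\<^sub>R ?g' (f x) b)" if "x \<in> S" for x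
  proof
    fix v
    have lin: "linear (?g' (f x))"
      using g[OF that] has_derivative_linear by blast
    have "?g' (f x) (?f' x v) = ?g' (f x) (\<Sum>b\<in>Basis. (?f' x v \<bullet> b) *\<^sub>R b)"
      by (simp add: euclidean_representation)
    then show "?g' (f x) (?f' x v) = (\<Sum>b\<in>Basis. (?f' x v \<bullet> b) *\<^sub>R ?g' (f x) b)"
      by (simp add: linear_sum[OF lin] linear_scale[OF lin])
  qed
  then have "((\<lambda>x. g (f x)) has_derivative (\<lambda>v. \<Sum>b\<in>Basis. (?f' x v \<bullet> b) *\<^sub>R ?g' (f x) b)) (at x)"
    if "x \<in> S" for x
    using has_derivative_compose[OF Ck_on_Suc_has_derivative[OF \<open>open S\<close> Suc.prems(1) that] g[OF that]] that
    by simp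
  then show ?case
  proof (rule Ck_on_SucI[OF \<open>open S\<close>])
    fix v
    have "Ck_on k f S"
      using Suc.prems(1) by (rule Ck_on_Suc_imp)
    then show "Ck_on k (\<lambda>x. \<Sum>b\<in>Basis. (?f' x v \<bullet> b) *\<^sub>R ?g' (f x) b) S"
      using Suc.prems
      by (intro Ck_on_sum Ck_on_bilinear[OF _ bounded_bilinear_scaleR] Suc.IH
          Ck_on_linear[OF _ bounded_linear_inner_left] \<open>open S\<close>) auto
  qed
qed

text \<open>The derivative is built from \<open>inverse\<close> itself, so regularity of order
  \<open>k\<close> feeds its own next step; \<open>exp\<close> and \<open>sqrt\<close> below follow
  the same pattern.\<close>

lemma Ck_on_inverse:
  fixes S :: "real set"
  assumes "open S" "0 \<notin> S"
  shows "Ck_on k inverse S"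
proof (induction k)
  case 0
  then show ?case using assms by (auto intro!: continuous_on_inverse continuous_on_id)
next
  case (Suc k)
  show ?case
  proof (rule Ck_on_SucI[OF \<open>open S\<close>])
    show "(inverse has_derivative (\<lambda>h. - (inverse x * h * inverse x))) (at x)" if "x \<in> S" for x
      using that assms(2) by (metis has_derivative_inverse')
    have "Ck_on k (\<lambda>x. (- v) *\<^sub>R (inverse x * inverse x)) S" for v
      by (intro Ck_on_linear[OF _ bounded_linear_scaleR_right]
          Ck_on_bilinear[OF _ bounded_bilinear_mult] Suc assms(1))
    then show "Ck_on k (\<lambda>x. - (inverse x * v * inverse x)) S" for v
      by (simp add: mult.commute mult.left_commute)
  qed
qed

lemma Ck_on_exp: "open S \<Longrightarrow> Ck_on k (exp :: real \<Rightarrow> real) S"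
proof (induction k)
  case 0
  then show ?case by (auto intro!: continuous_on_exp continuous_on_id)
next
  case (Suc k)
  show ?case
  proof (rule Ck_on_SucI[OF \<open>open S\<close>])
    show "(exp has_derivative (\<lambda>h. h * exp x)) (at x)" for x :: real
      by (auto intro!: derivative_eq_intros)
    have "Ck_on k (\<lambda>x. v *\<^sub>R exp x) S" for v :: real
      using Suc by (intro Ck_on_linear[OF _ bounded_linear_scaleR_right]) auto
    then show "Ck_on k (\<lambda>x. v * exp x) S" for v :: real
      by simp
  qed
qed

lemma Ck_on_sqrt:
  assumes "open S" "S \<subseteq> {0<..}"
  shows "Ck_on k sqrt S"
proof (induction k)
  case 0
  then show ?case by (auto intro!: continuous_on_real_sqrt continuous_on_id)
next
  case (Suc k)
  show ?case
  proof (rule Ck_on_SucI[OF \<open>open S\<close>])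
    show "(sqrt has_derivative (\<lambda>h. h *\<^sub>R (inverse (sqrt x) / 2))) (at x)" if "x \<in> S" for x
      using that assms(2)
      by (intro has_derivative_eq_rhs[OF DERIV_real_sqrt[of x, unfolded has_field_derivative_def]]) auto
    have "Ck_on k (\<lambda>x. inverse (sqrt x)) S"
      using assms(2)
      by (intro Ck_on_compose[OF assms(1) open_greaterThan _ Suc Ck_on_inverse[OF open_greaterThan, of 0]]) auto
    then have "Ck_on k (\<lambda>x. (v / 2) *\<^sub>R inverse (sqrt x)) S" for v :: real
      by (intro Ck_on_linear[OF _ bounded_linear_scaleR_right] assms(1))
    then show "Ck_on k (\<lambda>x. v *\<^sub>R (inverse (sqrt x) / 2)) S" for v :: real
      by simp
  qed
qed

section \<open>Closure properties of smooth maps\<close>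

lemma smooth_on_cong:
  "open S \<Longrightarrow> (\<And>x. x \<in> S \<Longrightarrow> f x = g x) \<Longrightarrow> smooth_on S f \<longleftrightarrow> smooth_on S g"
  unfolding smooth_on_def using Ck_on_cong by blast

lemma smooth_on_has_derivative:
  "open S \<Longrightarrow> smooth_on S f \<Longrightarrow> x \<in> S \<Longrightarrow> (f has_derivative frechet_derivative f (at x)) (at x)"
  unfolding smooth_on_def using Ck_on_Suc_has_derivative by blast

lemma smooth_on_differentiable:
  "open S \<Longrightarrow> smooth_on S f \<Longrightarrow> x \<in> S \<Longrightarrow> f differentiable (at x)"
  using smooth_on_has_derivative differentiable_def by blast

lemma smooth_on_continuous_on: "smooth_on S f \<Longrightarrow> continuous_on S f"
  unfolding smooth_on_def by (metis Ck_on.simps(1))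

lemma smooth_on_frechet_derivative:
  "smooth_on S f \<Longrightarrow> smooth_on S (\<lambda>x. frechet_derivative f (at x) v)"
  unfolding smooth_on_def by (metis Ck_on.simps(2))

lemma smooth_on_partial: "smooth_on S f \<Longrightarrow> smooth_on S (partial i f)"
  using smooth_on_frechet_derivative by (simp add: partial_def[abs_def])

lemma smooth_on_const: "open S \<Longrightarrow> smooth_on S (\<lambda>x. c)"
  by (simp add: smooth_on_def Ck_on_const)

lemma smooth_on_ident: "open S \<Longrightarrow> smooth_on S (\<lambda>x. x)"
  by (simp add: smooth_on_def Ck_on_ident)

lemma smooth_on_add:
  "open S \<Longrightarrow> smooth_on S f \<Longrightarrow> smooth_on S g \<Longrightarrow> smooth_on S (\<lambda>x. f x + g x)"
  by (simp add: smooth_on_def Ck_on_add)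

lemma smooth_on_sum:
  "open S \<Longrightarrow> (\<And>i. i \<in> I \<Longrightarrow> smooth_on S (f i)) \<Longrightarrow> smooth_on S (\<lambda>x. \<Sum>i\<in>I. f i x)"
  by (simp add: smooth_on_def Ck_on_sum)

lemma smooth_on_linear:
  "open S \<Longrightarrow> bounded_linear b \<Longrightarrow> smooth_on S f \<Longrightarrow> smooth_on S (\<lambda>x. b (f x))"
  by (simp add: smooth_on_def Ck_on_linear)

lemma smooth_on_bilinear:
  "open S \<Longrightarrow> bounded_bilinear b \<Longrightarrow> smooth_on S f \<Longrightarrow> smooth_on S g
    \<Longrightarrow> smooth_on S (\<lambda>x. b (f x) (g x))"
  by (simp add: smooth_on_def Ck_on_bilinear)

lemmas smooth_on_scaleR = smooth_on_bilinear[OF _ bounded_bilinear_scaleR]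
lemmas smooth_on_inner = smooth_on_bilinear[OF _ bounded_bilinear_inner]

lemma smooth_on_mult:
  fixes f g :: "'a::euclidean_space \<Rightarrow> real"
  shows "open S \<Longrightarrow> smooth_on S f \<Longrightarrow> smooth_on S g \<Longrightarrow> smooth_on S (\<lambda>x. f x * g x)"
  by (rule smooth_on_bilinear[OF _ bounded_bilinear_mult])

lemma smooth_on_minus: "open S \<Longrightarrow> smooth_on S f \<Longrightarrow> smooth_on S (\<lambda>x. - f x)"
  by (rule smooth_on_linear[OF _ bounded_linear_minus[OF bounded_linear_ident]])

lemma smooth_on_diff:
  "open S \<Longrightarrow> smooth_on S f \<Longrightarrow> smooth_on S g \<Longrightarrow> smooth_on S (\<lambda>x. f x - g x)"
  using smooth_on_add[of S f "\<lambda>x. - g x"] smooth_on_minus[of S g] by simp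

lemma smooth_on_compose:
  fixes f :: "'a::euclidean_space \<Rightarrow> 'b::euclidean_space" and g :: "'b \<Rightarrow> 'c::real_normed_vector"
  shows "open S \<Longrightarrow> open T \<Longrightarrow> f ` S \<subseteq> T \<Longrightarrow> smooth_on S f \<Longrightarrow> smooth_on T g
    \<Longrightarrow> smooth_on S (\<lambda>x. g (f x))"
  by (simp add: smooth_on_def Ck_on_compose)

lemma smooth_on_inverse:
  fixes f :: "'a::euclidean_space \<Rightarrow> real"
  assumes "open S" "smooth_on S f" "\<And>x. x \<in> S \<Longrightarrow> f x \<noteq> 0"
  shows "smooth_on S (\<lambda>x. inverse (f x))"
  using assms
  by (intro smooth_on_compose[of S "- {0}" f inverse]) (auto simp: smooth_on_def intro!: Ck_on_inverse)

lemma smooth_on_divide: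
  fixes f g :: "'a::euclidean_space \<Rightarrow> real"
  shows "open S \<Longrightarrow> smooth_on S f \<Longrightarrow> smooth_on S g \<Longrightarrow> (\<And>x. x \<in> S \<Longrightarrow> g x \<noteq> 0)
    \<Longrightarrow> smooth_on S (\<lambda>x. f x / g x)"
  by (simp add: divide_inverse smooth_on_mult smooth_on_inverse)

lemma smooth_on_exp:
  fixes f :: "'a::euclidean_space \<Rightarrow> real"
  shows "open S \<Longrightarrow> smooth_on S f \<Longrightarrow> smooth_on S (\<lambda>x. exp (f x))"
  by (intro smooth_on_compose[of S UNIV f exp]) (auto simp: smooth_on_def intro!: Ck_on_exp)

lemma smooth_on_sqrt:
  assumes "open S" "smooth_on S f" "\<And>x. x \<in> S \<Longrightarrow> f x > 0"
  shows "smooth_on S (\<lambda>x. sqrt (f x))"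
  using assms
  by (intro smooth_on_compose[of S "{0<..}" f sqrt]) (auto simp: smooth_on_def intro!: Ck_on_sqrt)

lemma smooth_on_vec_nth: "open S \<Longrightarrow> smooth_on S f \<Longrightarrow> smooth_on S (\<lambda>x. f x $ i)"
  by (rule smooth_on_linear[OF _ bounded_linear_vec_nth])

lemma bounded_linear_axis: "bounded_linear (axis i :: 'b::euclidean_space \<Rightarrow> 'b^'n)"
  by (intro linear_conv_bounded_linear[THEN iffD1] linearI) (auto simp: axis_def vec_eq_iff)

lemma smooth_on_vecI:
  fixes f :: "'a::euclidean_space \<Rightarrow> 'b::euclidean_space^'n"
  assumes "open S" "\<And>i. smooth_on S (\<lambda>x. f x $ i)"
  shows "smooth_on S f"
proof -
  have "smooth_on S (\<lambda>x. \<Sum>i\<in>UNIV. axis i (f x $ i))"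
    by (intro smooth_on_sum smooth_on_linear[OF _ bounded_linear_axis] assms)
  moreover have "(\<Sum>i\<in>UNIV. axis i (f x $ i)) = f x" for x
    by (simp add: vec_eq_iff sum_component axis_def if_distrib cong: if_cong)
  ultimately show ?thesis by simp
qed

lemma bounded_bilinear_matrix_vector_mult:
  "bounded_bilinear ((*v) :: real^'n^'m \<Rightarrow> real^'n \<Rightarrow> real^'m)"
  by (rule bilinear_conv_bounded_bilinear[THEN iffD1])
     (auto simp: bilinear_def algebra_simps matrix_vector_mult_def vec_eq_iff sum_distrib_left
       sum.distrib intro!: linearI)

lemmas smooth_on_matrix_vector_mult =
  smooth_on_bilinear[OF _ bounded_bilinear_matrix_vector_mult]

lemma bounded_bilinear_cross3: "bounded_bilinear cross3"
  using bilinear_cross by (simp add: bilinear_conv_bounded_bilinear)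

lemmas smooth_on_cross3 = smooth_on_bilinear[OF _ bounded_bilinear_cross3]

subsection \<open>Symmetry of second derivatives\<close>

text \<open>The mean value theorem along \<open>u\<close> turns the second difference into an
  increment of \<open>f' _ u\<close> between two points, which the linearisation of that function at
  \<open>x\<close> evaluates up to an error small compared with \<open>t\<close>.\<close>

lemma second_difference_limit:
  fixes f :: "'a::real_normed_vector \<Rightarrow> real"
  assumes S: "open S" "x \<in> S" and f: "\<And>y. y \<in> S \<Longrightarrow> (f has_derivative f' y) (at y)"
    and A: "((\<lambda>y. f' y u) has_derivative A) (at x)"
  shows "((\<lambda>t. (f (x + t *\<^sub>R u + t *\<^sub>R v) - f (x + t *\<^sub>R u) - f (x + t *\<^sub>R v) + f x) / t\<^sup>2)
           \<longlongrightarrow> A v) (at_right 0)"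
proof -
  define D where "D t = f (x + t *\<^sub>R u + t *\<^sub>R v) - f (x + t *\<^sub>R u) - f (x + t *\<^sub>R v) + f x" for t
  define g where "g y = f' y u" for y
  \<comment> \<open>\<open>t * K\<close> bounds the norm of every displacement
    \<open>s u + q v\<close> with \<open>s\<close> and \<open>q\<close> between 0 and
    \<open>t\<close>; the summand 1 keeps \<open>K\<close> positive.\<close>
  define K where "K = 2 * norm u + norm v + 1"
  have K: "K > 0" by (simp add: K_def add_nonneg_pos)
  interpret A: bounded_linear A using A by (rule has_derivative_bounded_linear)
  obtain r where r: "r > 0" "ball x r \<subseteq> S"
    using S openE by blast
  have "\<forall>\<^sub>F t in at_right 0. \<bar>D t / t\<^sup>2 - A v\<bar> < e" if "e > 0" for e
  proof -
    \<comment> \<open>With this tolerance each of the two linearisation errors is at most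
      \<open>t * e / 4\<close>, so the quotient ends within \<open>e / 2\<close>.\<close>
    have "e / (4 * K) > 0" using that K by simp
    then obtain d where d: "d > 0"
      and gd: "\<And>y. norm (y - x) < d \<Longrightarrow> norm (g y - g x - A (y - x)) \<le> e / (4 * K) * norm (y - x)"
      using A unfolding has_derivative_at_alt g_def by blast
    define t0 where "t0 = min r d / K"
    have "\<bar>D t / t\<^sup>2 - A v\<bar> < e" if t: "0 < t" "t < t0" for t
    proof -
      have tK: "t * K < r" "t * K < d"
        using t K by (auto simp: t0_def field_simps split: if_splits)
      have small: "norm (s *\<^sub>R u + q *\<^sub>R v) \<le> t * K" if "0 \<le> s" "s \<le> t" "0 \<le> q" "q \<le> t" for s q
      proof -
        have "norm (s *\<^sub>R u + q *\<^sub>R v) \<le> s * norm u + q * norm v"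
          using norm_triangle_ineq[of "s *\<^sub>R u" "q *\<^sub>R v"] that by simp
        also have "\<dots> \<le> t * norm u + t * norm v"
          using that by (intro add_mono mult_right_mono) auto
        also have "\<dots> \<le> t * K"
          using t by (simp add: K_def algebra_simps)
        finally show ?thesis .
      qed
      have inS: "x + s *\<^sub>R u + q *\<^sub>R v \<in> S" if "0 \<le> s" "s \<le> t" "0 \<le> q" "q \<le> t" for s q
        using small[OF that] tK(1) r(2) by (auto simp: dist_norm norm_minus_commute subset_iff add.assoc)
      have der: "((\<lambda>s. f (x + s *\<^sub>R u + q *\<^sub>R v)) has_real_derivative g (x + s *\<^sub>R u + q *\<^sub>R v)) (at s)"
        if "0 \<le> s" "s \<le> t" "0 \<le> q" "q \<le> t" for s q
      proof -
        have "((\<lambda>s. x + s *\<^sub>R u + q *\<^sub>R v) has_derivative (\<lambda>h. h *\<^sub>R u)) (at s)"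
          by (auto intro!: derivative_eq_intros)
        from has_derivative_compose[OF this f[OF inS[OF that]]]
        have "((\<lambda>s. f (x + s *\<^sub>R u + q *\<^sub>R v)) has_derivative
            (\<lambda>h. f' (x + s *\<^sub>R u + q *\<^sub>R v) (h *\<^sub>R u))) (at s)" .
        moreover have "linear (f' (x + s *\<^sub>R u + q *\<^sub>R v))"
          using f[OF inS[OF that]] has_derivative_linear by blast
        moreover from this have "f' (x + s *\<^sub>R u + q *\<^sub>R v) (h *\<^sub>R u) = g (x + s *\<^sub>R u + q *\<^sub>R v) * h" for h
          by (simp add: g_def linear_scale)
        ultimately show ?thesis
          by (simp add: has_field_derivative_def)
      qed
      \<comment> \<open>The second difference is the increment over \<open>[0, t]\<close> of
        \<open>p\<close>, itself a first difference in direction \<open>v\<close>.\<close>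
      define p where "p s = f (x + s *\<^sub>R u + t *\<^sub>R v) - f (x + s *\<^sub>R u)" for s
      have "\<exists>s. 0 < s \<and> s < t \<and> p t - p 0 = (t - 0) * (g (x + s *\<^sub>R u + t *\<^sub>R v) - g (x + s *\<^sub>R u + 0 *\<^sub>R v))"
        unfolding p_def using t der[of _ t] der[of _ 0]
        by (intro MVT2) (auto intro!: DERIV_diff)
      then obtain s where s: "0 < s" "s < t"
        and ps: "p t - p 0 = t * (g (x + s *\<^sub>R u + t *\<^sub>R v) - g (x + s *\<^sub>R u))"
        by auto
      have D: "D t = p t - p 0" by (simp add: D_def p_def)
      have 1: "norm (g (x + s *\<^sub>R u + t *\<^sub>R v) - g x - A (s *\<^sub>R u + t *\<^sub>R v)) \<le> e / (4 * K) * (t * K)"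
      proof -
        have n: "norm (s *\<^sub>R u + t *\<^sub>R v) \<le> t * K" using s t by (intro small) auto
        have "norm (g (x + s *\<^sub>R u + t *\<^sub>R v) - g x - A (s *\<^sub>R u + t *\<^sub>R v))
            \<le> e / (4 * K) * norm (s *\<^sub>R u + t *\<^sub>R v)"
          using gd[of "x + s *\<^sub>R u + t *\<^sub>R v"] n tK(2) by (simp add: add.assoc)
        also have "\<dots> \<le> e / (4 * K) * (t * K)"
          using n \<open>e / (4 * K) > 0\<close> by (intro mult_left_mono) auto
        finally show ?thesis .
      qed
      have 2: "norm (g (x + s *\<^sub>R u) - g x - A (s *\<^sub>R u)) \<le> e / (4 * K) * (t * K)"
      proof -
        have n: "norm (s *\<^sub>R u) \<le> t * K" using small[of s 0] s t by auto
        have "norm (g (x + s *\<^sub>R u) - g x - A (s *\<^sub>R u)) \<le> e / (4 * K) * norm (s *\<^sub>R u)"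
          using gd[of "x + s *\<^sub>R u"] n tK(2) by simp
        also have "\<dots> \<le> e / (4 * K) * (t * K)"
          using n \<open>e / (4 * K) > 0\<close> by (intro mult_left_mono) auto
        finally show ?thesis .
      qed
      have K4: "e / (4 * K) * (t * K) = t * e / 4" using K by simp
      have "\<bar>g (x + s *\<^sub>R u + t *\<^sub>R v) - g (x + s *\<^sub>R u) - t * A v\<bar> \<le> t * e / 2"
        using 1 2 unfolding K4 A.add A.scaleR real_norm_def real_scaleR_def by linarith
      moreover have "D t / t\<^sup>2 - A v = (g (x + s *\<^sub>R u + t *\<^sub>R v) - g (x + s *\<^sub>R u) - t * A v) / t"
        using t by (simp add: D ps power2_eq_square field_simps)
      ultimately have "\<bar>D t / t\<^sup>2 - A v\<bar> \<le> e / 2"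
        using t by (simp only: abs_divide) (simp add: divide_le_eq mult.commute)
      then show ?thesis using \<open>e > 0\<close> by simp
    qed
    moreover have "t0 > 0" using r d K by (simp add: t0_def)
    ultimately show ?thesis unfolding eventually_at_right_field by blast
  qed
  then show ?thesis
    unfolding tendsto_iff D_def by (simp add: dist_real_def)
qed

text \<open>The second difference quotient is symmetric in \<open>u\<close> and \<open>v\<close>, so
  its limit can be computed in two ways. Inner products with basis vectors reduce to real values, as
  the mean value theorem requires.\<close>

lemma symmetric_second_derivative:
  fixes f :: "'a::real_normed_vector \<Rightarrow> 'b::euclidean_space"
  assumes S: "open S" "x \<in> S" and f: "\<And>y. y \<in> S \<Longrightarrow> (f has_derivative f' y) (at y)"
    and A: "((\<lambda>y. f' y u) has_derivative A) (at x)" and B: "((\<lambda>y. f' y v) has_derivative B) (at x)"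
  shows "A v = B u"
proof (rule euclidean_eqI)
  fix b :: 'b
  let ?F = "\<lambda>y. f y \<bullet> b"
  have F: "(?F has_derivative (\<lambda>h. f' y h \<bullet> b)) (at y)" if "y \<in> S" for y
    by (rule has_derivative_inner_left[OF f[OF that]])
  have 1: "((\<lambda>t. (?F (x + t *\<^sub>R u + t *\<^sub>R v) - ?F (x + t *\<^sub>R u) - ?F (x + t *\<^sub>R v) + ?F x) / t\<^sup>2)
           \<longlongrightarrow> A v \<bullet> b) (at_right 0)"
    by (rule second_difference_limit[OF S F has_derivative_inner_left[OF A]])
  have 2: "((\<lambda>t. (?F (x + t *\<^sub>R v + t *\<^sub>R u) - ?F (x + t *\<^sub>R v) - ?F (x + t *\<^sub>R u) + ?F x) / t\<^sup>2)
           \<longlongrightarrow> B u \<bullet> b) (at_right 0)"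
    by (rule second_difference_limit[OF S F has_derivative_inner_left[OF B]])
  have comm: "x + t *\<^sub>R v + t *\<^sub>R u = x + t *\<^sub>R u + t *\<^sub>R v" for t
    by (simp add: add.assoc add.commute)
  have eq: "(?F (x + t *\<^sub>R v + t *\<^sub>R u) - ?F (x + t *\<^sub>R v) - ?F (x + t *\<^sub>R u) + ?F x) / t\<^sup>2
      = (?F (x + t *\<^sub>R u + t *\<^sub>R v) - ?F (x + t *\<^sub>R u) - ?F (x + t *\<^sub>R v) + ?F x) / t\<^sup>2" for t
    by (simp add: comm)
  show "A v \<bullet> b = B u \<bullet> b"
    using tendsto_unique[OF trivial_limit_at_right_real 1 2[unfolded eq]] .
qed

lemma frechet_derivative_commute:
  fixes f :: "'a::euclidean_space \<Rightarrow> 'b::euclidean_space"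
  assumes "open S" "smooth_on S f" "x \<in> S"
  shows "frechet_derivative (\<lambda>y. frechet_derivative f (at y) u) (at x) v
       = frechet_derivative (\<lambda>y. frechet_derivative f (at y) v) (at x) u"
  using assms
  by (intro symmetric_second_derivative[of S x f "\<lambda>y. frechet_derivative f (at y)" u _ v]
      smooth_on_has_derivative smooth_on_frechet_derivative)

lemma partial_commute:
  fixes f :: "real^'n \<Rightarrow> 'b::euclidean_space"
  assumes "open S" "smooth_on S f" "x \<in> S"
  shows "partial i (partial j f) x = partial j (partial i f) x"
  using frechet_derivative_commute[OF assms] by (simp add: partial_def[abs_def])

section \<open>The Levi-Civita connection in an orthonormal coframe\<close>

lemma matrix_inv_left_right:
  fixes A :: "real^'n^'n"
  assumes "invertible A"
  shows matrix_inv_mult_left: "matrix_inv A ** A = mat 1"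
    and matrix_inv_mult_right: "A ** matrix_inv A = mat 1"
proof -
  have "A ** matrix_inv A = mat 1 \<and> matrix_inv A ** A = mat 1"
    using assms unfolding invertible_def matrix_inv_def by (rule someI_ex)
  then show "matrix_inv A ** A = mat 1" "A ** matrix_inv A = mat 1" by auto
qed

lemma linear_axis_expansion:
  fixes g :: "real^'n \<Rightarrow> 'b::real_vector"
  assumes "linear g"
  shows "g X = (\<Sum>a\<in>UNIV. X $ a *\<^sub>R g (axis a 1))"
proof -
  have "g X = g (\<Sum>a\<in>UNIV. X $ a *\<^sub>R axis a 1)"
    using basis_expansion[of X] by (simp add: scalar_mult_eq_scaleR)
  then show ?thesis by (simp add: linear_sum[OF assms] linear_scale[OF assms])
qed

text \<open>Uniqueness of the Levi-Civita connection: symmetric symbols compatible with the metric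
  satisfy Koszul's formula, the combination of derivatives of \<open>G\<close> that defines
  \<open>christoffel\<close>. Symbols can thus be identified without handling the inverse matrix
  again.\<close>

lemma christoffel_eqI:
  fixes G :: "real^'n \<Rightarrow> real^'n^'n"
  assumes inv: "invertible (G x)" and sym: "\<And>i j. G x $ i $ j = G x $ j $ i"
    and Gam: "\<And>k i j. Gam k i j = Gam k j i"
    and compat: "\<And>l i j. partial l (\<lambda>y. G y $ i $ j) x
      = (\<Sum>k\<in>UNIV. Gam k l i * G x $ k $ j) + (\<Sum>k\<in>UNIV. Gam k l j * G x $ k $ i)"
  shows "christoffel G x k i j = Gam k i j"
proof -
  have "christoffel G x k i j =
      (1/2) * (\<Sum>l\<in>UNIV. matrix_inv (G x) $ k $ l * (2 * (\<Sum>m\<in>UNIV. Gam m i j * G x $ m $ l)))"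
    unfolding christoffel_def
  proof (intro arg_cong2[where f = "(*)"] refl sum.cong)
    fix l
    have "partial i (\<lambda>y. G y $ j $ l) x + partial j (\<lambda>y. G y $ i $ l) x - partial l (\<lambda>y. G y $ i $ j) x
        = (\<Sum>k\<in>UNIV. Gam k i j * G x $ k $ l) + (\<Sum>k\<in>UNIV. Gam k j i * G x $ k $ l)"
      unfolding compat using Gam[of _ l i] Gam[of _ l j] by simp
    also have "\<dots> = 2 * (\<Sum>m\<in>UNIV. Gam m i j * G x $ m $ l)"
      using Gam[of _ j i] by simp
    finally show "partial i (\<lambda>y. G y $ j $ l) x + partial j (\<lambda>y. G y $ i $ l) x
        - partial l (\<lambda>y. G y $ i $ j) x = 2 * (\<Sum>m\<in>UNIV. Gam m i j * G x $ m $ l)" .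
  qed
  also have "\<dots> = (\<Sum>l\<in>UNIV. \<Sum>m\<in>UNIV. Gam m i j * (matrix_inv (G x) $ k $ l * G x $ l $ m))"
    using sym by (simp add: sum_distrib_left mult.commute mult.left_commute)
  also have "\<dots> = (\<Sum>m\<in>UNIV. Gam m i j * (\<Sum>l\<in>UNIV. matrix_inv (G x) $ k $ l * G x $ l $ m))"
    by (subst sum.swap) (simp add: sum_distrib_left)
  also have "\<dots> = (\<Sum>m\<in>UNIV. Gam m i j * (matrix_inv (G x) ** G x) $ k $ m)"
    by (simp add: matrix_matrix_mult_def)
  also have "\<dots> = Gam k i j"
    by (simp add: matrix_inv_mult_left[OF inv] mat_def if_distrib cong: if_cong)
  finally show ?thesis .
qed

text \<open>Cramer's rule with the cofactors written as cross products of the columns of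
  \<open>A\<close>. It exhibits \<open>matrix_inv A *v v\<close> as a rational expression, from
  which smoothness is read off.\<close>

lemma matrix_inv_vector_cross3:
  fixes A :: "real^3^3"
  assumes "invertible A"
  defines "a \<equiv> A *v axis 1 1" and "b \<equiv> A *v axis 2 1" and "c \<equiv> A *v axis 3 1"
  shows "a \<bullet> cross3 b c \<noteq> 0"
    and "matrix_inv A *v v = (1 / (a \<bullet> cross3 b c)) *\<^sub>R
           vector [cross3 b c \<bullet> v, cross3 c a \<bullet> v, cross3 a b \<bullet> v]"
proof -
  have "vector [a, b, c] = transpose A"
    by (simp add: a_def b_def c_def matrix_vector_mult_basis column_def transpose_def vec_eq_iff
        forall_3 vector_def)
  then have "a \<bullet> cross3 b c = det A"
    by (simp add: dot_cross_det det_transpose)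
  moreover have "det A \<noteq> 0"
    using assms(1) by (simp add: invertible_det_nz)
  ultimately show nz: "a \<bullet> cross3 b c \<noteq> 0" by simp
  define w where "w = matrix_inv A *v v"
  have "v = A *v w"
    by (simp add: w_def matrix_vector_mul_assoc matrix_inv_mult_right[OF assms(1)])
  also have "\<dots> = w $ 1 *\<^sub>R a + w $ 2 *\<^sub>R b + w $ 3 *\<^sub>R c"
    using linear_axis_expansion[OF matrix_vector_mul_linear, of A w] by (simp add: a_def b_def c_def sum_3)
  finally have v: "v = w $ 1 *\<^sub>R a + w $ 2 *\<^sub>R b + w $ 3 *\<^sub>R c" .
  have eq: "cross3 c a \<bullet> b = a \<bullet> cross3 b c" "cross3 a b \<bullet> c = a \<bullet> cross3 b c" "cross3 b c \<bullet> a = a \<bullet> cross3 b c"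
    by (simp_all add: cross3_simps)
  have "w = (1 / (a \<bullet> cross3 b c)) *\<^sub>R vector [cross3 b c \<bullet> v, cross3 c a \<bullet> v, cross3 a b \<bullet> v]"
    using nz by (simp add: v inner_add_right inner_scaleR_right dot_cross_self eq vec_eq_iff forall_3)
  then show "matrix_inv A *v v = (1 / (a \<bullet> cross3 b c)) *\<^sub>R
      vector [cross3 b c \<bullet> v, cross3 c a \<bullet> v, cross3 a b \<bullet> v]"
    by (simp add: w_def)
qed

lemma smooth_on_matrix_inv_vector:
  fixes A :: "'a::euclidean_space \<Rightarrow> real^3^3"
  assumes S: "open S" and A: "smooth_on S A" and v: "smooth_on S v"
    and inv: "\<And>y. y \<in> S \<Longrightarrow> invertible (A y)"
  shows "smooth_on S (\<lambda>y. matrix_inv (A y) *v v y)"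
proof -
  let ?a = "\<lambda>y. A y *v axis 1 1" and ?b = "\<lambda>y. A y *v axis 2 1" and ?c = "\<lambda>y. A y *v axis 3 1"
  let ?d = "\<lambda>y. ?a y \<bullet> cross3 (?b y) (?c y)"
  let ?V = "\<lambda>y. vector [cross3 (?b y) (?c y) \<bullet> v y, cross3 (?c y) (?a y) \<bullet> v y,
      cross3 (?a y) (?b y) \<bullet> v y] :: real^3"
  have col: "smooth_on S (\<lambda>y. A y *v axis i 1)" for i
    by (intro smooth_on_matrix_vector_mult smooth_on_const S A)
  have "smooth_on S ?V"
  proof (rule smooth_on_vecI[OF S])
    fix i :: 3
    show "smooth_on S (\<lambda>y. ?V y $ i)"
      using exhaust_3[of i]
      by (elim disjE) (simp_all add: smooth_on_inner smooth_on_cross3 S col v)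
  qed
  moreover have "smooth_on S (\<lambda>y. 1 / ?d y)"
    using matrix_inv_vector_cross3(1)[OF inv]
    by (intro smooth_on_divide smooth_on_inner smooth_on_cross3 smooth_on_const S col)
  ultimately have "smooth_on S (\<lambda>y. (1 / ?d y) *\<^sub>R ?V y)"
    by (intro smooth_on_scaleR S)
  then show ?thesis
    using matrix_inv_vector_cross3(2)[OF inv] smooth_on_cong[OF S] by (metis (no_types, lifting))
qed

text \<open>The Jacobi identity: the commutator of the infinitesimal rotations given by
  \<open>a\<close> and \<open>b\<close> is the one given by \<open>cross3 a b\<close>.\<close>

lemma cross_cross_left:
  "cross3 (cross3 a b) c = cross3 a (cross3 b c) - cross3 b (cross3 a c)"
  by (simp add: vec_eq_iff forall_3 cross_components algebra_simps)

text \<open>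
  The rows of \<open>th p\<close> are an orthonormal coframe. Identifying \<open>so(3)\<close> with \<open>\<real>\<^sup>3\<close> through the cross
  product, the Levi-Civita connection reads \<open>d + om(X) \<times> _\<close>, and the last two assumptions are
  Cartan's structure equations.
\<close>

locale coframe =
  fixes D :: "(real^3) set" and H th om :: "real^3 \<Rightarrow> real^3^3" and s t :: real
  assumes open_D: "open D"
    and smooth_th: "smooth_on D th" and smooth_om: "smooth_on D om"
    and inv_th: "p \<in> D \<Longrightarrow> invertible (th p)"
    and H_eq: "p \<in> D \<Longrightarrow> H p = transpose (th p) ** th p"
    and torsion: "p \<in> D \<Longrightarrow>
      frechet_derivative th (at p) X *v Y - frechet_derivative th (at p) Y *v X
      + cross3 (om p *v X) (th p *v Y) - cross3 (om p *v Y) (th p *v X) = 0"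
    and curv: "p \<in> D \<Longrightarrow>
      frechet_derivative om (at p) X *v Y - frechet_derivative om (at p) Y *v X
      + cross3 (om p *v X) (om p *v Y)
      = s *\<^sub>R cross3 (th p *v X) (th p *v Y)
        + ((t - s) * cross3 (th p *v X) (th p *v Y) $ 3) *\<^sub>R axis 3 1"
begin

definition Sop :: "real^3 \<Rightarrow> real^3" where
  "Sop v = s *\<^sub>R v + ((t - s) * v $ 3) *\<^sub>R axis 3 1"

text \<open>The Levi-Civita derivative in direction \<open>X\<close> of the field with constant
  coordinates \<open>Y\<close>, obtained by conjugating the connection of the coframe with
  \<open>th\<close>; on basis vectors its components are the Christoffel symbols.\<close>

definition conn :: "real^3 \<Rightarrow> real^3 \<Rightarrow> real^3 \<Rightarrow> real^3" where
  "conn p X Y = matrix_inv (th p) *v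
     (frechet_derivative th (at p) X *v Y + cross3 (om p *v X) (th p *v Y))"

lemma th_deriv: "p \<in> D \<Longrightarrow> (th has_derivative frechet_derivative th (at p)) (at p)"
  by (rule smooth_on_has_derivative[OF open_D smooth_th])

lemma linear_th': "p \<in> D \<Longrightarrow> linear (frechet_derivative th (at p))"
  using th_deriv has_derivative_linear by blast

lemma linear_Sop: "linear Sop"
  by (rule linearI) (auto simp: Sop_def algebra_simps)

lemma th_conn:
  "p \<in> D \<Longrightarrow> th p *v conn p X Y = frechet_derivative th (at p) X *v Y + cross3 (om p *v X) (th p *v Y)"
  by (simp add: conn_def matrix_vector_mul_assoc matrix_inv_mult_right[OF inv_th])

lemma th_inject: "p \<in> D \<Longrightarrow> th p *v X = th p *v Y \<longleftrightarrow> X = Y"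
  using inj_matrix_vector_mult[OF inv_th] by (meson inj_eq)

lemma linear_conn_right: "linear (conn p X)"
  by (rule linearI)
     (simp_all add: conn_def algebra_simps matrix_vector_right_distrib cross_add_right
       cross_mult_right matrix_vector_mult_scaleR)

lemma linear_conn_left: "p \<in> D \<Longrightarrow> linear (\<lambda>X. conn p X Y)"
  by (rule linearI)
     (simp_all add: conn_def algebra_simps matrix_vector_right_distrib cross_add_left
       cross_mult_left matrix_vector_mult_scaleR linear_add[OF linear_th'] linear_scale[OF linear_th']
       matrix_vector_mult_add_rdistrib scaleR_matrix_vector_assoc[symmetric])

lemma metric_ip_eq:
  assumes "p \<in> D"
  shows "metric_ip H p V W = (th p *v V) \<bullet> (th p *v W)"
proof -
  have "(th p *v V) \<bullet> (th p *v W) = V \<bullet> (H p *v W)"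
    unfolding H_eq[OF assms] matrix_vector_mul_assoc[symmetric] transpose_matrix_vector
    by (metis dot_lmul_matrix inner_commute)
  also have "\<dots> = metric_ip H p V W"
    by (simp add: metric_ip_def inner_vec_def matrix_vector_mult_def sum_distrib_left ac_simps)
  finally show ?thesis ..
qed

lemma H_component:
  "p \<in> D \<Longrightarrow> H p $ i $ j = (th p *v axis i 1) \<bullet> (th p *v axis j 1)"
  by (simp add: H_eq matrix_matrix_mult_def transpose_def matrix_vector_mult_basis column_def
      inner_vec_def)

text \<open>\<open>conn\<close> meets the two conditions that characterise the Levi-Civita
  connection: symmetry is the torsion equation, and compatibility holds because crossing with
  \<open>om\<close> is skew for the inner product, so only the derivative of \<open>th\<close>
  contributes to that of \<open>H\<close>.\<close>

lemma christoffel_H: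
  assumes p: "p \<in> D"
  shows "christoffel H p k i j = conn p (axis i 1) (axis j 1) $ k"
proof (rule christoffel_eqI[where Gam = "\<lambda>k i j. conn p (axis i 1) (axis j 1) $ k"])
  show "invertible (H p)"
    using inv_th[OF p] by (simp add: H_eq[OF p] invertible_mult invertible_det_nz det_transpose det_mul)
  show "H p $ i $ j = H p $ j $ i" for i j
    by (simp add: H_component[OF p] inner_commute)
  show "conn p (axis i 1) (axis j 1) $ k = conn p (axis j 1) (axis i 1) $ k" for k i j
  proof -
    have "th p *v conn p (axis i 1) (axis j 1) = th p *v conn p (axis j 1) (axis i 1)"
      using torsion[OF p, of "axis i 1" "axis j 1"] by (simp add: th_conn[OF p] algebra_simps)
    then show ?thesis by (simp add: th_inject[OF p])
  qed
  show "partial l (\<lambda>y. H y $ i $ j) p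
      = (\<Sum>k\<in>UNIV. conn p (axis l 1) (axis i 1) $ k * H p $ k $ j)
        + (\<Sum>k\<in>UNIV. conn p (axis l 1) (axis j 1) $ k * H p $ k $ i)" for l i j
  proof -
    let ?e = "\<lambda>i. axis i 1 :: real^3" and ?d = "frechet_derivative th (at p)"
    have th': "((\<lambda>y. th y *v ?e i) has_derivative (\<lambda>h. ?d h *v ?e i)) (at p)" for i
      by (auto intro!: has_derivative_eq_rhs[OF bounded_bilinear.FDERIV
            [OF bounded_bilinear_matrix_vector_mult th_deriv[OF p] has_derivative_const]])
    have "((\<lambda>y. (th y *v ?e i) \<bullet> (th y *v ?e j)) has_derivative
        (\<lambda>h. (th p *v ?e i) \<bullet> (?d h *v ?e j) + (?d h *v ?e i) \<bullet> (th p *v ?e j))) (at p)"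
      by (rule has_derivative_inner[OF th' th'])
    then have "((\<lambda>y. H y $ i $ j) has_derivative
        (\<lambda>h. (th p *v ?e i) \<bullet> (?d h *v ?e j) + (?d h *v ?e i) \<bullet> (th p *v ?e j))) (at p)"
      by (rule has_derivative_transform_within_open[OF _ open_D p]) (simp add: H_component)
    then have 1: "partial l (\<lambda>y. H y $ i $ j) p =
        (th p *v ?e i) \<bullet> (?d (?e l) *v ?e j) + (?d (?e l) *v ?e i) \<bullet> (th p *v ?e j)"
      by (simp add: partial_def frechet_derivative_eqI)
    have 2: "(\<Sum>k\<in>UNIV. V $ k * H p $ k $ j) = (th p *v V) \<bullet> (th p *v ?e j)" for V j
      using linear_axis_expansion[OF matrix_vector_mul_linear, of "th p" V]
      by (simp add: H_component[OF p] inner_sum_left)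
    have 3: "cross3 w a \<bullet> b + cross3 w b \<bullet> a = 0" for w a b
      by (simp add: cross3_simps)
    show ?thesis
      unfolding 1 2 th_conn[OF p] using 3[of "om p *v ?e l" "th p *v ?e i" "th p *v ?e j"]
      by (simp add: inner_add_left inner_add_right inner_commute)
  qed
qed

text \<open>The derivative of \<open>th (f y)\<close> produced by the product rule is exactly the
  part of \<open>conn\<close> that does not involve \<open>om\<close>, so in frame components only
  the cross product remains beside the partial derivative.\<close>

lemma cov_deriv_H:
  fixes f V :: "real^'m \<Rightarrow> real^3"
  assumes p: "f x \<in> D" and f: "f differentiable (at x)" and V: "V differentiable (at x)"
  shows "th (f x) *v cov_deriv H f i V x = partial i (\<lambda>y. th (f y) *v V y) x
    + cross3 (om (f x) *v partial i f x) (th (f x) *v V x)"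
proof -
  let ?f' = "frechet_derivative f (at x)" and ?V' = "frechet_derivative V (at x)"
  let ?d = "frechet_derivative th (at (f x))"
  have f': "(f has_derivative ?f') (at x)" and V': "(V has_derivative ?V') (at x)"
    using f V by (simp_all add: frechet_derivative_works[symmetric])
  have "((\<lambda>y. th (f y) *v V y) has_derivative (\<lambda>h. th (f x) *v ?V' h + ?d (?f' h) *v V x)) (at x)"
    by (rule bounded_bilinear.FDERIV[OF bounded_bilinear_matrix_vector_mult
          has_derivative_compose[OF f' th_deriv[OF p]] V'])
  then have 1: "partial i (\<lambda>y. th (f y) *v V y) x
      = th (f x) *v partial i V x + ?d (partial i f x) *v V x"
    by (simp add: partial_def frechet_derivative_eqI)
  have "(\<chi> a. \<Sum>b\<in>UNIV. \<Sum>c\<in>UNIV. christoffel H (f x) a b c * partial i f x $ b * V x $ c)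
      = conn (f x) (partial i f x) (V x)"
  proof -
    have "conn (f x) (partial i f x) (V x)
      = (\<Sum>b\<in>UNIV. partial i f x $ b *\<^sub>R conn (f x) (axis b 1) (V x))"
      by (rule linear_axis_expansion[OF linear_conn_left[OF p]])
    also have "\<dots> = (\<Sum>b\<in>UNIV. \<Sum>c\<in>UNIV.
        partial i f x $ b *\<^sub>R V x $ c *\<^sub>R conn (f x) (axis b 1) (axis c 1))"
      by (simp only: linear_axis_expansion[OF linear_conn_right, of "f x" _ "V x"] scaleR_sum_right)
    finally show ?thesis
      by (simp add: vec_eq_iff christoffel_H[OF p] sum_component ac_simps)
  qed
  then show ?thesis
    by (simp add: cov_deriv_def matrix_vector_right_distrib th_conn[OF p] 1)
qed

lemma smooth_conn: "smooth_on D (\<lambda>y. conn y X Y)"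
  unfolding conn_def
  by (intro smooth_on_matrix_inv_vector smooth_on_add smooth_on_matrix_vector_mult smooth_on_cross3
      smooth_on_const smooth_on_frechet_derivative open_D smooth_th smooth_om inv_th)

text \<open>Cartan's second structure equation. Differentiating the defining equation of
  \<open>conn\<close> gives the derivatives of the Christoffel symbols; the second derivatives of
  \<open>th\<close> are symmetric and drop out under antisymmetrisation, which leaves the derivative
  of \<open>om\<close> and products of \<open>om\<close> with itself.\<close>

lemma curvature_H:
  assumes p: "p \<in> D"
  shows "th p *v (\<chi> d. curvature H p a b c d)
    = cross3 (Sop (cross3 (th p *v axis a 1) (th p *v axis b 1))) (th p *v axis c 1)"
proof -
  let ?e = "\<lambda>i. axis i 1 :: real^3"
  let ?d = "\<lambda>p. frechet_derivative th (at p)" and ?o = "frechet_derivative om (at p)"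
  define C where "C b c y = conn y (?e b) (?e c)" for b c y
  define C' where "C' b c = frechet_derivative (C b c) (at p)" for b c
  have C': "(C b c has_derivative C' b c) (at p)" for b c
    using smooth_on_has_derivative[OF open_D smooth_conn p] by (simp add: C_def[abs_def] C'_def)
  have part: "partial a (\<lambda>y. christoffel H y d b c) p = C' b c (?e a) $ d" for a b c d
  proof -
    have "((\<lambda>y. C b c y $ d) has_derivative (\<lambda>h. C' b c h $ d)) (at p)"
      by (rule bounded_linear.has_derivative[OF bounded_linear_vec_nth C'])
    then have "((\<lambda>y. christoffel H y d b c) has_derivative (\<lambda>h. C' b c h $ d)) (at p)"
      by (rule has_derivative_transform_within_open[OF _ open_D p]) (simp add: christoffel_H C_def)
    then show ?thesis by (simp add: partial_def frechet_derivative_eqI)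
  qed
  have R: "(\<chi> d. curvature H p a b c d)
      = C' b c (?e a) - C' a c (?e b) + conn p (?e a) (C b c p) - conn p (?e b) (C a c p)"
  proof -
    have "conn p X (C b c p) = (\<Sum>e\<in>UNIV. C b c p $ e *\<^sub>R conn p X (?e e))" for X b c
      by (rule linear_axis_expansion[OF linear_conn_right])
    then show ?thesis
      by (simp add: vec_eq_iff curvature_def part christoffel_H[OF p] sum_subtractf sum_component
          mult.commute C_def)
  qed
  define d2 where "d2 X Y = frechet_derivative (\<lambda>y. ?d y X) (at p) Y" for X Y
  have sym: "d2 X Y = d2 Y X" for X Y
    unfolding d2_def by (rule frechet_derivative_commute[OF open_D smooth_th p])
  \<comment> \<open>Two computations of the derivative of \<open>th y *v C b c y\<close> are
    compared: by the product rule, and from the defining equation of \<open>conn\<close>.\<close>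
  have K: "th p *v C' b c (?e a) + ?d p (?e a) *v C b c p
      = d2 (?e b) (?e a) *v ?e c + cross3 (?o (?e a) *v ?e b) (th p *v ?e c)
        + cross3 (om p *v ?e b) (?d p (?e a) *v ?e c)" for a b c
  proof -
    have o': "(om has_derivative ?o) (at p)"
      by (rule smooth_on_has_derivative[OF open_D smooth_om p])
    have d2: "((\<lambda>y. ?d y X) has_derivative d2 X) (at p)" for X
      unfolding d2_def
      by (rule smooth_on_has_derivative[OF open_D smooth_on_frechet_derivative[OF smooth_th] p])
    have mv: "((\<lambda>y. A y *v v) has_derivative (\<lambda>h. A' h *v v)) (at p)"
      if "(A has_derivative A') (at p)" for A :: "real^3 \<Rightarrow> real^3^3" and A' v
      by (auto intro!: has_derivative_eq_rhs[OF bounded_bilinear.FDERIV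
            [OF bounded_bilinear_matrix_vector_mult that has_derivative_const]])
    have 1: "((\<lambda>y. th y *v C b c y) has_derivative
        (\<lambda>h. th p *v C' b c h + ?d p h *v C b c p)) (at p)"
      by (rule bounded_bilinear.FDERIV[OF bounded_bilinear_matrix_vector_mult th_deriv[OF p] C'])
    have "((\<lambda>y. ?d y (?e b) *v ?e c + cross3 (om y *v ?e b) (th y *v ?e c)) has_derivative
        (\<lambda>h. d2 (?e b) h *v ?e c + (cross3 (om p *v ?e b) (?d p h *v ?e c)
          + cross3 (?o h *v ?e b) (th p *v ?e c)))) (at p)"
      by (intro has_derivative_add mv d2 th_deriv[OF p] o'
          bounded_bilinear.FDERIV[OF bounded_bilinear_cross3])
    then have "((\<lambda>y. th y *v C b c y) has_derivative
        (\<lambda>h. d2 (?e b) h *v ?e c + (cross3 (om p *v ?e b) (?d p h *v ?e c)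
          + cross3 (?o h *v ?e b) (th p *v ?e c)))) (at p)"
      by (rule has_derivative_transform_within_open[OF _ open_D p]) (simp add: C_def th_conn)
    from fun_cong[OF has_derivative_unique[OF 1 this], of "?e a"] show ?thesis by simp
  qed
  have "th p *v (\<chi> d. curvature H p a b c d)
      = cross3 (?o (?e a) *v ?e b - ?o (?e b) *v ?e a) (th p *v ?e c)
      + cross3 (om p *v ?e a) (cross3 (om p *v ?e b) (th p *v ?e c))
      - cross3 (om p *v ?e b) (cross3 (om p *v ?e a) (th p *v ?e c))"
  proof -
    have "th p *v C b c p = ?d p (?e b) *v ?e c + cross3 (om p *v ?e b) (th p *v ?e c)" for b c
      by (simp add: C_def th_conn[OF p])
    then show ?thesis
      unfolding R matrix_vector_right_distrib matrix_vector_mult_diff_distrib th_conn[OF p]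
        K[of b c a, unfolded eq_diff_eq[symmetric]] K[of a c b, unfolded eq_diff_eq[symmetric]]
      by (simp add: sym[of "?e b" "?e a"] cross_add_right Cross3.left_diff_distrib)
  qed
  \<comment> \<open>The Jacobi identity merges the two nested cross products into one, so that
    \<open>curv\<close> applies.\<close>
  also have "\<dots> = cross3 (?o (?e a) *v ?e b - ?o (?e b) *v ?e a + cross3 (om p *v ?e a) (om p *v ?e b))
      (th p *v ?e c)"
    by (simp add: cross_add_left cross_cross_left)
  also have "\<dots> = cross3 (Sop (cross3 (th p *v ?e a) (th p *v ?e b))) (th p *v ?e c)"
    by (simp add: curv[OF p] Sop_def)
  finally show ?thesis .
qed

lemma curvature_op_H:
  assumes p: "p \<in> D"
  shows "th p *v curvature_op H p X Y Z
    = cross3 (Sop (cross3 (th p *v X) (th p *v Y))) (th p *v Z)"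
proof -
  let ?e = "\<lambda>i. axis i 1 :: real^3" and ?T = "\<lambda>X Y Z. cross3 (Sop (cross3 (th p *v X) (th p *v Y))) (th p *v Z)"
  have lin: "linear (\<lambda>X. ?T X Y Z)" "linear (\<lambda>Y. ?T X Y Z)" "linear (\<lambda>Z. ?T X Y Z)" for X Y Z
    by (rule linearI; simp add: matrix_vector_right_distrib cross_add_left cross_add_right
        cross_mult_left cross_mult_right linear_add[OF linear_Sop] linear_scale[OF linear_Sop]
        matrix_vector_mult_scaleR)+
  have "?T X Y Z = (\<Sum>a\<in>UNIV. \<Sum>b\<in>UNIV. \<Sum>c\<in>UNIV. X $ a *\<^sub>R Y $ b *\<^sub>R Z $ c *\<^sub>R ?T (?e a) (?e b) (?e c))"
    by (subst linear_axis_expansion[OF lin(1)], subst linear_axis_expansion[OF lin(2)],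
        subst linear_axis_expansion[OF lin(3)]) (simp add: scaleR_sum_right)
  also have "\<dots> = (\<Sum>a\<in>UNIV. \<Sum>b\<in>UNIV. \<Sum>c\<in>UNIV. th p *v
      ((X $ a * Y $ b * Z $ c) *\<^sub>R (\<chi> d. curvature H p a b c d)))"
    by (simp add: curvature_H[OF p] matrix_vector_mult_scaleR mult.assoc)
  also have "\<dots> = th p *v (\<Sum>a\<in>UNIV. \<Sum>b\<in>UNIV. \<Sum>c\<in>UNIV.
      (X $ a * Y $ b * Z $ c) *\<^sub>R (\<chi> d. curvature H p a b c d))"
    by (simp add: linear_sum[OF matrix_vector_mul_linear])
  also have "(\<Sum>a\<in>UNIV. \<Sum>b\<in>UNIV. \<Sum>c\<in>UNIV.
      (X $ a * Y $ b * Z $ c) *\<^sub>R (\<chi> d. curvature H p a b c d)) = curvature_op H p X Y Z"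
    by (simp add: curvature_op_def vec_eq_iff sum_component)
  finally show ?thesis ..
qed

end

section \<open>Surfaces in a coframe\<close>

lemma partial_cong:
  assumes "open S" "x \<in> S" "\<And>y. y \<in> S \<Longrightarrow> f y = g y" "f differentiable (at x)"
  shows "partial i f x = partial i g x"
  unfolding partial_def
  using frechet_derivative_transform_within_open[of f x S g] assms by simp

lemma has_derivative_partial:
  "(f has_derivative f') (at x) \<Longrightarrow> partial i f x = f' (axis i 1)"
  by (simp add: partial_def frechet_derivative_eqI)

lemma matrix_inv_unique_right:
  fixes A B :: "real^'n^'n"
  assumes "A ** B = mat 1"
  shows "matrix_inv A = B"
proof -
  have inv: "invertible A"
    using assms matrix_left_right_inverse unfolding invertible_def by blast
  have "matrix_inv A = matrix_inv A ** (A ** B)" by (simp add: assms)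
  also have "\<dots> = B" by (simp add: matrix_mul_assoc matrix_inv_mult_left[OF inv])
  finally show ?thesis .
qed

text \<open>In three dimensions a vector \<open>w\<close> orthogonal to \<open>a\<close> and
  \<open>b\<close> is a multiple of \<open>n = cross3 a b\<close>, by the expansion of
  \<open>cross3 n (cross3 w n)\<close>; two orthogonal multiples of one vector cannot both be
  nonzero. Vector identities along a surface are tested with this.\<close>

lemma eq_0_if_orthogonal_frame:
  fixes a b \<xi> v :: "real^3"
  assumes "cross3 a b \<noteq> 0" "\<xi> \<bullet> a = 0" "\<xi> \<bullet> b = 0" "\<xi> \<noteq> 0" "v \<bullet> a = 0" "v \<bullet> b = 0" "v \<bullet> \<xi> = 0"
  shows "v = 0"
proof -
  let ?n = "cross3 a b"
  have n: "(?n \<bullet> ?n) *\<^sub>R w = (?n \<bullet> w) *\<^sub>R ?n" if "w \<bullet> a = 0" "w \<bullet> b = 0" for w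
  proof -
    have "cross3 w ?n = 0" using that by (simp add: Lagrange)
    then have "cross3 ?n (cross3 w ?n) = 0" by simp
    then show ?thesis using Lagrange[of ?n w ?n] by simp
  qed
  have "(?n \<bullet> v) * (?n \<bullet> \<xi>) = ((?n \<bullet> v) *\<^sub>R ?n) \<bullet> \<xi>" by simp
  also have "\<dots> = 0" using n[OF assms(5,6)] assms(7) by (metis inner_scaleR_left mult_zero_right)
  finally have "?n \<bullet> v = 0 \<or> ?n \<bullet> \<xi> = 0" by simp
  then show ?thesis using n[OF assms(5,6)] n[OF assms(2,3)] assms(1,4) by auto
qed

locale surf = coframe +
  fixes U :: "(real^2) set" and f :: "real^2 \<Rightarrow> real^3" and G :: "real^2 \<Rightarrow> real^2^2"
  assumes open_U: "open U" and smooth_f: "smooth_on U f" and f_D: "x \<in> U \<Longrightarrow> f x \<in> D"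
    and G_eq: "x \<in> U \<Longrightarrow> G x $ i $ j = metric_ip H (f x) (partial i f x) (partial j f x)"
    and G_pos: "x \<in> U \<Longrightarrow> v \<noteq> 0 \<Longrightarrow> metric_ip G x v v > 0"
begin

text \<open>Orthonormal frame components of a field along \<open>f\<close>; on these the ambient
  metric is the Euclidean inner product.\<close>

definition hat :: "(real^2 \<Rightarrow> real^3) \<Rightarrow> real^2 \<Rightarrow> real^3" where
  "hat V x = th (f x) *v V x"

definition e :: "2 \<Rightarrow> real^2 \<Rightarrow> real^3" where
  "e i = hat (partial i f)"

definition a :: "2 \<Rightarrow> real^2 \<Rightarrow> real^3" where
  "a i x = om (f x) *v partial i f x"

text \<open>The connection \<open>\<nabla>\<^sup>f\<close> in frame components, \<open>a i\<close>
  being the pulled back connection form.\<close>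

definition Dh :: "2 \<Rightarrow> (real^2 \<Rightarrow> real^3) \<Rightarrow> real^2 \<Rightarrow> real^3" where
  "Dh i v x = partial i v x + cross3 (a i x) (v x)"

definition ginv :: "2 \<Rightarrow> 2 \<Rightarrow> real^2 \<Rightarrow> real" where
  "ginv i j x = matrix_inv (G x) $ i $ j"

definition B :: "2 \<Rightarrow> 2 \<Rightarrow> real^2 \<Rightarrow> real^3" where
  "B i j x = th (f x) *v nabla_d G H f x i j"

lemma smooth_th_f: "smooth_on U (\<lambda>x. th (f x))" and smooth_om_f: "smooth_on U (\<lambda>x. om (f x))"
  using f_D by (auto intro!: smooth_on_compose[OF open_U open_D _ smooth_f] smooth_th smooth_om)

lemma smooth_hat: "smooth_on U V \<Longrightarrow> smooth_on U (hat V)"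
  unfolding hat_def[abs_def] by (intro smooth_on_matrix_vector_mult open_U smooth_th_f)

lemma smooth_e: "smooth_on U (e i)"
  unfolding e_def by (intro smooth_hat smooth_on_partial smooth_f)

lemma smooth_a: "smooth_on U (a i)"
  unfolding a_def[abs_def]
  by (intro smooth_on_matrix_vector_mult open_U smooth_om_f smooth_on_partial smooth_f)

lemma smooth_Dh: "smooth_on U v \<Longrightarrow> smooth_on U (Dh i v)"
  unfolding Dh_def[abs_def]
  by (intro smooth_on_add smooth_on_cross3 smooth_on_partial smooth_a open_U)

text \<open>Fields such as the tension field are known through their frame components; applying the
  smooth inverse of \<open>th\<close> recovers the smoothness in coordinates that
  \<open>hat_cov_deriv\<close> asks for.\<close>

lemma smooth_unhat:
  assumes "smooth_on U v" "\<And>x. x \<in> U \<Longrightarrow> hat V x = v x"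
  shows "smooth_on U V"
proof -
  have "smooth_on U (\<lambda>x. matrix_inv (th (f x)) *v v x)"
    by (intro smooth_on_matrix_inv_vector open_U smooth_th_f assms(1) inv_th f_D)
  moreover have "matrix_inv (th (f x)) *v v x = V x" if "x \<in> U" for x
    unfolding assms(2)[OF that, symmetric] hat_def
    by (simp add: matrix_vector_mul_assoc matrix_inv_mult_left[OF inv_th[OF f_D[OF that]]])
  ultimately show ?thesis using smooth_on_cong[OF open_U] by (metis (no_types, lifting))
qed

lemma differentiable_U: "smooth_on U v \<Longrightarrow> x \<in> U \<Longrightarrow> v differentiable (at x)"
  using smooth_on_differentiable[OF open_U] by blast

lemma hat_cov_deriv:
  assumes "smooth_on U V" "x \<in> U"
  shows "hat (cov_deriv H f i V) x = Dh i (hat V) x"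
  using cov_deriv_H[OF f_D differentiable_U[OF smooth_f] differentiable_U[OF assms(1)]] assms(2)
  by (simp add: hat_def[abs_def] Dh_def a_def)

lemma Dh_cong:
  assumes "x \<in> U" "\<And>y. y \<in> U \<Longrightarrow> v y = w y" "smooth_on U v"
  shows "Dh i v x = Dh i w x"
  using partial_cong[OF open_U assms(1,2) differentiable_U[OF assms(3,1)]] assms(1,2)
  by (simp add: Dh_def)

lemma partial_inner:
  assumes x: "x \<in> U" and v: "smooth_on U v" and w: "smooth_on U w"
  shows "partial i (\<lambda>y. v y \<bullet> w y) x = Dh i v x \<bullet> w x + v x \<bullet> Dh i w x"
proof -
  have "partial i (\<lambda>y. v y \<bullet> w y) x = v x \<bullet> partial i w x + partial i v x \<bullet> w x"
    using has_derivative_partial[OF has_derivative_inner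
        [OF smooth_on_has_derivative[OF open_U v x] smooth_on_has_derivative[OF open_U w x]]]
    by (simp add: partial_def)
  moreover have "cross3 (a i x) (v x) \<bullet> w x + v x \<bullet> cross3 (a i x) (w x) = 0"
    by (simp add: cross3_simps)
  ultimately show ?thesis by (simp add: Dh_def inner_add_left inner_add_right)
qed

lemma Dh_scaleR:
  assumes x: "x \<in> U" and c: "smooth_on U c" and v: "smooth_on U v"
  shows "Dh i (\<lambda>y. c y *\<^sub>R v y) x = partial i c x *\<^sub>R v x + c x *\<^sub>R Dh i v x"
  using has_derivative_partial[OF has_derivative_scaleR
        [OF smooth_on_has_derivative[OF open_U c x] smooth_on_has_derivative[OF open_U v x]]]
  by (simp add: Dh_def partial_def algebra_simps cross_mult_right)

lemma Dh_add:
  assumes x: "x \<in> U" and v: "smooth_on U v" and w: "smooth_on U w"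
  shows "Dh i (\<lambda>y. v y + w y) x = Dh i v x + Dh i w x"
  using has_derivative_partial[OF has_derivative_add
        [OF smooth_on_has_derivative[OF open_U v x] smooth_on_has_derivative[OF open_U w x]]]
  by (simp add: Dh_def partial_def algebra_simps cross_add_right)

lemma partial_hat:
  assumes x: "x \<in> U" and V: "smooth_on U V"
  shows "partial i (hat V) x = th (f x) *v partial i V x
    + frechet_derivative th (at (f x)) (partial i f x) *v V x"
  using has_derivative_partial[OF bounded_bilinear.FDERIV[OF bounded_bilinear_matrix_vector_mult
        has_derivative_compose[OF smooth_on_has_derivative[OF open_U smooth_f x] th_deriv[OF f_D[OF x]]]
        smooth_on_has_derivative[OF open_U V x]]]
  by (simp add: hat_def[abs_def] partial_def)

section \<open>Torsion and curvature of the connection along the surface\<close>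

lemma Dh_e_commute:
  assumes x: "x \<in> U"
  shows "Dh i (e j) x = Dh j (e i) x"
  using torsion[OF f_D[OF x], of "partial i f x" "partial j f x"]
    partial_commute[OF open_U smooth_f x, of i j]
  by (simp add: Dh_def e_def partial_hat[OF x smooth_on_partial[OF smooth_f]] a_def hat_def algebra_simps)

lemma partial_a:
  assumes x: "x \<in> U"
  shows "partial i (a j) x = om (f x) *v partial i (partial j f) x
    + frechet_derivative om (at (f x)) (partial i f x) *v partial j f x"
  using has_derivative_partial[OF bounded_bilinear.FDERIV[OF bounded_bilinear_matrix_vector_mult
        has_derivative_compose[OF smooth_on_has_derivative[OF open_U smooth_f x]
          smooth_on_has_derivative[OF open_D smooth_om f_D[OF x]]]
        smooth_on_has_derivative[OF open_U smooth_on_partial[OF smooth_f] x]]]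
  by (simp add: a_def[abs_def] partial_def)

text \<open>The mixed second derivatives of \<open>v\<close> and of \<open>f\<close> cancel, and the
  Jacobi identity gathers the remaining products of connection forms into the pulled back left side
  of \<open>curv\<close>.\<close>

lemma Dh_curvature:
  assumes x: "x \<in> U" and v: "smooth_on U v"
  shows "Dh i (Dh j v) x - Dh j (Dh i v) x = cross3 (Sop (cross3 (e i x) (e j x))) (v x)"
proof -
  have D2: "Dh i (Dh j v) x = partial i (partial j v) x + (cross3 (a j x) (partial i v x)
      + cross3 (partial i (a j) x) (v x)) + cross3 (a i x) (partial j v x + cross3 (a j x) (v x))" for i j
  proof -
    have "partial i (\<lambda>y. partial j v y + cross3 (a j y) (v y)) x = partial i (partial j v) x
        + (cross3 (a j x) (partial i v x) + cross3 (partial i (a j) x) (v x))"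
      using has_derivative_partial[OF has_derivative_add[OF
          smooth_on_has_derivative[OF open_U smooth_on_partial[OF v] x]
          bounded_bilinear.FDERIV[OF bounded_bilinear_cross3
            smooth_on_has_derivative[OF open_U smooth_a x] smooth_on_has_derivative[OF open_U v x]]]]
      by (simp add: partial_def)
    then show ?thesis by (simp add: Dh_def[abs_def])
  qed
  have "Dh i (Dh j v) x - Dh j (Dh i v) x
      = cross3 (partial i (a j) x - partial j (a i) x + cross3 (a i x) (a j x)) (v x)"
    unfolding D2 using partial_commute[OF open_U v x, of i j]
    by (simp add: cross_add_right cross_add_left Cross3.left_diff_distrib cross_cross_left)
  also have "partial i (a j) x - partial j (a i) x + cross3 (a i x) (a j x)
      = Sop (cross3 (e i x) (e j x))"
    using curv[OF f_D[OF x], of "partial i f x" "partial j f x"]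
      partial_commute[OF open_U smooth_f x, of i j]
    by (simp add: partial_a[OF x] a_def[symmetric] e_def hat_def Sop_def)
  finally show ?thesis .
qed

section \<open>Induced metric and second fundamental form\<close>

lemma G_component: "x \<in> U \<Longrightarrow> G x $ i $ j = e i x \<bullet> e j x"
  by (simp add: G_eq metric_ip_eq f_D e_def hat_def)

lemma normal_nz:
  assumes x: "x \<in> U"
  shows "cross3 (e 1 x) (e 2 x) \<noteq> 0"
proof
  assume n: "cross3 (e 1 x) (e 2 x) = 0"
  have quad: "metric_ip G x v v = (v $ 1)\<^sup>2 * (e 1 x \<bullet> e 1 x) + 2 * v $ 1 * v $ 2 * (e 1 x \<bullet> e 2 x)
      + (v $ 2)\<^sup>2 * (e 2 x \<bullet> e 2 x)" for v
    by (simp add: metric_ip_def sum_2 G_component[OF x] inner_commute power2_eq_square algebra_simps)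
  have 1: "e 1 x \<bullet> e 1 x > 0"
    using G_pos[OF x, of "axis 1 1"] by (simp add: quad axis_def vec_eq_iff)
  \<comment> \<open>Coordinates of \<open>(e1 \<bullet> e1) e2 - (e1 \<bullet> e2) e1\<close>, the
    part of \<open>e 2 x\<close> orthogonal to \<open>e 1 x\<close> up to scale. Its squared length
    is \<open>e1 \<bullet> e1\<close> times the Gram determinant, which equals the squared length of
    the cross product.\<close>
  let ?v = "vector [- (e 1 x \<bullet> e 2 x), e 1 x \<bullet> e 1 x] :: real^2"
  have "?v $ 2 \<noteq> 0" using 1 by simp
  then have "?v \<noteq> 0" by (metis zero_index)
  then have "metric_ip G x ?v ?v > 0" by (rule G_pos[OF x])
  moreover have "metric_ip G x ?v ?v
      = (e 1 x \<bullet> e 1 x) * ((e 1 x \<bullet> e 1 x) * (e 2 x \<bullet> e 2 x) - (e 1 x \<bullet> e 2 x)\<^sup>2)"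
    by (simp add: quad power2_eq_square algebra_simps)
  moreover have "(e 1 x \<bullet> e 1 x) * (e 2 x \<bullet> e 2 x) - (e 1 x \<bullet> e 2 x)\<^sup>2
      = cross3 (e 1 x) (e 2 x) \<bullet> cross3 (e 1 x) (e 2 x)"
    by (simp add: dot_cross inner_commute power2_eq_square)
  ultimately show False by (simp add: n)
qed

lemma e_nz: "x \<in> U \<Longrightarrow> e i x \<noteq> 0"
  using normal_nz exhaust_2[of i] by fastforce

lemma ginv_explicit:
  assumes x: "x \<in> U"
  defines "\<delta> \<equiv> cross3 (e 1 x) (e 2 x) \<bullet> cross3 (e 1 x) (e 2 x)"
  shows "\<delta> > 0" "invertible (G x)"
    "ginv 1 1 x = (e 2 x \<bullet> e 2 x) / \<delta>" "ginv 1 2 x = - (e 1 x \<bullet> e 2 x) / \<delta>"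
    "ginv 2 1 x = - (e 1 x \<bullet> e 2 x) / \<delta>" "ginv 2 2 x = (e 1 x \<bullet> e 1 x) / \<delta>"
proof -
  show \<delta>: "\<delta> > 0" using normal_nz[OF x] by (simp add: \<delta>_def)
  have \<delta>_eq: "\<delta> = (e 1 x \<bullet> e 1 x) * (e 2 x \<bullet> e 2 x) - (e 1 x \<bullet> e 2 x) * (e 1 x \<bullet> e 2 x)"
    by (simp add: \<delta>_def dot_cross inner_commute)
  have "G x ** (vector [vector [(e 2 x \<bullet> e 2 x) / \<delta>, - (e 1 x \<bullet> e 2 x) / \<delta>],
      vector [- (e 1 x \<bullet> e 2 x) / \<delta>, (e 1 x \<bullet> e 1 x) / \<delta>]]) = mat 1"
    using \<delta> by (simp add: vec_eq_iff forall_2 matrix_matrix_mult_def sum_2 mat_def G_component[OF x]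
        inner_commute field_simps) (simp add: \<delta>_eq inner_commute algebra_simps)
  then have "matrix_inv (G x) = vector [vector [(e 2 x \<bullet> e 2 x) / \<delta>, - (e 1 x \<bullet> e 2 x) / \<delta>],
      vector [- (e 1 x \<bullet> e 2 x) / \<delta>, (e 1 x \<bullet> e 1 x) / \<delta>]]" and "invertible (G x)"
    using matrix_inv_unique_right matrix_left_right_inverse invertible_def by blast+
  then show "invertible (G x)"
    "ginv 1 1 x = (e 2 x \<bullet> e 2 x) / \<delta>" "ginv 1 2 x = - (e 1 x \<bullet> e 2 x) / \<delta>"
    "ginv 2 1 x = - (e 1 x \<bullet> e 2 x) / \<delta>" "ginv 2 2 x = (e 1 x \<bullet> e 1 x) / \<delta>"
    by (simp_all add: ginv_def)
qed

lemma ginv_commute: "x \<in> U \<Longrightarrow> ginv i j x = ginv j i x"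
  using exhaust_2[of i] exhaust_2[of j] by (auto simp: ginv_explicit)

lemma ginv_contract:
  assumes x: "x \<in> U"
  shows "(\<Sum>l\<in>UNIV. ginv k l x * (e l x \<bullet> e j x)) = (if k = j then 1 else 0)"
proof -
  have "(matrix_inv (G x) ** G x) $ k $ j = (if k = j then 1 else 0)"
    by (simp add: matrix_inv_mult_left[OF ginv_explicit(2)[OF x]] mat_def)
  then show ?thesis by (simp add: matrix_matrix_mult_def ginv_def G_component[OF x])
qed

text \<open>The right side is the tangential projection of \<open>Dh i (e j)\<close>. Projecting an
  ambient connection that is symmetric and metric preserves both properties, so
  \<open>christoffel_eqI\<close> identifies it with the intrinsic connection.\<close>

lemma christoffel_G:
  assumes x: "x \<in> U"
  shows "christoffel (G) x k i j = (\<Sum>l\<in>UNIV. ginv k l x * (Dh i (e j) x \<bullet> e l x))"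
proof (rule christoffel_eqI[where Gam = "\<lambda>k i j. \<Sum>l\<in>UNIV. ginv k l x * (Dh i (e j) x \<bullet> e l x)"])
  show "invertible (G x)" by (rule ginv_explicit[OF x])
  show "G x $ i $ j = G x $ j $ i" for i j by (simp add: G_component[OF x] inner_commute)
  show "(\<Sum>l\<in>UNIV. ginv k l x * (Dh i (e j) x \<bullet> e l x))
      = (\<Sum>l\<in>UNIV. ginv k l x * (Dh j (e i) x \<bullet> e l x))" for k i j
    by (simp add: Dh_e_commute[OF x, of i j])
  have proj: "(\<Sum>k\<in>UNIV. (\<Sum>l\<in>UNIV. ginv k l x * (w \<bullet> e l x)) * G x $ k $ j) = w \<bullet> e j x" for w j
  proof -
    have "(\<Sum>k\<in>UNIV. (\<Sum>l\<in>UNIV. ginv k l x * (w \<bullet> e l x)) * G x $ k $ j)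
        = (\<Sum>l\<in>UNIV. (w \<bullet> e l x) * (\<Sum>k\<in>UNIV. ginv l k x * (e k x \<bullet> e j x)))"
      by (simp add: sum_2 G_component[OF x] ginv_commute[OF x, of 2 1] algebra_simps)
    then show ?thesis by (simp add: ginv_contract[OF x] if_distrib cong: if_cong)
  qed
  show "partial l (\<lambda>y. G y $ i $ j) x
      = (\<Sum>k\<in>UNIV. (\<Sum>m\<in>UNIV. ginv k m x * (Dh l (e i) x \<bullet> e m x)) * G x $ k $ j)
        + (\<Sum>k\<in>UNIV. (\<Sum>m\<in>UNIV. ginv k m x * (Dh l (e j) x \<bullet> e m x)) * G x $ k $ i)" for l i j
  proof -
    have "partial l (\<lambda>y. G y $ i $ j) x = partial l (\<lambda>y. e i y \<bullet> e j y) x"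
      by (rule partial_cong[OF open_U x, symmetric])
         (auto simp: G_component intro!: differentiable_U[OF smooth_on_inner] open_U smooth_e x)
    then show ?thesis
      unfolding proj by (simp add: partial_inner[OF x smooth_e smooth_e] inner_commute)
  qed
qed

lemma B_eq:
  assumes x: "x \<in> U"
  shows "B i j x = Dh i (e j) x - (\<Sum>k\<in>UNIV. christoffel G x k i j *\<^sub>R e k x)"
proof -
  have "hat (cov_deriv H f i (partial j f)) x = Dh i (e j) x"
    by (simp add: hat_cov_deriv[OF smooth_on_partial[OF smooth_f] x] e_def)
  then show ?thesis
    by (simp add: B_def nabla_d_def matrix_vector_mult_diff_distrib hat_def e_def sum_2
        matrix_vector_right_distrib matrix_vector_mult_scaleR)
qed

lemma B_normal:
  assumes x: "x \<in> U"
  shows "B i j x \<bullet> e l x = 0"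
proof -
  have "(\<Sum>k\<in>UNIV. christoffel G x k i j * (e k x \<bullet> e l x))
      = (\<Sum>m\<in>UNIV. (Dh i (e j) x \<bullet> e m x) * (\<Sum>k\<in>UNIV. ginv m k x * (e k x \<bullet> e l x)))"
    by (simp add: sum_2 christoffel_G[OF x] ginv_commute[OF x, of 2 1] algebra_simps)
  also have "\<dots> = Dh i (e j) x \<bullet> e l x"
    by (simp add: ginv_contract[OF x] if_distrib cong: if_cong)
  finally show ?thesis
    by (simp add: B_eq[OF x] inner_diff_left inner_sum_left)
qed

lemma B_commute: "x \<in> U \<Longrightarrow> B i j x = B j i x"
  by (simp add: B_eq christoffel_G Dh_e_commute[of x i j])

text \<open>Against a normal field the Christoffel terms of \<open>B\<close> vanish and
  \<open>Dh i (e j)\<close> alone remains, so smoothness is seen without that of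
  \<open>matrix_inv (G x)\<close>.\<close>

lemma smooth_B_normal:
  assumes "smooth_on U \<xi>" "\<And>x. x \<in> U \<Longrightarrow> \<xi> x \<bullet> e 1 x = 0" "\<And>x. x \<in> U \<Longrightarrow> \<xi> x \<bullet> e 2 x = 0"
  shows "smooth_on U (\<lambda>x. B i j x \<bullet> \<xi> x)"
proof -
  have "smooth_on U (\<lambda>x. Dh i (e j) x \<bullet> \<xi> x)"
    by (intro smooth_on_inner smooth_Dh smooth_e open_U assms)
  moreover have "Dh i (e j) x \<bullet> \<xi> x = B i j x \<bullet> \<xi> x" if "x \<in> U" for x
    using assms(2,3)[OF that]
    by (simp add: B_eq[OF that] inner_diff_left sum_2 inner_add_left inner_commute[of _ "\<xi> x"]
        inner_diff_right inner_add_right)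
  ultimately show ?thesis using smooth_on_cong[OF open_U] by (metis (no_types, lifting))
qed

lemma hat_tension:
  "hat (tension G H f) x = (\<Sum>i\<in>UNIV. \<Sum>j\<in>UNIV. ginv i j x *\<^sub>R B i j x)"
  by (simp add: hat_def tension_def ginv_def B_def sum_2 matrix_vector_right_distrib
      matrix_vector_mult_scaleR)

text \<open>\<open>T\<close> is any closed form of the tension field on \<open>U\<close>; the
  umbilical case inserts \<open>2h\<xi>\<close>. Smoothness of each intermediate field is recovered
  from its frame components before it is differentiated again.\<close>

lemma hat_bitension:
  assumes x: "x \<in> U" and T: "smooth_on U T" and hT: "\<And>y. y \<in> U \<Longrightarrow> hat (tension G H f) y = T y"
  shows "hat (bitension G H f) x =
    (\<Sum>i\<in>UNIV. \<Sum>j\<in>UNIV. ginv i j x *\<^sub>R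
       (Dh i (Dh j T) x - (\<Sum>k\<in>UNIV. christoffel G x k i j *\<^sub>R Dh k T x)))
    - (\<Sum>i\<in>UNIV. \<Sum>j\<in>UNIV. ginv i j x *\<^sub>R cross3 (Sop (cross3 (e i x) (T x))) (e j x))"
proof -
  let ?t = "tension G H f"
  have t: "smooth_on U ?t" by (rule smooth_unhat[OF T hT])
  have ht: "smooth_on U (hat ?t)" by (rule smooth_hat[OF t])
  have D1: "hat (cov_deriv H f j ?t) y = Dh j T y" if "y \<in> U" for j y
    using hat_cov_deriv[OF t that] Dh_cong[OF that hT ht] by simp
  have ct: "smooth_on U (cov_deriv H f j ?t)" for j
    by (rule smooth_unhat[OF smooth_Dh[OF T] D1])
  have D2: "hat (cov_deriv H f i (cov_deriv H f j ?t)) x = Dh i (Dh j T) x" for i j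
    using hat_cov_deriv[OF ct x] Dh_cong[OF x D1 smooth_hat[OF ct]] by simp
  have R: "th (f x) *v curvature_op H (f x) (partial i f x) (?t x) (partial j f x)
      = cross3 (Sop (cross3 (e i x) (T x))) (e j x)" for i j
    using hT[OF x] by (simp add: curvature_op_H[OF f_D[OF x]] e_def hat_def)
  show ?thesis
    unfolding hat_def[of "bitension G H f"] bitension_def Let_def ginv_def[symmetric] sum_2
      matrix_vector_mult_diff_distrib matrix_vector_right_distrib matrix_vector_mult_scaleR R
      D1[OF x, unfolded hat_def] D2[unfolded hat_def] ..
qed

end

subsection \<open>Umbilical surfaces\<close>

locale umbilic_surf = surf +
  fixes \<xi> :: "real^2 \<Rightarrow> real^3" and h :: "real^2 \<Rightarrow> real"
  assumes smooth_xi: "smooth_on U \<xi>" and smooth_h: "smooth_on U h"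
    and unit_xi: "x \<in> U \<Longrightarrow> \<xi> x \<bullet> \<xi> x = 1"
    and normal_xi: "x \<in> U \<Longrightarrow> \<xi> x \<bullet> e i x = 0"
    and B_umb: "x \<in> U \<Longrightarrow> B i j x = (h x * (e i x \<bullet> e j x)) *\<^sub>R \<xi> x"
begin

lemma frame_eq_0:
  "x \<in> U \<Longrightarrow> v \<bullet> e 1 x = 0 \<Longrightarrow> v \<bullet> e 2 x = 0 \<Longrightarrow> v \<bullet> \<xi> x = 0 \<Longrightarrow> v = 0"
  using eq_0_if_orthogonal_frame[OF normal_nz normal_xi normal_xi] unit_xi by force

lemma Dh_e: "x \<in> U \<Longrightarrow> Dh i (e j) x
    = (\<Sum>k\<in>UNIV. christoffel G x k i j *\<^sub>R e k x) + (h x * (e i x \<bullet> e j x)) *\<^sub>R \<xi> x"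
  using B_eq[of x i j] B_umb[of x i j] by simp

text \<open>Weingarten's equation, found by differentiating \<open>\<xi> \<bullet> \<xi> = 1\<close>
  and \<open>\<xi> \<bullet> e j = 0\<close>.\<close>

lemma Dh_xi:
  assumes x: "x \<in> U"
  shows "Dh i \<xi> x = - h x *\<^sub>R e i x"
proof -
  have "partial i (\<lambda>y. \<xi> y \<bullet> \<xi> y) x = partial i (\<lambda>y. 1) x"
    by (rule partial_cong[OF open_U x]) (auto simp: unit_xi intro!: differentiable_U smooth_on_inner open_U smooth_xi x)
  then have 1: "Dh i \<xi> x \<bullet> \<xi> x = 0"
    using partial_inner[OF x smooth_xi smooth_xi, of i] by (simp add: partial_def inner_commute)
  have "Dh i \<xi> x \<bullet> e j x = - h x * (e i x \<bullet> e j x)" for j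
  proof -
    have "partial i (\<lambda>y. \<xi> y \<bullet> e j y) x = partial i (\<lambda>y. 0) x"
      by (rule partial_cong[OF open_U x]) (auto simp: normal_xi intro!: differentiable_U smooth_on_inner open_U smooth_xi smooth_e x)
    then have "Dh i \<xi> x \<bullet> e j x + \<xi> x \<bullet> Dh i (e j) x = 0"
      using partial_inner[OF x smooth_xi smooth_e, of i j] by (simp add: partial_def)
    then show ?thesis
      by (simp add: Dh_e[OF x] inner_add_right inner_sum_right normal_xi[OF x] unit_xi[OF x])
  qed
  then have "Dh i \<xi> x + h x *\<^sub>R e i x = 0"
    using 1 normal_xi[OF x]
    by (intro frame_eq_0[OF x]) (auto simp: inner_add_left inner_commute[of "e i x" "\<xi> x"])
  then show ?thesis by (simp add: eq_neg_iff_add_eq_0)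
qed

text \<open>The curvature acting on \<xi> is computed a second time from Weingarten's equation: the
  terms with \<open>Dh i (e j)\<close> cancel by symmetry, and a combination of \<open>e 1\<close>
  and \<open>e 2\<close> with the derivatives of \<open>h\<close> as coefficients remains. As
  \<open>cross3 (e 1 x) (e 2 x)\<close> is a multiple of \<xi>, pairing with
  \<open>cross3 (\<xi> x) (e k x)\<close> isolates one derivative.\<close>

lemma codazzi:
  assumes x: "x \<in> U"
  shows "partial k h x = Sop (\<xi> x) \<bullet> e k x"
proof -
  have mh: "smooth_on U (\<lambda>y. - h y)"
    by (rule smooth_on_minus[OF open_U smooth_h])
  have D1: "Dh i (Dh j \<xi>) x = Dh i (\<lambda>y. - h y *\<^sub>R e j y) x" for i j
    by (rule Dh_cong[OF x Dh_xi smooth_Dh[OF smooth_xi]])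
  have D2: "partial i (\<lambda>y. - h y) x = - partial i h x" for i
    using has_derivative_partial[OF has_derivative_minus[OF smooth_on_has_derivative[OF open_U smooth_h x]]]
    by (simp add: partial_def)
  have DD: "Dh i (Dh j \<xi>) x = - partial i h x *\<^sub>R e j x - h x *\<^sub>R Dh i (e j) x" for i j
    unfolding D1 Dh_scaleR[OF x mh smooth_e] D2 by simp
  let ?n = "cross3 (e 1 x) (e 2 x)"
  have n\<xi>: "?n = (?n \<bullet> \<xi> x) *\<^sub>R \<xi> x"
    using frame_eq_0[OF x, of "?n - (?n \<bullet> \<xi> x) *\<^sub>R \<xi> x"] unit_xi[OF x] normal_xi[OF x]
    by (simp add: inner_diff_left dot_cross_self)
  have nz: "?n \<bullet> \<xi> x \<noteq> 0" using n\<xi> normal_nz[OF x] by (metis scale_zero_left)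
  have C: "partial 2 h x *\<^sub>R e 1 x - partial 1 h x *\<^sub>R e 2 x = (?n \<bullet> \<xi> x) *\<^sub>R cross3 (Sop (\<xi> x)) (\<xi> x)"
  proof -
    have "cross3 (Sop ?n) (\<xi> x) = (?n \<bullet> \<xi> x) *\<^sub>R cross3 (Sop (\<xi> x)) (\<xi> x)"
      by (subst n\<xi>) (simp only: linear_scale[OF linear_Sop] cross_mult_left)
    then show ?thesis
      using Dh_curvature[OF x smooth_xi, of 1 2] by (simp add: DD Dh_e_commute[OF x, of 2 1])
  qed
  have r: "(?n \<bullet> \<xi> x) * (cross3 (Sop (\<xi> x)) (\<xi> x) \<bullet> cross3 (\<xi> x) (e k x))
      = - (?n \<bullet> \<xi> x) * (Sop (\<xi> x) \<bullet> e k x)" for k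
    using unit_xi[OF x] normal_xi[OF x] by (simp add: dot_cross)
  have t: "e 2 x \<bullet> cross3 (\<xi> x) (e 1 x) = ?n \<bullet> \<xi> x" "e 1 x \<bullet> cross3 (\<xi> x) (e 2 x) = - (?n \<bullet> \<xi> x)"
    by (simp_all add: cross3_simps)
  have "- partial 1 h x * (?n \<bullet> \<xi> x) = - (?n \<bullet> \<xi> x) * (Sop (\<xi> x) \<bullet> e 1 x)"
    using arg_cong[OF C, of "\<lambda>v. v \<bullet> cross3 (\<xi> x) (e 1 x)"] r[of 1] t
    by (simp add: inner_diff_left dot_cross_self)
  moreover have "- partial 2 h x * (?n \<bullet> \<xi> x) = - (?n \<bullet> \<xi> x) * (Sop (\<xi> x) \<bullet> e 2 x)"
    using arg_cong[OF C, of "\<lambda>v. v \<bullet> cross3 (\<xi> x) (e 2 x)"] r[of 2] t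
    by (simp add: inner_diff_left dot_cross_self)
  ultimately show ?thesis using nz exhaust_2[of k] by auto
qed

text \<open>The negative of the Ricci operator on \<xi>, namely
  \<open>tr(S) \<xi> - S \<xi>\<close>. The dual frame \<open>E\<close> absorbs the inverse metric,
  and crossing it with the normal returns the original frame, which leaves an identity in
  \<open>e 1\<close> and \<open>e 2\<close>.\<close>

lemma curvature_trace:
  assumes x: "x \<in> U"
  shows "(\<Sum>i\<in>UNIV. \<Sum>j\<in>UNIV. ginv i j x *\<^sub>R cross3 (Sop (cross3 (e i x) (\<xi> x))) (e j x))
    = (2 * s + t) *\<^sub>R \<xi> x - Sop (\<xi> x)"
proof -
  let ?n = "cross3 (e 1 x) (e 2 x)" and ?S = "\<lambda>v. Sop (cross3 v (\<xi> x))"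
  \<comment> \<open>Signed area factor of the frame: its sign records whether \<xi> points along the
    cross product, so no orientation has to be fixed.\<close>
  define \<nu> where "\<nu> = ?n \<bullet> \<xi> x"
  have n\<xi>: "?n = \<nu> *\<^sub>R \<xi> x"
    using frame_eq_0[OF x, of "?n - \<nu> *\<^sub>R \<xi> x"] unit_xi[OF x] normal_xi[OF x]
    by (simp add: inner_diff_left dot_cross_self \<nu>_def)
  have nz: "\<nu> \<noteq> 0" using n\<xi> normal_nz[OF x] by auto
  have \<delta>: "?n \<bullet> ?n = \<nu> * \<nu>" by (simp add: n\<xi> unit_xi[OF x])
  define E where "E j = ginv 1 j x *\<^sub>R e 1 x + ginv 2 j x *\<^sub>R e 2 x" for j
  have E1: "\<nu> *\<^sub>R cross3 (E 1) (\<xi> x) = - e 2 x" and E2: "\<nu> *\<^sub>R cross3 (E 2) (\<xi> x) = e 1 x"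
  proof -
    have xn: "cross3 w (\<xi> x) = (1 / \<nu>) *\<^sub>R cross3 w ?n" for w
      using nz by (simp add: n\<xi> cross_mult_right)
    have "\<nu> *\<^sub>R cross3 (E j) (\<xi> x) = (E j \<bullet> e 2 x) *\<^sub>R e 1 x - (E j \<bullet> e 1 x) *\<^sub>R e 2 x" for j
      using nz by (simp add: xn Lagrange)
    moreover have "E j \<bullet> e l x = (if j = l then 1 else 0)" for j l
      using ginv_contract[OF x, of j l] ginv_commute[OF x, of _ j]
      by (simp add: E_def sum_2 inner_add_left)
    ultimately show "\<nu> *\<^sub>R cross3 (E 1) (\<xi> x) = - e 2 x" "\<nu> *\<^sub>R cross3 (E 2) (\<xi> x) = e 1 x"
      by simp_all
  qed
  have "(\<Sum>i\<in>UNIV. \<Sum>j\<in>UNIV. ginv i j x *\<^sub>R cross3 (?S (e i x)) (e j x))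
      = cross3 (?S (E 1)) (e 1 x) + cross3 (?S (E 2)) (e 2 x)"
    by (simp add: sum_2 E_def cross_add_left cross_mult_left linear_add[OF linear_Sop]
        linear_scale[OF linear_Sop] ac_simps)
  then have "\<nu> *\<^sub>R (\<Sum>i\<in>UNIV. \<Sum>j\<in>UNIV. ginv i j x *\<^sub>R cross3 (?S (e i x)) (e j x))
      = cross3 (Sop (\<nu> *\<^sub>R cross3 (E 1) (\<xi> x))) (e 1 x) + cross3 (Sop (\<nu> *\<^sub>R cross3 (E 2) (\<xi> x))) (e 2 x)"
    by (simp add: linear_scale[OF linear_Sop] cross_mult_left scaleR_add_right)
  also have "\<dots> = cross3 (Sop (- e 2 x)) (e 1 x) + cross3 (Sop (e 1 x)) (e 2 x)"
    by (simp only: E1 E2)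
  also have "\<dots> = (2 * s + t) *\<^sub>R ?n - Sop ?n"
    by (simp add: vec_eq_iff forall_3 cross_components Sop_def axis_def algebra_simps)
  also have "\<dots> = \<nu> *\<^sub>R ((2 * s + t) *\<^sub>R \<xi> x - Sop (\<xi> x))"
    by (simp add: n\<xi> linear_scale[OF linear_Sop] algebra_simps)
  finally show ?thesis using nz by (simp only: scaleR_cancel_left) simp
qed

lemma hat_tension_umb:
  assumes x: "x \<in> U"
  shows "hat (tension G H f) x = (2 * h x) *\<^sub>R \<xi> x"
proof -
  have "hat (tension G H f) x = (h x * (\<Sum>i\<in>UNIV. \<Sum>j\<in>UNIV. ginv i j x * (e j x \<bullet> e i x))) *\<^sub>R \<xi> x"
    by (simp add: hat_tension B_umb[OF x] sum_2 algebra_simps inner_commute)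
  also have "(\<Sum>i\<in>UNIV. \<Sum>j\<in>UNIV. ginv i j x * (e j x \<bullet> e i x)) = 2"
    by (simp add: ginv_contract[OF x])
  finally show ?thesis by (simp add: mult.commute)
qed

text \<open>The Laplace-Beltrami operator applied to \<open>h\<close>; it stays unevaluated because
  it is only used where \<open>h\<close> is locally constant.\<close>

definition lap :: "real^2 \<Rightarrow> real" where
  "lap x = (\<Sum>i\<in>UNIV. \<Sum>j\<in>UNIV. ginv i j x *
     (partial i (partial j h) x - (\<Sum>k\<in>UNIV. christoffel G x k i j * partial k h x)))"

text \<open>Weingarten's equation is used twice on \<open>2h\<xi>\<close>. Contraction merges the
  gradient terms with coefficients 2 and 4 into 6, and \<open>-2h^3\<close> doubles because the
  induced metric has trace 2.\<close>

lemma hat_bitension_umb: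
  assumes x: "x \<in> U"
  shows "hat (bitension G H f) x = (2 * lap x - 4 * h x ^ 3) *\<^sub>R \<xi> x
    - (6 * h x) *\<^sub>R (\<Sum>i\<in>UNIV. \<Sum>j\<in>UNIV. (ginv i j x * partial i h x) *\<^sub>R e j x)
    - (2 * h x) *\<^sub>R ((2 * s + t) *\<^sub>R \<xi> x - Sop (\<xi> x))"
proof -
  let ?T = "\<lambda>y. (2 * h y) *\<^sub>R \<xi> y"
  have h2: "smooth_on U (\<lambda>y. 2 * h y)"
    by (intro smooth_on_mult smooth_on_const open_U smooth_h)
  have T: "smooth_on U ?T"
    by (intro smooth_on_scaleR open_U h2 smooth_xi)
  have dh2: "partial i (\<lambda>y. 2 * h y) y = 2 * partial i h y" if "y \<in> U" for i y
    using has_derivative_partial[OF bounded_linear.has_derivative[OF bounded_linear_mult_right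
          smooth_on_has_derivative[OF open_U smooth_h that]], of i 2]
    by (simp add: partial_def)
  have DT: "Dh j ?T y = (2 * partial j h y) *\<^sub>R \<xi> y + (- 2 * (h y)\<^sup>2) *\<^sub>R e j y" if "y \<in> U" for j y
    by (simp add: Dh_scaleR[OF that h2 smooth_xi] dh2[OF that] Dh_xi[OF that] power2_eq_square)
  have DDT: "Dh i (Dh j ?T) x = (2 * partial i (partial j h) x) *\<^sub>R \<xi> x
      - (2 * partial j h x * h x) *\<^sub>R e i x - (4 * h x * partial i h x) *\<^sub>R e j x
      - (2 * (h x)\<^sup>2) *\<^sub>R Dh i (e j) x" for i j
  proof -
    have s1: "smooth_on U (\<lambda>y. 2 * partial j h y)"
      by (intro smooth_on_mult smooth_on_const open_U smooth_on_partial smooth_h)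
    have s2: "smooth_on U (\<lambda>y. - 2 * (h y)\<^sup>2)"
      unfolding power2_eq_square by (intro smooth_on_mult smooth_on_const open_U smooth_h)
    have d1: "partial i (\<lambda>y. 2 * partial j h y) x = 2 * partial i (partial j h) x"
      using has_derivative_partial[OF bounded_linear.has_derivative[OF bounded_linear_mult_right
            smooth_on_has_derivative[OF open_U smooth_on_partial[OF smooth_h] x]], of i 2]
      by (simp add: partial_def)
    have d2: "partial i (\<lambda>y. - 2 * (h y)\<^sup>2) x = - 4 * h x * partial i h x"
    proof -
      have "((\<lambda>y. - 2 * (h y)\<^sup>2) has_derivative (\<lambda>v. - 4 * h x * frechet_derivative h (at x) v)) (at x)"
        using smooth_on_has_derivative[OF open_U smooth_h x]
        by (auto intro!: derivative_eq_intros)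
      from has_derivative_partial[OF this, of i] show ?thesis by (simp add: partial_def)
    qed
    have "Dh i (Dh j ?T) x = Dh i (\<lambda>y. (2 * partial j h y) *\<^sub>R \<xi> y + (- 2 * (h y)\<^sup>2) *\<^sub>R e j y) x"
      by (rule Dh_cong[OF x DT smooth_Dh[OF T]])
    also have "\<dots> = (2 * partial i (partial j h) x) *\<^sub>R \<xi> x + (2 * partial j h x) *\<^sub>R Dh i \<xi> x
        + ((- 4 * h x * partial i h x) *\<^sub>R e j x + (- 2 * (h x)\<^sup>2) *\<^sub>R Dh i (e j) x)"
      by (simp only: Dh_add[OF x smooth_on_scaleR[OF open_U s1 smooth_xi] smooth_on_scaleR[OF open_U s2 smooth_e]]
          Dh_scaleR[OF x s1 smooth_xi] Dh_scaleR[OF x s2 smooth_e] d1 d2)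
    finally show ?thesis by (simp add: Dh_xi[OF x] algebra_simps)
  qed
  \<comment> \<open>The Christoffel part of \<open>Dh i (e j)\<close> cancels against the tangential
    part of the correction term.\<close>
  have DDT': "Dh i (Dh j ?T) x - (\<Sum>k\<in>UNIV. christoffel G x k i j *\<^sub>R Dh k ?T x)
    = (2 * (partial i (partial j h) x - (\<Sum>k\<in>UNIV. christoffel G x k i j * partial k h x))
        - 2 * h x ^ 3 * (e j x \<bullet> e i x)) *\<^sub>R \<xi> x
      - (2 * partial j h x * h x) *\<^sub>R e i x - (4 * h x * partial i h x) *\<^sub>R e j x" for i j
    unfolding DDT DT[OF x] Dh_e[OF x] sum_2
    by (simp add: algebra_simps power2_eq_square power3_eq_cube inner_commute)
  have g2: "(\<Sum>i\<in>UNIV. \<Sum>j\<in>UNIV. ginv i j x * (e j x \<bullet> e i x)) = 2"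
    by (simp add: ginv_contract[OF x])
  have P1: "(\<Sum>i\<in>UNIV. \<Sum>j\<in>UNIV. ginv i j x *\<^sub>R
       (Dh i (Dh j ?T) x - (\<Sum>k\<in>UNIV. christoffel G x k i j *\<^sub>R Dh k ?T x)))
    = (2 * lap x - 2 * h x ^ 3 * (\<Sum>i\<in>UNIV. \<Sum>j\<in>UNIV. ginv i j x * (e j x \<bullet> e i x))) *\<^sub>R \<xi> x
      - (6 * h x) *\<^sub>R (\<Sum>i\<in>UNIV. \<Sum>j\<in>UNIV. (ginv i j x * partial i h x) *\<^sub>R e j x)"
    unfolding DDT' lap_def
    by (simp add: vec_eq_iff sum_2 algebra_simps ginv_commute[OF x, of 2 1])
  have P2: "(\<Sum>i\<in>UNIV. \<Sum>j\<in>UNIV. ginv i j x *\<^sub>R cross3 (Sop (cross3 (e i x) (?T x))) (e j x))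
      = (2 * h x) *\<^sub>R (\<Sum>i\<in>UNIV. \<Sum>j\<in>UNIV. ginv i j x *\<^sub>R cross3 (Sop (cross3 (e i x) (\<xi> x))) (e j x))"
    by (simp add: cross_mult_right linear_scale[OF linear_Sop] cross_mult_left scaleR_sum_right mult.commute)
  have "hat (bitension G H f) x =
    (\<Sum>i\<in>UNIV. \<Sum>j\<in>UNIV. ginv i j x *\<^sub>R
       (Dh i (Dh j ?T) x - (\<Sum>k\<in>UNIV. christoffel G x k i j *\<^sub>R Dh k ?T x)))
    - (\<Sum>i\<in>UNIV. \<Sum>j\<in>UNIV. ginv i j x *\<^sub>R cross3 (Sop (cross3 (e i x) (?T x))) (e j x))"
    by (rule hat_bitension[OF x T]) (rule hat_tension_umb)
  then show ?thesis
    unfolding P1 P2 g2 curvature_trace[OF x] by simp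
qed

text \<open>Pairing with \<open>e k\<close> leaves \<open>-6h\<close> times the derivative of
  \<open>h\<close> from the rough Laplacian and, by Codazzi, \<open>+2h\<close> times it from the
  curvature; these do not cancel.\<close>

lemma biharmonic_tangential:
  assumes x: "x \<in> U" and 0: "bitension G H f x = 0"
  shows "h x * partial k h x = 0"
proof -
  have "(\<Sum>i\<in>UNIV. \<Sum>j\<in>UNIV. (ginv i j x * partial i h x) * (e j x \<bullet> e k x))
      = (\<Sum>i\<in>UNIV. partial i h x * (\<Sum>j\<in>UNIV. ginv i j x * (e j x \<bullet> e k x)))"
    by (simp add: sum_distrib_left ac_simps)
  also have "\<dots> = partial k h x"
    by (simp add: ginv_contract[OF x] if_distrib cong: if_cong)
  finally have g: "(\<Sum>i\<in>UNIV. \<Sum>j\<in>UNIV. (ginv i j x * partial i h x) * (e j x \<bullet> e k x)) = partial k h x" .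
  have "hat (bitension G H f) x \<bullet> e k x = 0"
    by (simp add: hat_def 0)
  then have "- (6 * h x) * partial k h x + 2 * h x * (Sop (\<xi> x) \<bullet> e k x) = 0"
    unfolding hat_bitension_umb[OF x]
    by (simp add: inner_diff_left inner_sum_left g normal_xi[OF x])
  then show ?thesis by (simp add: codazzi[OF x, symmetric])
qed

text \<open>Where \<open>h\<close> has no zero the tangential equation makes it locally constant,
  and openness of \<open>V\<close> lets the second derivatives vanish as well. The first right side
  is \<open>Ric(\<xi>, \<xi>)\<close>; the second claim is Codazzi's equation with vanishing left
  side.\<close>

lemma biharmonic_normal:
  assumes V: "open V" "V \<subseteq> U" "x \<in> V"
    and h: "\<And>y. y \<in> V \<Longrightarrow> h y \<noteq> 0" and 0: "\<And>y. y \<in> V \<Longrightarrow> bitension G H f y = 0"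
  shows "2 * (h x)\<^sup>2 = - (2 * s) - (t - s) * (1 - (\<xi> x $ 3)\<^sup>2)"
    and "(t - s) * \<xi> x $ 3 * e k x $ 3 = 0"
proof -
  have x: "x \<in> U" using V by blast
  have dh: "partial k h y = 0" if "y \<in> V" for k y
    using biharmonic_tangential[of y k] h[OF that] 0[OF that] that V(2) by auto
  have ddh: "partial i (partial k h) x = 0" for i k
    using partial_cong[OF V(1,3) dh differentiable_U[OF smooth_on_partial[OF smooth_h] x]]
    by (simp add: partial_def)
  have S: "Sop (\<xi> x) \<bullet> \<xi> x = s + (t - s) * (\<xi> x $ 3)\<^sup>2"
    by (simp add: Sop_def inner_add_left unit_xi[OF x] inner_axis' power2_eq_square)
  have lap0: "lap x = 0"
    by (simp add: lap_def ddh dh[OF V(3)])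
  have "hat (bitension G H f) x \<bullet> \<xi> x = 0"
    by (simp add: hat_def 0[OF V(3)])
  then have "- 4 * h x ^ 3 - 2 * h x * (2 * s + t - (s + (t - s) * (\<xi> x $ 3)\<^sup>2)) = 0"
    unfolding hat_bitension_umb[OF x] by (simp add: inner_diff_left unit_xi[OF x] S lap0 dh[OF V(3)])
  then have "h x * (2 * (2 * (h x)\<^sup>2 + (2 * s + t - (s + (t - s) * (\<xi> x $ 3)\<^sup>2)))) = 0"
    by (simp add: algebra_simps power2_eq_square power3_eq_cube)
  then have "2 * (h x)\<^sup>2 + (2 * s + t - (s + (t - s) * (\<xi> x $ 3)\<^sup>2)) = 0"
    using h[OF V(3)] by (metis mult_eq_0_iff zero_neq_numeral)
  then show "2 * (h x)\<^sup>2 = - (2 * s) - (t - s) * (1 - (\<xi> x $ 3)\<^sup>2)"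
    by (simp add: algebra_simps)
  show "(t - s) * \<xi> x $ 3 * e k x $ 3 = 0"
    using codazzi[OF x, of k] dh[OF V(3), of k] normal_xi[OF x, of k]
    by (simp add: Sop_def inner_add_left inner_axis')
qed

end

section \<open>Coinciding principal curvatures and the shape of the second fundamental form\<close>

lemma rank_one:
  fixes a b d x y :: real
  assumes "a * x + b * y = 0" "b * x + d * y = 0"
  shows "(x\<^sup>2 + y\<^sup>2) * a = (a + d) * y\<^sup>2" "(x\<^sup>2 + y\<^sup>2) * b = - (a + d) * x * y"
    "(x\<^sup>2 + y\<^sup>2) * d = (a + d) * x\<^sup>2"
  using assms by algebra+

text \<open>For the eigenvalue \<open>k\<close> the symmetric matrix \<open>b - k g\<close>
  annihilates \<open>v\<close>, hence is \<open>\<alpha> n n^T\<close> with \<open>n\<close> the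
  vector \<open>v\<close> turned by a right angle. Then \<open>w = g^-1 n\<close> is an eigenvector
  for \<open>k + \<alpha> (n \<bullet> w)\<close>; uniqueness and \<open>n \<bullet> w > 0\<close>
  force \<open>\<alpha> = 0\<close>.\<close>

lemma unique_eigenvalue_imp_scalar:
  fixes g b :: "real^2^2"
  assumes inv: "invertible g" and pos: "\<And>v. v \<noteq> 0 \<Longrightarrow> v \<bullet> (g *v v) > 0"
    and sym: "b $ 1 $ 2 = b $ 2 $ 1"  "g $ 1 $ 2 = g $ 2 $ 1"
    and uniq: "\<exists>!k. \<exists>v. v \<noteq> 0 \<and> (matrix_inv g ** b) *v v = k *\<^sub>R v"
  shows "\<exists>k. \<forall>i j. b $ i $ j = k * g $ i $ j"
proof -
  have eig: "(matrix_inv g ** b) *v v = k *\<^sub>R v \<longleftrightarrow> b *v v = k *\<^sub>R (g *v v)" for v k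
  proof -
    have "(matrix_inv g ** b) *v v = k *\<^sub>R v \<longleftrightarrow> g *v ((matrix_inv g ** b) *v v) = g *v (k *\<^sub>R v)"
      by (simp only: inj_eq[OF inj_matrix_vector_mult[OF inv]])
    then show ?thesis
      by (simp add: matrix_vector_mul_assoc matrix_mul_assoc matrix_inv_mult_right[OF inv]
          matrix_vector_mult_scaleR)
  qed
  obtain k v where v: "v \<noteq> 0" "b *v v = k *\<^sub>R (g *v v)"
    and k: "\<And>k' w. w \<noteq> 0 \<Longrightarrow> b *v w = k' *\<^sub>R (g *v w) \<Longrightarrow> k' = k"
    using uniq unfolding eig by (metis (no_types, lifting))
  define c where "c i j = b $ i $ j - k * g $ i $ j" for i j
  have cv: "c 1 1 * v $ 1 + c 1 2 * v $ 2 = 0" "c 1 2 * v $ 1 + c 2 2 * v $ 2 = 0"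
    using v(2) by (simp_all add: vec_eq_iff forall_2 matrix_vector_mult_def sum_2 c_def sym algebra_simps)
  have c21: "c 2 1 = c 1 2" by (simp add: c_def sym)
  have vv: "(v $ 1)\<^sup>2 + (v $ 2)\<^sup>2 > 0"
    using v(1) by (simp add: vec_eq_iff forall_2 sum_power2_gt_zero_iff)
  define \<alpha> where "\<alpha> = (c 1 1 + c 2 2) / ((v $ 1)\<^sup>2 + (v $ 2)\<^sup>2)"
  have \<alpha>: "\<alpha> * ((v $ 1)\<^sup>2 + (v $ 2)\<^sup>2) = c 1 1 + c 2 2"
    unfolding \<alpha>_def using less_imp_neq[OF vv] by (metis nonzero_eq_divide_eq)
  have c: "c 1 1 = \<alpha> * (v $ 2)\<^sup>2" "c 1 2 = - \<alpha> * v $ 1 * v $ 2" "c 2 2 = \<alpha> * (v $ 1)\<^sup>2"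
  proof -
    let ?q = "(v $ 1)\<^sup>2 + (v $ 2)\<^sup>2"
    have q: "?q \<noteq> 0" using less_imp_neq[OF vv] by (rule not_sym)
    note r = rank_one[OF cv, folded \<alpha>]
    show "c 1 1 = \<alpha> * (v $ 2)\<^sup>2"
      by (rule mult_left_cancel[OF q, THEN iffD1]) (use r in \<open>simp only: ac_simps\<close>)
    show "c 1 2 = - \<alpha> * v $ 1 * v $ 2"
      by (rule mult_left_cancel[OF q, THEN iffD1]) (use r in \<open>simp only: mult_minus_left mult_minus_right ac_simps\<close>)
    show "c 2 2 = \<alpha> * (v $ 1)\<^sup>2"
      by (rule mult_left_cancel[OF q, THEN iffD1]) (use r in \<open>simp only: ac_simps\<close>)
  qed
  define n where "n = (vector [- v $ 2, v $ 1] :: real^2)"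
  define w where "w = matrix_inv g *v n"
  have gw: "g *v w = n"
    by (simp add: w_def matrix_vector_mul_assoc matrix_inv_mult_right[OF inv])
  have "n \<noteq> 0" using v(1) by (auto simp: n_def vec_eq_iff forall_2)
  then have w: "w \<noteq> 0" using gw by auto
  have "b *v w = k *\<^sub>R (g *v w) + (\<alpha> * (n \<bullet> w)) *\<^sub>R n"
  proof -
    have "(\<chi> i. \<Sum>j\<in>UNIV. c i j * w $ j) = (\<alpha> * (n \<bullet> w)) *\<^sub>R n"
      using c by (simp add: vec_eq_iff forall_2 sum_2 n_def inner_vec_def c21 power2_eq_square algebra_simps)
    moreover have "b *v w = k *\<^sub>R (g *v w) + (\<chi> i. \<Sum>j\<in>UNIV. c i j * w $ j)"
      by (simp add: vec_eq_iff matrix_vector_mult_def c_def sum_2 algebra_simps)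
    ultimately show ?thesis by simp
  qed
  then have "b *v w = (k + \<alpha> * (n \<bullet> w)) *\<^sub>R (g *v w)"
    by (simp add: gw algebra_simps)
  then have "\<alpha> * (n \<bullet> w) = 0"
    using k[OF w] by fastforce
  moreover have "n \<bullet> w > 0"
    using pos[OF w] by (simp add: gw inner_commute)
  ultimately have "\<alpha> = 0" by simp
  then have "b $ i $ j = k * g $ i $ j" for i j
    using c sym exhaust_2[of i] exhaust_2[of j] by (auto simp: c_def)
  then show ?thesis by blast
qed

context surf
begin

definition xi0 :: "real^2 \<Rightarrow> real^3" where
  "xi0 x = (1 / sqrt (cross3 (e 1 x) (e 2 x) \<bullet> cross3 (e 1 x) (e 2 x))) *\<^sub>R cross3 (e 1 x) (e 2 x)"

text \<open>Under umbilicity one diagonal entry of \<open>B\<close> determines \<open>h\<close>;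
  this quotient is smooth without any reference to eigenvalues.\<close>

definition h0 :: "real^2 \<Rightarrow> real" where
  "h0 x = (B 1 1 x \<bullet> xi0 x) / (e 1 x \<bullet> e 1 x)"

lemma xi0_normal: "xi0 x \<bullet> e i x = 0"
  using exhaust_2[of i] by (auto simp: xi0_def dot_cross_self)

lemma xi0_unit: "x \<in> U \<Longrightarrow> xi0 x \<bullet> xi0 x = 1"
  using normal_nz by (simp add: xi0_def power2_eq_square[symmetric])

lemma smooth_xi0: "smooth_on U xi0"
  unfolding xi0_def[abs_def]
  by (intro smooth_on_scaleR smooth_on_divide smooth_on_sqrt smooth_on_inner smooth_on_cross3
      smooth_on_const smooth_e open_U) (use normal_nz in auto)

lemma smooth_h0: "smooth_on U h0"
  unfolding h0_def[abs_def]
  by (intro smooth_on_divide smooth_B_normal smooth_xi0 smooth_on_inner smooth_e open_U)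
     (use e_nz xi0_normal in auto)

lemma unit_normal_iff:
  "x \<in> U \<Longrightarrow> unit_normal H f x \<zeta> \<longleftrightarrow>
     (th (f x) *v \<zeta>) \<bullet> (th (f x) *v \<zeta>) = 1 \<and> (\<forall>i. e i x \<bullet> (th (f x) *v \<zeta>) = 0)"
  by (simp add: unit_normal_def metric_ip_eq f_D e_def hat_def)

lemma shape_operator_eq:
  "x \<in> U \<Longrightarrow> shape_operator G H f x \<zeta> = matrix_inv (G x) ** (\<chi> i j. B i j x \<bullet> (th (f x) *v \<zeta>))"
  by (simp add: shape_operator_def metric_ip_eq f_D B_def)

lemma th_matrix_inv: "p \<in> D \<Longrightarrow> th p *v (matrix_inv (th p) *v v) = v"
  by (simp add: matrix_vector_mul_assoc matrix_inv_mult_right[OF inv_th])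

text \<open>The eigenvalue condition is read at the coordinate vector whose frame components are
  \<open>xi0 x\<close> and makes the scalar second fundamental form proportional to the metric.
  Since \<open>B\<close> has no tangential part, this determines it.\<close>

lemma umbilic_surfI:
  assumes umb: "\<And>x \<zeta>. x \<in> U \<Longrightarrow> unit_normal H f x \<zeta> \<Longrightarrow> \<exists>!k. principal_curvature G H f x \<zeta> k"
  shows "umbilic_surf D H th om s t U f G xi0 h0"
proof unfold_locales
  fix x i j assume x: "x \<in> U"
  show "xi0 x \<bullet> xi0 x = 1" by (rule xi0_unit[OF x])
  show "xi0 x \<bullet> e i x = 0" by (rule xi0_normal)
  define \<zeta> where "\<zeta> = matrix_inv (th (f x)) *v xi0 x"
  have th\<zeta>: "th (f x) *v \<zeta> = xi0 x" by (simp add: \<zeta>_def th_matrix_inv f_D x)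
  have "unit_normal H f x \<zeta>"
    by (simp add: unit_normal_iff[OF x] th\<zeta> xi0_unit[OF x] xi0_normal inner_commute[of "e _ x"])
  from umb[OF x this] have "\<exists>!k. \<exists>v. v \<noteq> 0 \<and>
      (matrix_inv (G x) ** (\<chi> i j. B i j x \<bullet> xi0 x)) *v v = k *\<^sub>R v"
    by (simp add: principal_curvature_def shape_operator_eq[OF x] th\<zeta>)
  then have "\<exists>k. \<forall>i j. (\<chi> i j. B i j x \<bullet> xi0 x) $ i $ j = k * G x $ i $ j"
  proof (intro unique_eigenvalue_imp_scalar)
    show "v \<bullet> (G x *v v) > 0" if "v \<noteq> 0" for v
      using G_pos[OF x that]
      by (simp add: metric_ip_def inner_vec_def matrix_vector_mult_def sum_2 algebra_simps)
  qed (simp_all add: ginv_explicit[OF x] B_commute[OF x, of 1 2] G_component[OF x] inner_commute)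
  then obtain k where k: "\<And>i j. B i j x \<bullet> xi0 x = k * (e i x \<bullet> e j x)"
    by (auto simp: G_component[OF x])
  then have hk: "h0 x = k" using e_nz[OF x] by (simp add: h0_def)
  have "B i j x - (B i j x \<bullet> xi0 x) *\<^sub>R xi0 x = 0"
    by (rule eq_0_if_orthogonal_frame[OF normal_nz[OF x], of "xi0 x"])
       (use xi0_unit[OF x] in \<open>auto simp: xi0_normal B_normal[OF x] inner_diff_left\<close>)
  then show "B i j x = (h0 x * (e i x \<bullet> e j x)) *\<^sub>R xi0 x"
    by (simp add: k hk)
qed (rule smooth_xi0 smooth_h0)+

end

context umbilic_surf
begin

text \<open>The shape operator in any direction \<zeta> is a multiple of the identity, so
  \<open>h x = 0\<close> settles minimality at \<open>x\<close> for both unit normals.\<close>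

lemma mean_curvature_eq:
  assumes x: "x \<in> U"
  shows "mean_curvature G H f x \<zeta> = h x * (\<xi> x \<bullet> (th (f x) *v \<zeta>))"
proof -
  let ?q = "h x * (\<xi> x \<bullet> (th (f x) *v \<zeta>))"
  have "(\<chi> i j. B i j x \<bullet> (th (f x) *v \<zeta>)) = ?q *\<^sub>R G x"
    by (simp add: vec_eq_iff B_umb[OF x] G_component[OF x])
  moreover have "matrix_inv (G x) ** (?q *\<^sub>R G x) = ?q *\<^sub>R (matrix_inv (G x) ** G x)"
    by (simp add: vec_eq_iff matrix_matrix_mult_def sum_distrib_left ac_simps)
  ultimately have "shape_operator G H f x \<zeta> = ?q *\<^sub>R mat 1"
    by (simp only: shape_operator_eq[OF x] matrix_inv_mult_left[OF ginv_explicit(2)[OF x]])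
  then show ?thesis
    by (simp add: mean_curvature_def trace_def mat_def sum_2)
qed

subsection \<open>Rigidity\<close>

text \<open>
  The sign of \<open>2h\<^sup>2 = Ric(\<xi>, \<xi>)\<close> excludes the first case at once. In the other two, \<open>\<xi>\<close> is forced to be
  vertical, respectively horizontal, and then \<open>h\<close> vanishes because the vertical field is Killing,
  respectively parallel.
\<close>

lemma open_h_nonzero: "open {y \<in> U. h y \<noteq> 0}"
proof -
  have "open (U \<inter> h -` (- {0}))"
    by (intro continuous_open_preimage smooth_on_continuous_on smooth_h open_U) auto
  then show ?thesis by (simp add: vimage_def Int_def)
qed

lemma h_eq_0_if_nonpos:
  assumes 0: "\<And>y. y \<in> U \<Longrightarrow> bitension G H f y = 0" and "s \<ge> 0" "s + t \<ge> 0" and x: "x \<in> U"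
  shows "h x = 0"
proof (rule ccontr)
  assume "h x \<noteq> 0"
  then have "2 * (h x)\<^sup>2 = - (2 * s) - (t - s) * (1 - (\<xi> x $ 3)\<^sup>2)"
    using 0 x by (intro biharmonic_normal(1)[OF open_h_nonzero]) simp_all
  \<comment> \<open>A convex combination of the Ricci eigenvalues \<open>-2s\<close> in the vertical
    and \<open>-(s + t)\<close> in the horizontal directions.\<close>
  also have "\<dots> = - (2 * s) * (\<xi> x $ 3)\<^sup>2 - (s + t) * (1 - (\<xi> x $ 3)\<^sup>2)"
    by (simp add: algebra_simps)
  also have "\<dots> \<le> 0"
  proof -
    have "(\<xi> x $ 3)\<^sup>2 \<le> 1"
      using unit_xi[OF x] by (simp add: inner_vec_def sum_3 power2_eq_square)
        (smt (verit) zero_le_square)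
    then show ?thesis using assms(2,3)
      by (smt (verit) mult_nonneg_nonneg mult_minus_left zero_le_power2)
  qed
  finally show False using \<open>h x \<noteq> 0\<close> by simp
qed

lemma vertical_xi:
  assumes x: "x \<in> U" and "\<And>k. e k x $ 3 = 0"
  shows "\<xi> x $ 1 = 0" "\<xi> x $ 2 = 0" "(\<xi> x $ 3)\<^sup>2 = 1"
proof -
  let ?n = "cross3 (e 1 x) (e 2 x)" and ?v = "\<xi> x - (\<xi> x $ 3) *\<^sub>R axis 3 1"
  have n: "?n $ 1 = 0" "?n $ 2 = 0" by (simp_all add: cross_components assms(2))
  have "?v \<bullet> e i x = 0" for i
    by (simp add: inner_diff_left normal_xi[OF x] inner_axis' assms(2))
  moreover have "?v \<bullet> ?n = 0"
    by (simp add: inner_vec_def sum_3 n axis_def)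
  ultimately have "?v = 0"
    by (intro eq_0_if_orthogonal_frame[OF normal_nz[OF x], of ?n]) (auto simp: dot_cross_self normal_nz[OF x])
  then have v: "\<xi> x = (\<xi> x $ 3) *\<^sub>R axis 3 1" by simp
  show "\<xi> x $ 1 = 0" "\<xi> x $ 2 = 0" by (subst v; simp add: axis_def)+
  then show "(\<xi> x $ 3)\<^sup>2 = 1"
    using unit_xi[OF x] by (simp add: inner_vec_def sum_3 power2_eq_square)
qed

lemma partial_xi_component:
  assumes V: "open V" "V \<subseteq> U" "x \<in> V" and "\<And>y. y \<in> V \<Longrightarrow> \<xi> y $ j = 0"
  shows "partial i \<xi> x $ j = 0"
proof -
  have x: "x \<in> U" using V by blast
  have "partial i (\<lambda>y. \<xi> y $ j) x = partial i \<xi> x $ j"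
    using has_derivative_partial[OF bounded_linear.has_derivative[OF bounded_linear_vec_nth
          smooth_on_has_derivative[OF open_U smooth_xi x]]]
    by (simp add: partial_def)
  moreover have "partial i (\<lambda>y. \<xi> y $ j) x = partial i (\<lambda>y. 0) x"
    using assms by (intro partial_cong[OF V(1,3)])
      (auto intro!: differentiable_U smooth_on_vec_nth open_U smooth_xi x)
  ultimately show ?thesis by (simp add: partial_def)
qed

lemma h_eq_0_if_killing:
  assumes 0: "\<And>y. y \<in> U \<Longrightarrow> bitension G H f y = 0" and st: "s + t \<ge> 0" "t \<noteq> s"
    and killing: "\<And>p X. p \<in> D \<Longrightarrow> cross3 (om p *v X) (axis 3 1) \<bullet> (th p *v X) = 0"
    and x: "x \<in> U"
  shows "h x = 0"
proof (rule ccontr)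
  assume hx: "h x \<noteq> 0"
  define V where "V = {y \<in> U. h y \<noteq> 0}"
  have V: "open V" "V \<subseteq> U" "x \<in> V"
    using open_h_nonzero hx x by (auto simp: V_def)
  have N: "2 * (h y)\<^sup>2 = - (2 * s) - (t - s) * (1 - (\<xi> y $ 3)\<^sup>2)" "(t - s) * \<xi> y $ 3 * e k y $ 3 = 0"
    if "y \<in> V" for y k
    using biharmonic_normal[OF V(1,2) that] 0 by (auto simp: V_def)
  have e3: "e k y $ 3 = 0" if "y \<in> V" for y k
  proof -
    \<comment> \<open>A horizontal normal would give \<open>2h^2 = -(s + t) \<le> 0\<close>, so the
      eigenvector condition can only hold with a horizontal tangent plane.\<close>
    have "\<xi> y $ 3 \<noteq> 0"
    proof
      assume "\<xi> y $ 3 = 0"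
      then have "2 * (h y)\<^sup>2 = - (s + t)" using N(1)[OF that] by simp
      then show False using st(1) that by (simp add: V_def) (smt (verit) zero_less_power2)
    qed
    then show ?thesis using N(2)[OF that, of k] st(2) by simp
  qed
  have \<xi>12: "\<xi> y $ 1 = 0" "\<xi> y $ 2 = 0" if "y \<in> V" for y
    using vertical_xi[of y] e3[OF that] that V(2) by auto
  have "\<xi> x = (\<xi> x $ 3) *\<^sub>R axis 3 1"
    using \<xi>12[OF V(3)] by (simp add: vec_eq_iff forall_3 axis_def)
  \<comment> \<open>With \<xi> vertical, the connection part of \<open>Dh 1 \<xi>\<close> paired
    with \<open>e 1\<close> vanishes by the Killing equation, and the derivative part because \<xi>
    stays vertical while \<open>e 1\<close> is horizontal. Weingarten's equation then makes
    \<open>h\<close> times the squared length of \<open>e 1\<close> zero.\<close>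
  then have "cross3 (a 1 x) (\<xi> x) \<bullet> e 1 x = \<xi> x $ 3 * (cross3 (a 1 x) (axis 3 1) \<bullet> e 1 x)"
    by (metis cross_mult_right inner_scaleR_left)
  also have "\<dots> = 0"
    using killing[OF f_D[OF x]] by (simp add: a_def e_def hat_def)
  finally have "cross3 (a 1 x) (\<xi> x) \<bullet> e 1 x = 0" .
  moreover have "partial 1 \<xi> x \<bullet> e 1 x = 0"
    using partial_xi_component[OF V \<xi>12(1)] partial_xi_component[OF V \<xi>12(2)] e3[OF V(3)]
    by (simp add: inner_vec_def sum_3)
  ultimately have "Dh 1 \<xi> x \<bullet> e 1 x = 0"
    by (simp add: Dh_def inner_add_left)
  then show False using hx e_nz[OF x] by (simp add: Dh_xi[OF x])
qed

lemma h_eq_0_if_parallel: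
  assumes 0: "\<And>y. y \<in> U \<Longrightarrow> bitension G H f y = 0" and st: "s = 0" "t \<noteq> 0"
    and parallel: "\<And>p X. p \<in> D \<Longrightarrow> cross3 (om p *v X) (axis 3 1) = 0"
    and x: "x \<in> U"
  shows "h x = 0"
proof (rule ccontr)
  assume hx: "h x \<noteq> 0"
  define V where "V = {y \<in> U. h y \<noteq> 0}"
  have V: "open V" "V \<subseteq> U" "x \<in> V"
    using open_h_nonzero hx x by (auto simp: V_def)
  have N: "2 * (h y)\<^sup>2 = - t * (1 - (\<xi> y $ 3)\<^sup>2)" "t * \<xi> y $ 3 * e k y $ 3 = 0"
    if "y \<in> V" for y k
    using biharmonic_normal[OF V(1,2) that] 0 st by (auto simp: V_def)
  \<comment> \<open>Otherwise the tangent plane is horizontal, \<xi> has vertical component 1 or -1,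
    and the normal equation gives \<open>h = 0\<close>.\<close>
  have \<xi>3: "\<xi> y $ 3 = 0" if "y \<in> V" for y
  proof (rule ccontr)
    assume "\<xi> y $ 3 \<noteq> 0"
    then have "e k y $ 3 = 0" for k using N(2)[OF that, of k] st(2) by simp
    then have "(\<xi> y $ 3)\<^sup>2 = 1" using vertical_xi[of y] that V(2) by auto
    then show False using N(1)[OF that] that by (simp add: V_def)
  qed
  \<comment> \<open>Parallelism keeps \<open>Dh i \<xi>\<close> horizontal as \<xi> is, and
    Weingarten's equation passes this on to \<open>e i\<close>. Tangent plane and normal would then
    all be horizontal.\<close>
  have "e i x $ 3 = 0" for i
  proof -
    have "cross3 (a i x) (axis 3 1) = 0" by (simp add: a_def parallel[OF f_D[OF x]])
    then have "a i x $ 1 = 0" "a i x $ 2 = 0"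
      by (simp_all add: vec_eq_iff forall_3 cross_components axis_def)
    then have "cross3 (a i x) (\<xi> x) $ 3 = 0" by (simp add: cross_components)
    then have "Dh i \<xi> x $ 3 = 0"
      using partial_xi_component[OF V \<xi>3] by (simp add: Dh_def)
    then show ?thesis using hx by (simp add: Dh_xi[OF x])
  qed
  then have "(\<xi> x $ 3)\<^sup>2 = 1" by (rule vertical_xi(3)[OF x])
  then show False using \<xi>3[OF V(3)] by simp
qed

end

section \<open>Surfaces in charts\<close>

lemma riemannian_chart_open:
  assumes M: "riemannian_manifold M" and c: "c \<in> atlas M"
  shows "openin (top_of M) W \<Longrightarrow> W \<subseteq> chart_dom c \<Longrightarrow> open (coord c ` W)"
    and "open V \<Longrightarrow> openin (top_of M) {p \<in> chart_dom c. coord c p \<in> V}"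
    and "inj_on (coord c) (chart_dom c)"
proof -
  have hom: "homeomorphic_map (subtopology (top_of M) (chart_dom c))
      (top_of_set (coord c ` chart_dom c)) (coord c)"
    and oc: "openin (top_of M) (chart_dom c)" "open (coord c ` chart_dom c)"
    using M c unfolding riemannian_manifold_def by blast+
  have "chart_dom c \<subseteq> topspace (top_of M)" by (rule openin_subset[OF oc(1)])
  then have dom: "topspace (subtopology (top_of M) (chart_dom c)) = chart_dom c"
    by (simp add: Int_absorb1)
  show "inj_on (coord c) (chart_dom c)"
    using homeomorphic_imp_injective_map[OF hom] by (simp only: dom)
  show "open (coord c ` W)" if "openin (top_of M) W" "W \<subseteq> chart_dom c"
  proof -
    have "openin (subtopology (top_of M) (chart_dom c)) W"
      using that oc(1) by (simp add: openin_open_subtopology)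
    then have "openin (top_of_set (coord c ` chart_dom c)) (coord c ` W)"
      using homeomorphic_map_openness[OF hom, of W] that(2) by (simp only: dom)
    then show ?thesis
      using oc(2) openin_open_trans by blast
  qed
  show "openin (top_of M) {p \<in> chart_dom c. coord c p \<in> V}" if "open V"
  proof -
    have "openin (top_of_set (coord c ` chart_dom c)) (coord c ` chart_dom c \<inter> V)"
      using that by (rule openin_open_Int)
    from openin_continuous_map_preimage[OF homeomorphic_imp_continuous_map[OF hom] this]
    have "openin (subtopology (top_of M) (chart_dom c)) {p \<in> chart_dom c. coord c p \<in> V}"
      unfolding dom by (rule back_subst[of "openin _"]) auto
    then show ?thesis using oc(1) by (rule openin_trans_full)
  qed
qed

lemma surface_chart_facts:
  assumes M: "surface M N \<phi>" and c: "c \<in> atlas M" and d: "d \<in> atlas N"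
    and dN: "openin (top_of N) (chart_dom d)"
  shows "open (loc_dom c d \<phi>)" "smooth_on (loc_dom c d \<phi>) (loc_rep c d \<phi>)"
    and "x \<in> loc_dom c d \<phi> \<Longrightarrow> loc_rep c d \<phi> x \<in> coord d ` chart_dom d"
    and "x \<in> loc_dom c d \<phi> \<Longrightarrow> v \<noteq> 0 \<Longrightarrow> metric_ip (gram c) x v v > 0"
    and "p \<in> chart_dom c \<Longrightarrow> chart_inv c (coord c p) = p"
    and "openin (top_of M) (chart_dom c \<inter> \<phi> -` chart_dom d)"
proof -
  have rm: "riemannian_manifold M" and sm: "smooth_map M N \<phi>"
    using M by (simp_all add: surface_def)
  have oc: "openin (top_of M) (chart_dom c)"
    and pos: "\<And>x v. x \<in> coord c ` chart_dom c \<Longrightarrow> v \<noteq> 0 \<Longrightarrow> metric_ip (gram c) x v v > 0"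
    using rm c unfolding riemannian_manifold_def by blast+
  note chart_open = riemannian_chart_open[OF rm c]
  show inv: "chart_inv c (coord c p) = p" if "p \<in> chart_dom c" for p
    using that chart_open(3) by (simp add: chart_inv_def)
  let ?W = "chart_dom c \<inter> \<phi> -` chart_dom d"
  have "openin (top_of M) {p \<in> topspace (top_of M). \<phi> p \<in> chart_dom d}"
    by (rule openin_continuous_map_preimage[OF _ dN]) (use sm in \<open>simp add: smooth_map_def\<close>)
  then have "openin (top_of M) (chart_dom c \<inter> {p \<in> topspace (top_of M). \<phi> p \<in> chart_dom d})"
    using oc by (rule openin_Int[rotated])
  moreover have "chart_dom c \<inter> {p \<in> topspace (top_of M). \<phi> p \<in> chart_dom d} = ?W"
    using openin_subset[OF oc] by auto
  ultimately show W: "openin (top_of M) ?W" by simp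
  show "open (loc_dom c d \<phi>)"
    unfolding loc_dom_def by (rule chart_open(1)[OF W]) blast
  show "smooth_on (loc_dom c d \<phi>) (loc_rep c d \<phi>)"
    using sm c d by (simp add: smooth_map_def)
  show "loc_rep c d \<phi> x \<in> coord d ` chart_dom d" if "x \<in> loc_dom c d \<phi>"
    using that inv by (auto simp: loc_dom_def loc_rep_def)
  show "metric_ip (gram c) x v v > 0" if "x \<in> loc_dom c d \<phi>" "v \<noteq> 0"
    using that pos by (auto simp: loc_dom_def)
qed

lemma surf_in_charts:
  assumes M: "surface M N \<phi>" and c: "c \<in> atlas M" and d: "d \<in> atlas N"
    and dN: "openin (top_of N) (chart_dom d)"
    and co: "coframe (coord d ` chart_dom d) (gram d) th om s t"
  shows "surf (coord d ` chart_dom d) (gram d) th om s t (loc_dom c d \<phi>) (loc_rep c d \<phi>) (gram c)"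
proof -
  interpret coframe "coord d ` chart_dom d" "gram d" th om s t by (rule co)
  note facts = surface_chart_facts[OF M c d dN]
  have "isometric_in_charts c d \<phi>" using M c d by (simp add: surface_def)
  then show ?thesis
    by unfold_locales (use facts in \<open>auto simp: isometric_in_charts_def\<close>)
qed

text \<open>One disjunct for each of the three vanishing results for \<open>h\<close>: Euclidean and
  hyperbolic space, \<open>H2_times_R\<close> and \<open>Sol\<close> use the first, the
  Bianchi-Cartan-Vranceanu spaces the second, \<open>S2_times_R\<close> the third.\<close>

definition rigid_coframe ::
  "(real^3) set \<Rightarrow> (real^3 \<Rightarrow> real^3^3) \<Rightarrow> (real^3 \<Rightarrow> real^3^3) \<Rightarrow> real \<Rightarrow> real \<Rightarrow> bool" where
  "rigid_coframe D th om s t \<longleftrightarrow>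
     s \<ge> 0 \<and> s + t \<ge> 0 \<or>
     s + t \<ge> 0 \<and> t \<noteq> s \<and> (\<forall>p\<in>D. \<forall>X. cross3 (om p *v X) (axis 3 1) \<bullet> (th p *v X) = 0) \<or>
     s = 0 \<and> t \<noteq> 0 \<and> (\<forall>p\<in>D. \<forall>X. cross3 (om p *v X) (axis 3 1) = 0)"

text \<open>Minimality is tested chart by chart, so every target chart may bring a coframe of its
  own; \<open>h0 = 0\<close> in each pair of charts contradicts properness.\<close>

lemma not_proper_biharmonicI:
  assumes M: "surface M N \<phi>" and umb: "totally_umbilical M N \<phi>"
    and open_d: "\<And>d. d \<in> atlas N \<Longrightarrow> openin (top_of N) (chart_dom d)"
    and co: "\<And>d. d \<in> atlas N \<Longrightarrow> \<exists>th om s t. coframe (coord d ` chart_dom d) (gram d) th om s t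
      \<and> rigid_coframe (coord d ` chart_dom d) th om s t"
  shows "\<not> proper_biharmonic M N \<phi>"
proof
  assume pb: "proper_biharmonic M N \<phi>"
  have "minimal M N \<phi>"
    unfolding minimal_def
  proof (intro ballI allI impI)
    fix c d x \<zeta> assume c: "c \<in> atlas M" and d: "d \<in> atlas N" and x: "x \<in> loc_dom c d \<phi>"
    obtain th om s t where co': "coframe (coord d ` chart_dom d) (gram d) th om s t"
      and rigid: "rigid_coframe (coord d ` chart_dom d) th om s t"
      using co[OF d] by blast
    interpret surf "coord d ` chart_dom d" "gram d" th om s t "loc_dom c d \<phi>" "loc_rep c d \<phi>" "gram c"
      by (rule surf_in_charts[OF M c d open_d[OF d] co'])
    interpret umbilic_surf "coord d ` chart_dom d" "gram d" th om s t "loc_dom c d \<phi>" "loc_rep c d \<phi>"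
      "gram c" xi0 h0
      by (rule umbilic_surfI) (use umb c d in \<open>auto simp: totally_umbilical_def\<close>)
    have 0: "bitension (gram c) (gram d) (loc_rep c d \<phi>) y = 0" if "y \<in> loc_dom c d \<phi>" for y
      using pb c d that by (auto simp: proper_biharmonic_def biharmonic_map_def)
    have "h0 x = 0"
      using rigid h_eq_0_if_nonpos[OF 0 _ _ x] h_eq_0_if_killing[OF 0 _ _ _ x]
        h_eq_0_if_parallel[OF 0 _ _ _ x]
      unfolding rigid_coframe_def by blast
    then show "mean_curvature (gram c) (gram d) (loc_rep c d \<phi>) x \<zeta> = 0"
      by (simp add: mean_curvature_eq[OF x])
  qed
  with pb show False by (simp add: proper_biharmonic_def)
qed

section \<open>Coframes of the model spaces\<close>

lemma has_derivative_vecI: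
  fixes f :: "'a::euclidean_space \<Rightarrow> 'b::euclidean_space^'n"
  assumes "\<And>i. ((\<lambda>x. f x $ i) has_derivative (\<lambda>h. f' h $ i)) F"
  shows "(f has_derivative f') F"
proof -
  have "((\<lambda>x. \<Sum>i\<in>UNIV. axis i (f x $ i)) has_derivative (\<lambda>h. \<Sum>i\<in>UNIV. axis i (f' h $ i))) F"
    by (intro has_derivative_sum bounded_linear.has_derivative[OF bounded_linear_axis] assms)
  moreover have "(\<Sum>i\<in>UNIV. axis i (v $ i)) = v" for v :: "'b^'n"
    by (simp add: vec_eq_iff sum_component axis_def if_distrib cong: if_cong)
  ultimately show ?thesis by simp
qed

lemma has_derivative_vec_nth: "((\<lambda>x. x $ i) has_derivative (\<lambda>h. h $ i)) F"
  by (rule bounded_linear_imp_has_derivative[OF bounded_linear_vec_nth])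

lemma coframeI:
  assumes "open D" "smooth_on D th" "smooth_on D om"
    and "\<And>p. p \<in> D \<Longrightarrow> invertible (th p)"
    and "\<And>p. p \<in> D \<Longrightarrow> H p = transpose (th p) ** th p"
    and dth: "\<And>p. p \<in> D \<Longrightarrow> (th has_derivative th' p) (at p)"
    and dom: "\<And>p. p \<in> D \<Longrightarrow> (om has_derivative om' p) (at p)"
    and tor: "\<And>p X Y. p \<in> D \<Longrightarrow> th' p X *v Y - th' p Y *v X
      + cross3 (om p *v X) (th p *v Y) - cross3 (om p *v Y) (th p *v X) = 0"
    and cur: "\<And>p X Y. p \<in> D \<Longrightarrow> om' p X *v Y - om' p Y *v X + cross3 (om p *v X) (om p *v Y)
      = s *\<^sub>R cross3 (th p *v X) (th p *v Y)
        + ((t - s) * cross3 (th p *v X) (th p *v Y) $ 3) *\<^sub>R axis 3 1"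
  shows "coframe D H th om s t"
  by unfold_locales
     (use assms in \<open>simp_all add: frechet_derivative_eqI[OF dth] frechet_derivative_eqI[OF dom]\<close>)

definition cross_mat :: "real^3 \<Rightarrow> real^3^3" where
  "cross_mat v = (\<chi> i j. cross3 v (axis j 1) $ i)"

lemma cross_mat_vec: "cross_mat v *v w = cross3 v w"
  by (simp add: cross_mat_def vec_eq_iff forall_3 matrix_vector_mult_def sum_3 cross_components axis_def)

lemma bounded_linear_cross_mat: "bounded_linear cross_mat"
  by (rule linear_conv_bounded_linear[THEN iffD1], rule linearI)
     (auto simp: matrix_eq cross_mat_vec matrix_vector_mult_add_rdistrib cross_add_left
       cross_mult_left scaleR_matrix_vector_assoc[symmetric])

text \<open>For a metric \<open>lam^2 |dx|^2\<close> the coframe \<open>lam dx\<close> has the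
  connection form sending \<open>X\<close> to \<open>cross3 L X\<close>, where \<open>dlam\<close>
  makes \<open>L\<close> the gradient of \<open>ln |lam|\<close>. The sectional curvature is the
  constant \<open>-s\<close>.\<close>

lemma coframe_conformal:
  fixes lam :: "real^3 \<Rightarrow> real" and L :: "real^3 \<Rightarrow> real^3"
  assumes D: "open D" and sm: "smooth_on D lam" "smooth_on D L" and nz: "\<And>p. p \<in> D \<Longrightarrow> lam p \<noteq> 0"
    and H: "\<And>p i j. p \<in> D \<Longrightarrow> H p $ i $ j = (if i = j then (lam p)\<^sup>2 else 0)"
    and dlam: "\<And>p. p \<in> D \<Longrightarrow> (lam has_derivative (\<lambda>h. lam p * (L p \<bullet> h))) (at p)"
    and dL: "\<And>p. p \<in> D \<Longrightarrow> (L has_derivative L' p) (at p)"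
    and cur: "\<And>p X Y. p \<in> D \<Longrightarrow> cross3 (L' p X) Y - cross3 (L' p Y) X + cross3 (cross3 (L p) X) (cross3 (L p) Y)
      = (s * (lam p)\<^sup>2) *\<^sub>R cross3 X Y"
  shows "coframe D H (\<lambda>p. lam p *\<^sub>R mat 1) (\<lambda>p. cross_mat (L p)) s s"
proof (rule coframeI[where th' = "\<lambda>p h. (lam p * (L p \<bullet> h)) *\<^sub>R mat 1" and om' = "\<lambda>p h. cross_mat (L' p h)"])
  show "open D" by fact
  show "smooth_on D (\<lambda>p. lam p *\<^sub>R mat 1 :: real^3^3)"
    by (rule smooth_on_linear[OF D bounded_linear_scaleR_left sm(1)])
  show "smooth_on D (\<lambda>p. cross_mat (L p))"
    by (rule smooth_on_linear[OF D bounded_linear_cross_mat sm(2)])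
  fix p assume p: "p \<in> D"
  show "invertible (lam p *\<^sub>R mat 1 :: real^3^3)"
    using nz[OF p] by (intro scalar_invertible) (auto simp: invertible_def)
  show "H p = transpose (lam p *\<^sub>R mat 1) ** lam p *\<^sub>R mat 1"
    by (simp add: vec_eq_iff matrix_matrix_mult_def transpose_def mat_def H[OF p] sum_3 forall_3 power2_eq_square)
  show "((\<lambda>p. lam p *\<^sub>R mat 1) has_derivative (\<lambda>h. (lam p * (L p \<bullet> h)) *\<^sub>R (mat 1 :: real^3^3))) (at p)"
    by (rule bounded_linear.has_derivative[OF bounded_linear_scaleR_left dlam[OF p]])
  show "((\<lambda>p. cross_mat (L p)) has_derivative (\<lambda>h. cross_mat (L' p h))) (at p)"
    by (rule bounded_linear.has_derivative[OF bounded_linear_cross_mat dL[OF p]])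
  fix X Y
  show "((lam p * (L p \<bullet> X)) *\<^sub>R mat 1) *v Y - ((lam p * (L p \<bullet> Y)) *\<^sub>R mat 1) *v X
      + cross3 (cross_mat (L p) *v X) ((lam p *\<^sub>R mat 1) *v Y)
      - cross3 (cross_mat (L p) *v Y) ((lam p *\<^sub>R mat 1) *v X) = 0"
    by (simp add: scaleR_matrix_vector_assoc[symmetric] cross_mat_vec vec_eq_iff forall_3
        cross_components inner_vec_def sum_3 algebra_simps)
  show "cross_mat (L' p X) *v Y - cross_mat (L' p Y) *v X + cross3 (cross_mat (L p) *v X) (cross_mat (L p) *v Y)
      = s *\<^sub>R cross3 ((lam p *\<^sub>R mat 1) *v X) ((lam p *\<^sub>R mat 1) *v Y)
        + ((s - s) * cross3 ((lam p *\<^sub>R mat 1) *v X) ((lam p *\<^sub>R mat 1) *v Y) $ 3) *\<^sub>R axis 3 1"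
    by (simp add: scaleR_matrix_vector_assoc[symmetric] cross_mat_vec cur[OF p] cross_mult_left
        cross_mult_right power2_eq_square)
qed

text \<open>
  Riemannian submersions over a conformally flat surface of curvature \<open>K\<close> with vertical unit Killing
  field \<open>\<partial>\<^sub>z\<close>; \<open>l\<close> is twice the bundle curvature, \<open>l = 0\<close> being the product case.
\<close>

definition fib_th :: "(real^3 \<Rightarrow> real) \<Rightarrow> (real^3 \<Rightarrow> real) \<Rightarrow> (real^3 \<Rightarrow> real) \<Rightarrow> real^3 \<Rightarrow> real^3^3" where
  "fib_th lam P Q p = vector [vector [lam p, 0, 0], vector [0, lam p, 0], vector [P p, Q p, 1]]"

text \<open>In terms of the coframe \<open>\<theta>1, \<theta>2, \<theta>3\<close> this is
  \<open>l/2 (\<theta>1, \<theta>2, -\<theta>3)\<close> plus, in the third entry, the connection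
  form \<open>L1 dx2 - L2 dx1\<close> of the base, with \<open>L1, L2\<close> the partial
  derivatives of \<open>ln |lam|\<close>.\<close>

definition fib_om :: "real \<Rightarrow> (real^3 \<Rightarrow> real) \<Rightarrow> (real^3 \<Rightarrow> real) \<Rightarrow> (real^3 \<Rightarrow> real) \<Rightarrow> (real^3 \<Rightarrow> real)
    \<Rightarrow> (real^3 \<Rightarrow> real) \<Rightarrow> real^3 \<Rightarrow> real^3^3" where
  "fib_om l lam P Q L1 L2 p = vector [vector [l / 2 * lam p, 0, 0], vector [0, l / 2 * lam p, 0],
     vector [- L2 p - l / 2 * P p, L1 p - l / 2 * Q p, - (l / 2)]]"

lemma smooth_on_matrixI:
  fixes A :: "'a::euclidean_space \<Rightarrow> real^3^3"
  assumes "open S" "smooth_on S (\<lambda>x. A x $ 1 $ 1)" "smooth_on S (\<lambda>x. A x $ 1 $ 2)" "smooth_on S (\<lambda>x. A x $ 1 $ 3)"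
    "smooth_on S (\<lambda>x. A x $ 2 $ 1)" "smooth_on S (\<lambda>x. A x $ 2 $ 2)" "smooth_on S (\<lambda>x. A x $ 2 $ 3)"
    "smooth_on S (\<lambda>x. A x $ 3 $ 1)" "smooth_on S (\<lambda>x. A x $ 3 $ 2)" "smooth_on S (\<lambda>x. A x $ 3 $ 3)"
  shows "smooth_on S A"
proof (intro smooth_on_vecI assms(1))
  fix i j :: 3
  show "smooth_on S (\<lambda>x. A x $ i $ j)"
    using exhaust_3[of i] exhaust_3[of j] assms by auto
qed

text \<open>\<open>vert\<close> is the exterior derivative of the vertical form, \<open>base\<close>
  says that the base has Gauss curvature \<open>K\<close>. The parameters are O'Neill's values with
  reversed sign: vertical planes have sectional curvature \<open>l^2/4\<close>, horizontal ones
  \<open>K - 3 l^2/4\<close>.\<close>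

lemma coframe_fibred:
  assumes D: "open D"
    and sm: "smooth_on D lam" "smooth_on D P" "smooth_on D Q" "smooth_on D L1" "smooth_on D L2"
    and nz: "\<And>p. p \<in> D \<Longrightarrow> lam p \<noteq> 0"
    and H: "\<And>p. p \<in> D \<Longrightarrow> H p = transpose (fib_th lam P Q p) ** fib_th lam P Q p"
    and dlam: "\<And>p. p \<in> D \<Longrightarrow> (lam has_derivative (\<lambda>h. lam p * (L1 p * h $ 1 + L2 p * h $ 2))) (at p)"
    and dP: "\<And>p. p \<in> D \<Longrightarrow> (P has_derivative P' p) (at p)"
    and dQ: "\<And>p. p \<in> D \<Longrightarrow> (Q has_derivative Q' p) (at p)"
    and dL1: "\<And>p. p \<in> D \<Longrightarrow> (L1 has_derivative L1' p) (at p)"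
    and dL2: "\<And>p. p \<in> D \<Longrightarrow> (L2 has_derivative L2' p) (at p)"
    and vert: "\<And>p X Y. p \<in> D \<Longrightarrow> (P' p X * Y $ 1 + Q' p X * Y $ 2) - (P' p Y * X $ 1 + Q' p Y * X $ 2)
      = - l * (lam p)\<^sup>2 * (X $ 1 * Y $ 2 - X $ 2 * Y $ 1)"
    and base: "\<And>p X Y. p \<in> D \<Longrightarrow> (L1' p X * Y $ 2 - L2' p X * Y $ 1) - (L1' p Y * X $ 2 - L2' p Y * X $ 1)
      = - K * (lam p)\<^sup>2 * (X $ 1 * Y $ 2 - X $ 2 * Y $ 1)"
  shows "coframe D H (fib_th lam P Q) (fib_om l lam P Q L1 L2) (- (l\<^sup>2 / 4)) (3 * l\<^sup>2 / 4 - K)"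
proof -
  let ?th' = "\<lambda>p h. vector [vector [lam p * (L1 p * h $ 1 + L2 p * h $ 2), 0, 0],
        vector [0, lam p * (L1 p * h $ 1 + L2 p * h $ 2), 0], vector [P' p h, Q' p h, 0]] :: real^3^3"
  let ?om' = "\<lambda>p h. vector [vector [l / 2 * (lam p * (L1 p * h $ 1 + L2 p * h $ 2)), 0, 0],
        vector [0, l / 2 * (lam p * (L1 p * h $ 1 + L2 p * h $ 2)), 0],
        vector [- L2' p h - l / 2 * P' p h, L1' p h - l / 2 * Q' p h, 0]] :: real^3^3"
  show ?thesis
  proof (rule coframeI[where th' = ?th' and om' = ?om'])
    show "open D" by fact
    show "smooth_on D (fib_th lam P Q)"
      by (rule smooth_on_matrixI[OF D]) (simp_all add: fib_th_def sm smooth_on_const D)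
    have "smooth_on D (\<lambda>x. l / 2 * lam x)" "smooth_on D (\<lambda>x. - L2 x - l / 2 * P x)"
      "smooth_on D (\<lambda>x. L1 x - l / 2 * Q x)"
      by (intro smooth_on_diff smooth_on_minus smooth_on_mult sm smooth_on_const D)+
    then show "smooth_on D (fib_om l lam P Q L1 L2)"
      by (intro smooth_on_matrixI[OF D]) (simp_all add: fib_om_def smooth_on_const D)
    fix p assume p: "p \<in> D"
    show "invertible (fib_th lam P Q p)"
      using nz[OF p] by (simp add: invertible_det_nz det_3 fib_th_def)
    show "H p = transpose (fib_th lam P Q p) ** fib_th lam P Q p" by (rule H[OF p])
    note derivs = dlam[OF p] dP[OF p] dQ[OF p] dL1[OF p] dL2[OF p]
    show "(fib_th lam P Q has_derivative ?th' p) (at p)"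
    proof (intro has_derivative_vecI)
      fix i j :: 3
      show "((\<lambda>x. fib_th lam P Q x $ i $ j) has_derivative (\<lambda>h. ?th' p h $ i $ j)) (at p)"
        using exhaust_3[of i] exhaust_3[of j] derivs by (elim disjE) (simp_all add: fib_th_def)
    qed
    show "(fib_om l lam P Q L1 L2 has_derivative ?om' p) (at p)"
    proof (intro has_derivative_vecI)
      fix i j :: 3
      have "((\<lambda>x. l / 2 * lam x) has_derivative (\<lambda>h. l / 2 * (lam p * (L1 p * h $ 1 + L2 p * h $ 2)))) (at p)"
        "((\<lambda>x. - L2 x - l / 2 * P x) has_derivative (\<lambda>h. - L2' p h - l / 2 * P' p h)) (at p)"
        "((\<lambda>x. L1 x - l / 2 * Q x) has_derivative (\<lambda>h. L1' p h - l / 2 * Q' p h)) (at p)"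
        by (intro has_derivative_diff has_derivative_minus
            bounded_linear.has_derivative[OF bounded_linear_mult_right] derivs)+
      then show "((\<lambda>x. fib_om l lam P Q L1 L2 x $ i $ j) has_derivative
        (\<lambda>h. ?om' p h $ i $ j)) (at p)"
        using exhaust_3[of i] exhaust_3[of j] by (elim disjE) (simp_all add: fib_om_def)
    qed
    fix X Y
    note expand = vec_eq_iff forall_3 matrix_vector_mult_def sum_3 cross_components fib_th_def fib_om_def axis_def
    show "?th' p X *v Y - ?th' p Y *v X + cross3 (fib_om l lam P Q L1 L2 p *v X) (fib_th lam P Q p *v Y)
        - cross3 (fib_om l lam P Q L1 L2 p *v Y) (fib_th lam P Q p *v X) = 0"
      using vert[OF p, of X Y] by (simp add: expand) (simp add: field_simps power2_eq_square)
    show "?om' p X *v Y - ?om' p Y *v X + cross3 (fib_om l lam P Q L1 L2 p *v X) (fib_om l lam P Q L1 L2 p *v Y)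
        = - (l\<^sup>2 / 4) *\<^sub>R cross3 (fib_th lam P Q p *v X) (fib_th lam P Q p *v Y)
          + ((3 * l\<^sup>2 / 4 - K - - (l\<^sup>2 / 4)) * cross3 (fib_th lam P Q p *v X) (fib_th lam P Q p *v Y) $ 3) *\<^sub>R axis 3 1"
    proof -
      \<comment> \<open>The third component of the curvature equation: the base equation minus
        \<open>l/2\<close> times the vertical one.\<close>
      have 3: "(- L2' p X - l / 2 * P' p X) * Y $ 1 + (L1' p X - l / 2 * Q' p X) * Y $ 2
          - ((- L2' p Y - l / 2 * P' p Y) * X $ 1 + (L1' p Y - l / 2 * Q' p Y) * X $ 2)
          = - K * (lam p)\<^sup>2 * (X $ 1 * Y $ 2 - X $ 2 * Y $ 1)
            - l / 2 * (- l * (lam p)\<^sup>2 * (X $ 1 * Y $ 2 - X $ 2 * Y $ 1))"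
        unfolding base[OF p, of X Y, symmetric] vert[OF p, of X Y, symmetric] by (simp add: algebra_simps)
      show ?thesis
        using 3 by (simp add: expand) (simp add: field_simps power2_eq_square)
    qed
  qed
qed

text \<open>The horizontal components of \<open>om\<close> are \<open>l/2\<close> times those of the
  coframe, so crossing with the vertical axis turns the horizontal part of \<open>X\<close> by a
  right angle and rescales it; for \<open>l = 0\<close> the product itself vanishes, which is the
  parallel case.\<close>

lemma fib_killing:
  "cross3 (fib_om l lam P Q L1 L2 p *v X) (axis 3 1) \<bullet> (fib_th lam P Q p *v X) = 0"
  by (simp add: inner_vec_def matrix_vector_mult_def sum_3 cross_components fib_th_def fib_om_def axis_def)

lemma fib_parallel:
  "cross3 (fib_om 0 lam P Q L1 L2 p *v X) (axis 3 1) = 0"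
  by (simp add: vec_eq_iff forall_3 matrix_vector_mult_def sum_3 cross_components fib_om_def axis_def)

subsection \<open>The spaces given by global coordinates\<close>

definition gram3 :: "(real^3 \<Rightarrow> real^3) \<Rightarrow> (real^3 \<Rightarrow> real^3) \<Rightarrow> (real^3 \<Rightarrow> real^3) \<Rightarrow> real^3 \<Rightarrow> real^3^3" where
  "gram3 \<alpha> \<beta> \<gamma> p = (\<chi> i j. \<alpha> p $ i * \<alpha> p $ j + \<beta> p $ i * \<beta> p $ j + \<gamma> p $ i * \<gamma> p $ j)"

lemma coord_space_not_proper_biharmonicI:
  assumes M: "surface M (coord_space D \<alpha> \<beta> \<gamma>) \<phi>" "totally_umbilical M (coord_space D \<alpha> \<beta> \<gamma>) \<phi>"
    and co: "coframe D (gram3 \<alpha> \<beta> \<gamma>) th om s t"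
      "rigid_coframe D th om s t"
  shows "\<not> proper_biharmonic M (coord_space D \<alpha> \<beta> \<gamma>) \<phi>"
  by (rule not_proper_biharmonicI[OF M]) (use co in \<open>auto simp: coord_space_def gram3_def[abs_def]\<close>)

lemma Euclidean3_rigid:
  assumes "surface M Euclidean3 \<phi>" "totally_umbilical M Euclidean3 \<phi>"
  shows "\<not> proper_biharmonic M Euclidean3 \<phi>"
  using assms unfolding Euclidean3_def
proof (rule coord_space_not_proper_biharmonicI)
  show "coframe UNIV (gram3 (\<lambda>p. vector [1, 0, 0]) (\<lambda>p. vector [0, 1, 0])
      (\<lambda>p. vector [0, 0, 1]))
      (\<lambda>p. 1 *\<^sub>R mat 1) (\<lambda>p. cross_mat 0) 0 0"
  proof (rule coframe_conformal[where L' = "\<lambda>p h. 0" and L = "\<lambda>p. 0" and lam = "\<lambda>p. 1"])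
    fix p :: "real^3" and i j :: 3
    show "(gram3 (\<lambda>p. vector [1, 0, 0]) (\<lambda>p. vector [0, 1, 0])
      (\<lambda>p. vector [0, 0, 1]) p) $ i $ j
      = (if i = j then 1\<^sup>2 else 0 :: real)"
      using exhaust_3[of i] exhaust_3[of j] by (auto simp: gram3_def)
  qed (auto intro: smooth_on_const)
qed (simp add: rigid_coframe_def)

lemma Hyperbolic3_rigid:
  assumes "surface M Hyperbolic3 \<phi>" "totally_umbilical M Hyperbolic3 \<phi>"
  shows "\<not> proper_biharmonic M Hyperbolic3 \<phi>"
  using assms unfolding Hyperbolic3_def
proof (rule coord_space_not_proper_biharmonicI)
  \<comment> \<open>The gradient of \<open>ln (1/z)\<close>, the logarithm of the conformal
    factor.\<close>
  let ?L = "\<lambda>p::real^3. (- (1 / p $ 3)) *\<^sub>R axis 3 1 :: real^3"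
  have D: "open {p::real^3. p $ 3 > 0}"
    by (intro open_Collect_less continuous_intros)
  show "coframe {p. p $ 3 > 0} (gram3 (\<lambda>p. vector [1 / p $ 3, 0, 0]) (\<lambda>p. vector [0, 1 / p $ 3, 0])
      (\<lambda>p. vector [0, 0, 1 / p $ 3]))
      (\<lambda>p. (1 / p $ 3) *\<^sub>R mat 1) (\<lambda>p. cross_mat (?L p)) 1 1"
  proof (rule coframe_conformal[where L' = "\<lambda>p h. (h $ 3 / (p $ 3)\<^sup>2) *\<^sub>R axis 3 1" and L = "?L" and lam = "\<lambda>p. 1 / p $ 3"])
    have s: "smooth_on {p::real^3. p $ 3 > 0} (\<lambda>p. 1 / p $ 3)"
      by (intro smooth_on_divide smooth_on_const smooth_on_vec_nth smooth_on_ident D) auto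
    show "smooth_on {p::real^3. p $ 3 > 0} (\<lambda>p. 1 / p $ 3)" by (rule s)
    show "smooth_on {p::real^3. p $ 3 > 0} ?L"
      by (intro smooth_on_scaleR smooth_on_const smooth_on_minus s D)
    fix p :: "real^3" assume "p \<in> {p. p $ 3 > 0}"
    then have p: "p $ 3 \<noteq> 0" by simp
    show "1 / p $ 3 \<noteq> 0" using p by simp
    have d: "((\<lambda>p. 1 / p $ 3) has_derivative (\<lambda>h. - (h $ 3 / (p $ 3)\<^sup>2))) (at p)"
      using p by (auto intro!: derivative_eq_intros has_derivative_vec_nth simp: power2_eq_square)
    show "((\<lambda>p. 1 / p $ 3) has_derivative (\<lambda>h. 1 / p $ 3 * (?L p \<bullet> h))) (at p)"
      by (rule has_derivative_eq_rhs[OF d]) (auto simp: inner_axis' power2_eq_square)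
    show "(?L has_derivative (\<lambda>h. (h $ 3 / (p $ 3)\<^sup>2) *\<^sub>R axis 3 1)) (at p)"
      by (rule has_derivative_eq_rhs[OF bounded_linear.has_derivative[OF bounded_linear_scaleR_left has_derivative_minus[OF d]]]) auto
    fix X Y :: "real^3"
    show "cross3 ((X $ 3 / (p $ 3)\<^sup>2) *\<^sub>R axis 3 1) Y - cross3 ((Y $ 3 / (p $ 3)\<^sup>2) *\<^sub>R axis 3 1) X
        + cross3 (cross3 (?L p) X) (cross3 (?L p) Y) = (1 * (1 / p $ 3)\<^sup>2) *\<^sub>R cross3 X Y"
      using p by (simp add: vec_eq_iff forall_3 cross_components axis_def field_simps power2_eq_square)
  next
    fix p :: "real^3" and i j :: 3
    show "(gram3 (\<lambda>p. vector [1 / p $ 3, 0, 0]) (\<lambda>p. vector [0, 1 / p $ 3, 0])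
      (\<lambda>p. vector [0, 0, 1 / p $ 3]) p) $ i $ j
      = (if i = j then (1 / p $ 3)\<^sup>2 else 0)"
      using exhaust_3[of i] exhaust_3[of j] by (auto simp: gram3_def power2_eq_square)
  qed (rule D)
qed (simp add: rigid_coframe_def)

lemma fib_gram:
  "(gram3 (\<lambda>p. vector [lam p, 0, 0]) (\<lambda>p. vector [0, lam p, 0])
      (\<lambda>p. vector [P p, Q p, 1]) p)
    = transpose (fib_th lam P Q p) ** fib_th lam P Q p"
  by (simp add: gram3_def vec_eq_iff matrix_matrix_mult_def transpose_def sum_3 fib_th_def)

lemma H2_times_R_rigid:
  assumes "surface M H2_times_R \<phi>" "totally_umbilical M H2_times_R \<phi>"
  shows "\<not> proper_biharmonic M H2_times_R \<phi>"
  using assms unfolding H2_times_R_def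
proof (rule coord_space_not_proper_biharmonicI)
  \<comment> \<open>The base is the half-plane with conformal factor \<open>1/y\<close> and
    \<open>K = -1\<close>; \<open>?L2\<close> is the derivative of \<open>ln (1/y)\<close>.\<close>
  let ?lam = "\<lambda>p::real^3. 1 / p $ 2" and ?z = "\<lambda>p::real^3. 0::real" and ?L2 = "\<lambda>p::real^3. - (1 / p $ 2)"
  have D: "open {p::real^3. p $ 2 > 0}"
    by (intro open_Collect_less continuous_intros)
  have s: "smooth_on {p::real^3. p $ 2 > 0} ?lam"
    by (intro smooth_on_divide smooth_on_const smooth_on_vec_nth smooth_on_ident D) auto
  have d: "(?lam has_derivative (\<lambda>h. - (h $ 2 / (p $ 2)\<^sup>2))) (at p)" if "p \<in> {p. p $ 2 > 0}" for p :: "real^3"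
    using that by (auto intro!: derivative_eq_intros has_derivative_vec_nth simp: power2_eq_square)
  have "coframe {p::real^3. p $ 2 > 0} (gram3 (\<lambda>p. vector [1 / p $ 2, 0, 0]) (\<lambda>p. vector [0, 1 / p $ 2, 0])
      (\<lambda>p. vector [0, 0, 1]))
      (fib_th ?lam ?z ?z) (fib_om 0 ?lam ?z ?z ?z ?L2) (- (0\<^sup>2 / 4)) (3 * 0\<^sup>2 / 4 - (-1))"
  proof (rule coframe_fibred[where P' = "\<lambda>p h. 0" and Q' = "\<lambda>p h. 0" and L1' = "\<lambda>p h. 0"
        and L2' = "\<lambda>p h. h $ 2 / (p $ 2)\<^sup>2"])
    fix p :: "real^3" assume p: "p \<in> {p. p $ 2 > 0}"
    show "(?lam has_derivative (\<lambda>h. 1 / p $ 2 * (0 * h $ 1 + - (1 / p $ 2) * h $ 2))) (at p)"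
      by (rule has_derivative_eq_rhs[OF d[OF p]]) (auto simp: power2_eq_square)
    show "(?L2 has_derivative (\<lambda>h. h $ 2 / (p $ 2)\<^sup>2)) (at p)"
      using has_derivative_minus[OF d[OF p]] by simp
    fix X Y :: "real^3"
    show "(0 * Y $ 2 - X $ 2 / (p $ 2)\<^sup>2 * Y $ 1) - (0 * X $ 2 - Y $ 2 / (p $ 2)\<^sup>2 * X $ 1)
      = - (- 1) * (1 / p $ 2)\<^sup>2 * (X $ 1 * Y $ 2 - X $ 2 * Y $ 1)"
      using p by (simp add: field_simps power2_eq_square)
  qed (auto intro!: smooth_on_const smooth_on_minus D s fib_gram)
  then show "coframe {p::real^3. p $ 2 > 0} (gram3 (\<lambda>p. vector [1 / p $ 2, 0, 0]) (\<lambda>p. vector [0, 1 / p $ 2, 0])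
      (\<lambda>p. vector [0, 0, 1]))
      (fib_th ?lam ?z ?z) (fib_om 0 ?lam ?z ?z ?z ?L2) 0 1" by simp
qed (simp add: rigid_coframe_def)

lemma BCV_rigid:
  assumes "surface M (BCV m l) \<phi>" "totally_umbilical M (BCV m l) \<phi>" and ml: "m \<le> 0" "l \<noteq> 0"
  shows "\<not> proper_biharmonic M (BCV m l) \<phi>"
  using assms(1,2) unfolding BCV_def Let_def
proof (rule coord_space_not_proper_biharmonicI)
  let ?F = "\<lambda>p::real^3. 1 + m * ((p $ 1)\<^sup>2 + (p $ 2)\<^sup>2)"
  let ?D = "{p. ?F p > 0}" and ?lam = "\<lambda>p. 1 / ?F p"
  let ?P = "\<lambda>p. l / 2 * (p $ 2 / ?F p)" and ?Q = "\<lambda>p. - (l / 2 * (p $ 1 / ?F p))"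
  \<comment> \<open>The partial derivatives of \<open>ln (1/F)\<close>; the base metric
    \<open>(dx^2 + dy^2)/F^2\<close> has Gauss curvature \<open>4m\<close>.\<close>
  let ?L1 = "\<lambda>p. - (2 * m) * (p $ 1 / ?F p)" and ?L2 = "\<lambda>p. - (2 * m) * (p $ 2 / ?F p)"
  have D: "open ?D"
    by (intro open_Collect_less continuous_intros)
  have sF: "smooth_on ?D ?F"
    using D unfolding power2_eq_square
    by (intro smooth_on_add smooth_on_mult smooth_on_const smooth_on_vec_nth smooth_on_ident)
  have sq: "smooth_on ?D (\<lambda>p. p $ i / ?F p)" for i
    by (intro smooth_on_divide smooth_on_vec_nth smooth_on_ident sF D) auto
  have sl: "smooth_on ?D ?lam"
    by (intro smooth_on_divide smooth_on_const sF D) auto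
  let ?F' = "\<lambda>p h::real^3. m * (2 * p $ 1 * h $ 1 + 2 * p $ 2 * h $ 2)"
  let ?q' = "\<lambda>i p h. (h $ i * ?F p - p $ i * ?F' p h) / (?F p)\<^sup>2"
  have dF: "(?F has_derivative ?F' p) (at p)" for p
    by (auto intro!: derivative_eq_intros has_derivative_vec_nth)
  have dq: "((\<lambda>p. p $ i / ?F p) has_derivative ?q' i p) (at p)" if "p \<in> ?D" for p i
    using that
    by (intro has_derivative_eq_rhs[OF has_derivative_divide'[OF has_derivative_vec_nth dF]])
       (auto simp: power2_eq_square)
  have dl: "(?lam has_derivative (\<lambda>h. - ?F' p h / (?F p)\<^sup>2)) (at p)" if "p \<in> ?D" for p
    using that
    by (intro has_derivative_eq_rhs[OF has_derivative_divide'[OF has_derivative_const dF]])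
       (auto simp: power2_eq_square)
  show "coframe ?D (gram3 (\<lambda>p. vector [1 / ?F p, 0, 0]) (\<lambda>p. vector [0, 1 / ?F p, 0])
      (\<lambda>p. vector [?P p, ?Q p, 1]))
      (fib_th ?lam ?P ?Q) (fib_om l ?lam ?P ?Q ?L1 ?L2) (- (l\<^sup>2 / 4)) (3 * l\<^sup>2 / 4 - 4 * m)"
  proof (rule coframe_fibred[where P' = "\<lambda>p h. l / 2 * ?q' 2 p h" and Q' = "\<lambda>p h. - (l / 2 * ?q' 1 p h)"
        and L1' = "\<lambda>p h. - (2 * m) * ?q' 1 p h" and L2' = "\<lambda>p h. - (2 * m) * ?q' 2 p h"])
    show "smooth_on ?D ?lam" by (rule sl)
    show "smooth_on ?D ?P" "smooth_on ?D ?Q" "smooth_on ?D ?L1" "smooth_on ?D ?L2"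
      by (intro smooth_on_minus smooth_on_mult smooth_on_const sq D)+
    fix p assume p: "p \<in> ?D"
    then have nz: "?F p \<noteq> 0" by simp
    show "?lam p \<noteq> 0" using nz by simp
    show "(?lam has_derivative (\<lambda>h. ?lam p * (?L1 p * h $ 1 + ?L2 p * h $ 2))) (at p)"
    proof (rule has_derivative_eq_rhs[OF dl[OF p]], rule ext)
      have "- (m * (2 * a * x + 2 * b * y)) / F\<^sup>2 = 1 / F * (- (2 * m) * (a / F) * x + - (2 * m) * (b / F) * y)"
        for a b x y F :: real
        by (cases "F = 0") (auto simp: field_simps power2_eq_square)
      then show "- ?F' p h / (?F p)\<^sup>2 = ?lam p * (?L1 p * h $ 1 + ?L2 p * h $ 2)" for h .
    qed
    show "(?P has_derivative (\<lambda>h. l / 2 * ?q' 2 p h)) (at p)"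
      "(?Q has_derivative (\<lambda>h. - (l / 2 * ?q' 1 p h))) (at p)"
      "(?L1 has_derivative (\<lambda>h. - (2 * m) * ?q' 1 p h)) (at p)"
      "(?L2 has_derivative (\<lambda>h. - (2 * m) * ?q' 2 p h)) (at p)"
      by (intro has_derivative_minus bounded_linear.has_derivative[OF bounded_linear_mult_right] dq p)+
    fix X Y :: "real^3"
    \<comment> \<open>The numerator identity behind both the vertical and the base equation; it
      comes down to \<open>F - m (x^2 + y^2) = 1\<close>.\<close>
    have key: "(X $ 2 * ?F p - p $ 2 * ?F' p X) * Y $ 1 - (X $ 1 * ?F p - p $ 1 * ?F' p X) * Y $ 2
        - ((Y $ 2 * ?F p - p $ 2 * ?F' p Y) * X $ 1 - (Y $ 1 * ?F p - p $ 1 * ?F' p Y) * X $ 2)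
        = - 2 * (X $ 1 * Y $ 2 - X $ 2 * Y $ 1)"
      by (simp add: algebra_simps power2_eq_square)
    have q: "?q' 2 p X * Y $ 1 - ?q' 1 p X * Y $ 2 - (?q' 2 p Y * X $ 1 - ?q' 1 p Y * X $ 2)
        = - 2 * (?lam p)\<^sup>2 * (X $ 1 * Y $ 2 - X $ 2 * Y $ 1)"
    proof -
      have frac: "A / q * y - B / q * x - (C / q * u - E / q * v) = (A * y - B * x - (C * u - E * v)) / q"
        for A B C E q x y u v :: real
        by (simp add: diff_divide_distrib)
      have "?q' 2 p X * Y $ 1 - ?q' 1 p X * Y $ 2 - (?q' 2 p Y * X $ 1 - ?q' 1 p Y * X $ 2)
        = ((X $ 2 * ?F p - p $ 2 * ?F' p X) * Y $ 1 - (X $ 1 * ?F p - p $ 1 * ?F' p X) * Y $ 2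
        - ((Y $ 2 * ?F p - p $ 2 * ?F' p Y) * X $ 1 - (Y $ 1 * ?F p - p $ 1 * ?F' p Y) * X $ 2)) / (?F p)\<^sup>2"
        by (rule frac)
      also have "\<dots> = - 2 * (X $ 1 * Y $ 2 - X $ 2 * Y $ 1) / (?F p)\<^sup>2"
        by (simp only: key)
      also have "- 2 * w / q\<^sup>2 = - 2 * (1 / q)\<^sup>2 * w" for w q :: real
        by (simp add: power_divide)
      finally show ?thesis .
    qed
    show "l / 2 * ?q' 2 p X * Y $ 1 + - (l / 2 * ?q' 1 p X) * Y $ 2
        - (l / 2 * ?q' 2 p Y * X $ 1 + - (l / 2 * ?q' 1 p Y) * X $ 2)
        = - l * (?lam p)\<^sup>2 * (X $ 1 * Y $ 2 - X $ 2 * Y $ 1)"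
    proof -
      have "l / 2 * A * y + - (l / 2 * B) * x - (l / 2 * C * u + - (l / 2 * E) * v)
          = l / 2 * (A * y - B * x - (C * u - E * v))" for A B C E x y u v :: real
        by (simp add: algebra_simps)
      then show ?thesis by (simp only: q)
    qed
    show "- (2 * m) * ?q' 1 p X * Y $ 2 - - (2 * m) * ?q' 2 p X * Y $ 1
        - (- (2 * m) * ?q' 1 p Y * X $ 2 - - (2 * m) * ?q' 2 p Y * X $ 1)
        = - (4 * m) * (?lam p)\<^sup>2 * (X $ 1 * Y $ 2 - X $ 2 * Y $ 1)"
    proof -
      have "- (2 * m) * B * x - - (2 * m) * A * y - (- (2 * m) * E * v - - (2 * m) * C * u)
          = 2 * m * (A * y - B * x - (C * u - E * v))" for A B C E x y u v :: real
        by (simp add: algebra_simps)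
      then show ?thesis by (simp only: q)
    qed
  qed (auto intro!: D fib_gram)
  \<comment> \<open>\<open>s + t = l^2/2 - 4m\<close> and \<open>t - s = l^2 - 4m\<close> are both
    positive, which selects the Killing case.\<close>
  have "l\<^sup>2 > 0" using ml by simp
  then have "- (l\<^sup>2 / 4) + (3 * l\<^sup>2 / 4 - 4 * m) \<ge> 0" "3 * l\<^sup>2 / 4 - 4 * m \<noteq> - (l\<^sup>2 / 4)"
    using ml by linarith+
  then show "rigid_coframe ?D (fib_th ?lam ?P ?Q) (fib_om l ?lam ?P ?Q ?L1 ?L2) (- (l\<^sup>2 / 4)) (3 * l\<^sup>2 / 4 - 4 * m)"
    unfolding rigid_coframe_def using fib_killing by blast
qed

lemma Sol_rigid:
  assumes "surface M Sol \<phi>" "totally_umbilical M Sol \<phi>"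
  shows "\<not> proper_biharmonic M Sol \<phi>"
  using assms unfolding Sol_def
proof (rule coord_space_not_proper_biharmonicI)
  let ?a = "\<lambda>p::real^3. exp (p $ 3)" and ?b = "\<lambda>p::real^3. exp (- (p $ 3))"
  let ?th = "\<lambda>p. vector [vector [?a p, 0, 0], vector [0, ?b p, 0], vector [0, 0, 1]] :: real^3^3"
  \<comment> \<open>In terms of the coframe this is \<open>(\<theta>2, \<theta>1, 0)\<close>, the
    solution of the torsion equation for \<open>e^z dx, e^-z dy, dz\<close>.\<close>
  let ?om = "\<lambda>p. vector [vector [0, ?b p, 0], vector [?a p, 0, 0], vector [0, 0, 0]] :: real^3^3"
  let ?th' = "\<lambda>p h. vector [vector [h $ 3 * ?a p, 0, 0], vector [0, - h $ 3 * ?b p, 0], vector [0, 0, 0]] :: real^3^3"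
  let ?om' = "\<lambda>p h. vector [vector [0, - h $ 3 * ?b p, 0], vector [h $ 3 * ?a p, 0, 0], vector [0, 0, 0]] :: real^3^3"
  show "coframe UNIV (gram3 (\<lambda>p. vector [?a p, 0, 0]) (\<lambda>p. vector [0, ?b p, 0])
      (\<lambda>p. vector [0, 0, 1]))
      ?th ?om 1 (- 1)"
  proof (rule coframeI[where th' = ?th' and om' = ?om'])
    have s: "smooth_on UNIV ?a" "smooth_on UNIV ?b"
      by (intro smooth_on_exp smooth_on_minus smooth_on_vec_nth smooth_on_ident open_UNIV)+
    show "smooth_on UNIV ?th"
      by (rule smooth_on_matrixI) (simp_all add: s smooth_on_const)
    show "smooth_on UNIV ?om"
      by (rule smooth_on_matrixI) (simp_all add: s smooth_on_const)
    fix p :: "real^3"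
    show "invertible (?th p)" by (simp add: invertible_det_nz det_3)
    show "(gram3 (\<lambda>p. vector [?a p, 0, 0]) (\<lambda>p. vector [0, ?b p, 0])
      (\<lambda>p. vector [0, 0, 1]) p)
      = transpose (?th p) ** ?th p"
      by (simp add: gram3_def vec_eq_iff matrix_matrix_mult_def transpose_def sum_3)
    have da: "(?a has_derivative (\<lambda>h. h $ 3 * ?a p)) (at p)" "(?b has_derivative (\<lambda>h. - h $ 3 * ?b p)) (at p)"
      by (auto intro!: derivative_eq_intros has_derivative_vec_nth)
    show "(?th has_derivative (\<lambda>h. ?th' p h)) (at p)"
    proof (intro has_derivative_vecI)
      fix i j :: 3
      show "((\<lambda>p. ?th p $ i $ j) has_derivative (\<lambda>h. ?th' p h $ i $ j)) (at p)"
        using exhaust_3[of i] exhaust_3[of j] da by (elim disjE) simp_all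
    qed
    show "(?om has_derivative (\<lambda>h. ?om' p h)) (at p)"
    proof (intro has_derivative_vecI)
      fix i j :: 3
      show "((\<lambda>p. ?om p $ i $ j) has_derivative (\<lambda>h. ?om' p h $ i $ j)) (at p)"
        using exhaust_3[of i] exhaust_3[of j] da by (elim disjE) simp_all
    qed
    fix X Y :: "real^3"
    show "?th' p X *v Y - ?th' p Y *v X + cross3 (?om p *v X) (?th p *v Y) - cross3 (?om p *v Y) (?th p *v X) = 0"
      by (simp add: vec_eq_iff forall_3 matrix_vector_mult_def sum_3 cross_components algebra_simps)
    show "?om' p X *v Y - ?om' p Y *v X + cross3 (?om p *v X) (?om p *v Y)
        = 1 *\<^sub>R cross3 (?th p *v X) (?th p *v Y)
          + ((- 1 - 1) * cross3 (?th p *v X) (?th p *v Y) $ 3) *\<^sub>R axis 3 1"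
      by (simp add: vec_eq_iff forall_3 matrix_vector_mult_def sum_3 cross_components axis_def algebra_simps)
  qed simp
qed (simp add: rigid_coframe_def)

subsection \<open>Stereographic charts\<close>

text \<open>The Gram matrix of an \<open>embedded_chart\<close> is defined through
  \<open>inv_into\<close>; an explicit two-sided inverse makes it computable and shows that the
  chart is onto.\<close>

lemma inv_into_eqI:
  assumes "\<And>x. Q x \<in> A" "\<And>x. X (Q x) = x" "\<And>p. p \<in> A \<Longrightarrow> Q (X p) = p"
  shows "inv_into A X = Q" "X ` A = UNIV"
proof -
  have inj: "inj_on X A" using assms(3) by (metis inj_onI)
  show "inv_into A X = Q"
    using inv_into_f_f[OF inj assms(1)] assms(2) by (metis ext)
  show "X ` A = UNIV" using assms(1,2) by (metis image_eqI UNIV_eq_I)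
qed

lemma S2_times_R_rigid:
  assumes "surface M S2_times_R \<phi>" "totally_umbilical M S2_times_R \<phi>"
  shows "\<not> proper_biharmonic M S2_times_R \<phi>"
proof (rule not_proper_biharmonicI[OF assms])
  fix d :: "((real^3) \<times> real, 3) metric_chart" assume "d \<in> atlas S2_times_R"
  then have "d \<in> (\<lambda>s. embedded_chart (Sigma {p \<in> sphere 0 1. p $ 3 \<noteq> s} (\<lambda>_. UNIV))
        (\<lambda>(p, t). vector [p $ 1 / (1 - s * p $ 3), p $ 2 / (1 - s * p $ 3), t])) ` {1, -1}"
    by (simp only: S2_times_R_def riem_space.simps)
  then obtain s where s: "s \<in> {1, -1 :: real}"
    and d: "d = embedded_chart (Sigma {p \<in> sphere 0 1. p $ 3 \<noteq> s} (\<lambda>_. UNIV))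
        (\<lambda>(p, t). vector [p $ 1 / (1 - s * p $ 3), p $ 2 / (1 - s * p $ 3), t])"
    by blast
  let ?A = "Sigma {p \<in> sphere 0 1. p $ 3 \<noteq> s} (\<lambda>_. UNIV) :: ((real^3) \<times> real) set"
  let ?X = "\<lambda>(p, t). vector [p $ 1 / (1 - s * p $ 3), p $ 2 / (1 - s * p $ 3), t] :: real^3"
  have s2: "s * s = 1" using s by auto
  show "openin (top_of S2_times_R) (chart_dom d)"
  proof -
    have "open {q :: (real^3) \<times> real. fst q $ 3 \<noteq> s}"
      by (intro open_Collect_neq continuous_intros)
    moreover have "?A = Sigma (sphere 0 1) (\<lambda>_. UNIV) \<inter> {q. fst q $ 3 \<noteq> s}" by auto
    ultimately show ?thesis
      by (auto simp: d S2_times_R_def embedded_chart_def openin_open)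
  qed
  \<comment> \<open>Conformal factor of the round metric in stereographic coordinates; the relation
    \<open>lam * (1 + r^2) = 2\<close> carries the algebra below.\<close>
  define lam where "lam x = 2 / (1 + ((x $ 1)\<^sup>2 + (x $ 2)\<^sup>2))" for x :: "real^3"
  have pos: "1 + ((x $ 1)\<^sup>2 + (x $ 2)\<^sup>2) > 0" for x :: "real^3"
    by (simp add: add_pos_nonneg)
  have lam: "lam x * (1 + ((x $ 1)\<^sup>2 + (x $ 2)\<^sup>2)) = 2" "lam x > 0" for x
    using pos[of x] nonzero_eq_divide_eq[OF less_imp_neq[OF pos[of x], THEN not_sym], of "lam x" 2]
    by (simp_all add: lam_def)
  define Q where "Q x = (vector [lam x * x $ 1, lam x * x $ 2, s * (1 - lam x)] :: real^3, x $ 3)" for x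
  have QA: "Q x \<in> ?A" for x
  proof -
    have "lam x * (lam x * (1 + ((x $ 1)\<^sup>2 + (x $ 2)\<^sup>2))) = lam x * 2" by (simp only: lam)
    then have "(lam x * x $ 1)\<^sup>2 + (lam x * x $ 2)\<^sup>2 + (s * s) * (1 - lam x)\<^sup>2 = 1"
      unfolding s2 by (simp add: power2_eq_square algebra_simps)
    then have "norm (vector [lam x * x $ 1, lam x * x $ 2, s * (1 - lam x)] :: real^3) = 1"
      by (simp add: norm_eq_1 inner_vec_def sum_3 power2_eq_square algebra_simps)
    moreover have "s * (1 - lam x) \<noteq> s" using lam(2)[of x] s by auto
    ultimately show ?thesis by (simp add: Q_def)
  qed
  have XQ: "?X (Q x) = x" for x
  proof -
    have "1 - s * (s * (1 - lam x)) = lam x" by (simp add: s2 mult.assoc[symmetric])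
    then show ?thesis using lam(2)[of x] by (simp add: Q_def vec_eq_iff forall_3)
  qed
  have QX: "Q (?X q) = q" if "q \<in> ?A" for q
  proof -
    obtain p r where q: "q = (p, r)" by force
    have p: "p $ 1 * p $ 1 + p $ 2 * p $ 2 + p $ 3 * p $ 3 = 1" "p $ 3 \<noteq> s"
      using that by (auto simp: q norm_eq_1 inner_vec_def sum_3)
    \<comment> \<open>On the sphere the denominator of the projection turns out to be the conformal
      factor at the image point.\<close>
    define w where "w = 1 - s * p $ 3"
    have w: "w \<noteq> 0" using p(2) s by (auto simp: w_def)
    have sw: "p $ 3 = s * (1 - w)" by (simp add: w_def s2 mult.assoc[symmetric])
    have "w * w + (p $ 1 * p $ 1 + p $ 2 * p $ 2) = 2 * w"
      using p(1) s2 unfolding sw by algebra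
    then have "1 + ((p $ 1 / w)\<^sup>2 + (p $ 2 / w)\<^sup>2) = 2 / w"
      using w by (simp add: field_simps power2_eq_square)
    then have "lam (?X q) = w" using w by (simp add: lam_def q w_def[symmetric])
    then show ?thesis using w sw[symmetric] by (simp add: Q_def q w_def[symmetric] vec_eq_iff forall_3)
  qed
  have inv: "inv_into ?A ?X = Q" "?X ` ?A = UNIV"
    by (rule inv_into_eqI[OF QA XQ QX]; assumption)+
  define L1 where "L1 x = - lam x * x $ 1" for x
  define L2 where "L2 x = - lam x * x $ 2" for x
  let ?z = "\<lambda>x::real^3. 0::real"
  define lam' where "lam' x h = lam x * (L1 x * h $ 1 + L2 x * h $ 2)" for x h :: "real^3"
  have dlam: "(lam has_derivative lam' x) (at x)" for x
  proof -
    have "((\<lambda>x. 1 + ((x $ 1)\<^sup>2 + (x $ 2)\<^sup>2)) has_derivative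
        (\<lambda>h. 2 * x $ 1 * h $ 1 + 2 * x $ 2 * h $ 2)) (at x)"
      by (auto intro!: derivative_eq_intros has_derivative_vec_nth)
    from has_derivative_divide'[OF has_derivative_const this, of 2]
    have "(lam has_derivative (\<lambda>h. - (2 * (2 * x $ 1 * h $ 1 + 2 * x $ 2 * h $ 2)) /
        ((1 + ((x $ 1)\<^sup>2 + (x $ 2)\<^sup>2)) * (1 + ((x $ 1)\<^sup>2 + (x $ 2)\<^sup>2))))) (at x)"
      using less_imp_neq[OF pos[of x]] by (simp add: lam_def[abs_def])
    moreover have "- (2 * (2 * a * u + 2 * b * v)) / (q * q) = 2 / q * (- (2 / q) * a * u + - (2 / q) * b * v)"
      for a b u v q :: real
      by (cases "q = 0") (auto simp: field_simps)
    ultimately show ?thesis by (simp add: lam'_def[abs_def] L1_def L2_def) (simp add: lam_def)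
  qed
  have smlam: "smooth_on UNIV lam"
    unfolding lam_def[abs_def] power2_eq_square
    using pos by (intro smooth_on_divide smooth_on_add smooth_on_mult smooth_on_const smooth_on_vec_nth
        smooth_on_ident open_UNIV) (auto simp: power2_eq_square less_imp_neq[THEN not_sym])
  define Q' where "Q' x h = (vector [lam' x h * x $ 1 + lam x * h $ 1, lam' x h * x $ 2 + lam x * h $ 2,
      - s * lam' x h] :: real^3, h $ 3)" for x h :: "real^3"
  have dQ: "(Q has_derivative Q' x) (at x)" for x
    unfolding Q_def[abs_def] Q'_def[abs_def]
  proof (rule has_derivative_Pair[OF has_derivative_vecI has_derivative_vec_nth])
    fix i :: 3
    show "((\<lambda>x. vector [lam x * x $ 1, lam x * x $ 2, s * (1 - lam x)] $ i) has_derivative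
       (\<lambda>h. vector [lam' x h * x $ 1 + lam x * h $ 1, lam' x h * x $ 2 + lam x * h $ 2, - s * lam' x h] $ i)) (at x)"
      using exhaust_3[of i]
      by (elim disjE) (auto intro!: derivative_eq_intros has_derivative_vec_nth dlam)
  qed
  \<comment> \<open>The inverse chart is conformal on the sphere factor and isometric on the line;
    this yields the Gram matrix.\<close>
  have ip: "Q' x h \<bullet> Q' x k = (lam x)\<^sup>2 * (h $ 1 * k $ 1 + h $ 2 * k $ 2) + h $ 3 * k $ 3" for x h k
  proof -
    define a b where "a = x $ 1" and "b = x $ 2"
    have 2: "lam x * (1 + (a\<^sup>2 + b\<^sup>2)) = 2" using lam(1)[of x] by (simp add: a_def b_def)
    have "(lam' x h * a + lam x * h $ 1) * (lam' x k * a + lam x * k $ 1)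
        + (lam' x h * b + lam x * h $ 2) * (lam' x k * b + lam x * k $ 2) + (s * s) * (lam' x h * lam' x k)
        = lam' x h * lam' x k * (1 + (a\<^sup>2 + b\<^sup>2)) + lam x * (lam' x h * (a * k $ 1 + b * k $ 2)
          + lam' x k * (a * h $ 1 + b * h $ 2)) + (lam x)\<^sup>2 * (h $ 1 * k $ 1 + h $ 2 * k $ 2)"
      by (simp add: s2 power2_eq_square algebra_simps)
    also have "lam' x h * lam' x k * (1 + (a\<^sup>2 + b\<^sup>2)) + lam x * (lam' x h * (a * k $ 1 + b * k $ 2)
          + lam' x k * (a * h $ 1 + b * h $ 2)) = 0"
    proof -
      have l': "lam' x h = - (lam x)\<^sup>2 * (a * h $ 1 + b * h $ 2)" for h
        by (simp add: lam'_def L1_def L2_def a_def b_def power2_eq_square algebra_simps)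
      have "lam' x h * lam' x k * (1 + (a\<^sup>2 + b\<^sup>2))
          = (lam x * (1 + (a\<^sup>2 + b\<^sup>2))) * (lam x) ^ 3 * (a * h $ 1 + b * h $ 2) * (a * k $ 1 + b * k $ 2)"
        by (simp add: l' power2_eq_square power3_eq_cube)
      then show ?thesis
        unfolding 2 by (simp add: l' power2_eq_square power3_eq_cube)
    qed
    finally show ?thesis
      by (simp add: Q'_def inner_prod_def inner_vec_def sum_3 a_def b_def algebra_simps)
  qed
  have "coframe UNIV (gram d) (fib_th lam ?z ?z) (fib_om 0 lam ?z ?z L1 L2) (- (0\<^sup>2 / 4)) (3 * 0\<^sup>2 / 4 - 1)"
  proof (rule coframe_fibred[where P' = "\<lambda>p h. 0" and Q' = "\<lambda>p h. 0"
        and L1' = "\<lambda>p h. - (lam' p h * p $ 1 + lam p * h $ 1)" and L2' = "\<lambda>p h. - (lam' p h * p $ 2 + lam p * h $ 2)"])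
    show "smooth_on UNIV lam" by (rule smlam)
    show "smooth_on UNIV L1" "smooth_on UNIV L2"
      unfolding L1_def[abs_def] L2_def[abs_def]
      by (intro smooth_on_mult smooth_on_minus smlam smooth_on_vec_nth smooth_on_ident open_UNIV)+
    fix p :: "real^3"
    show "lam p \<noteq> 0" using lam(2)[of p] by simp
    have pa: "partial i Q p = Q' p (axis i 1)" for i
      by (rule has_derivative_partial[OF dQ])
    show "gram d p = transpose (fib_th lam ?z ?z p) ** fib_th lam ?z ?z p"
      unfolding d embedded_chart_def metric_chart.simps inv(1) pa ip
      by (simp add: vec_eq_iff forall_3 axis_def matrix_matrix_mult_def transpose_def sum_3 fib_th_def power2_eq_square)
    show "(lam has_derivative (\<lambda>h. lam p * (L1 p * h $ 1 + L2 p * h $ 2))) (at p)"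
      using dlam[of p] by (simp add: lam'_def[abs_def])
    show "(L1 has_derivative (\<lambda>h. - (lam' p h * p $ 1 + lam p * h $ 1))) (at p)"
      "(L2 has_derivative (\<lambda>h. - (lam' p h * p $ 2 + lam p * h $ 2))) (at p)"
      unfolding L1_def[abs_def] L2_def[abs_def]
      by (auto intro!: derivative_eq_intros has_derivative_vec_nth dlam)
    fix X Y :: "real^3"
    define a b where "a = p $ 1" and "b = p $ 2"
    have 2: "lam p * (1 + (a\<^sup>2 + b\<^sup>2)) = 2" using lam(1)[of p] by (simp add: a_def b_def)
    have l': "lam' p h = - (lam p)\<^sup>2 * (a * h $ 1 + b * h $ 2)" for h
      by (simp add: lam'_def L1_def L2_def a_def b_def power2_eq_square algebra_simps)
    \<comment> \<open>Gauss's equation for the base with \<open>K = 1\<close>: the factor on the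
      right becomes \<open>2 lam - lam^2 - 2 lam\<close>.\<close>
    have "(- (lam' p X * a + lam p * X $ 1) * Y $ 2 - - (lam' p X * b + lam p * X $ 2) * Y $ 1)
        - (- (lam' p Y * a + lam p * Y $ 1) * X $ 2 - - (lam' p Y * b + lam p * Y $ 2) * X $ 1)
        = (lam p * (lam p * (1 + (a\<^sup>2 + b\<^sup>2))) - (lam p)\<^sup>2 - 2 * lam p) * (X $ 1 * Y $ 2 - X $ 2 * Y $ 1)"
      unfolding l' by (simp add: power2_eq_square algebra_simps)
    then show "(- (lam' p X * p $ 1 + lam p * X $ 1) * Y $ 2 - - (lam' p X * p $ 2 + lam p * X $ 2) * Y $ 1)
        - (- (lam' p Y * p $ 1 + lam p * Y $ 1) * X $ 2 - - (lam' p Y * p $ 2 + lam p * Y $ 2) * X $ 1)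
        = - 1 * (lam p)\<^sup>2 * (X $ 1 * Y $ 2 - X $ 2 * Y $ 1)"
      unfolding 2 by (simp add: a_def b_def)
  qed (auto intro!: smooth_on_const)
  then have "coframe (coord d ` chart_dom d) (gram d) (fib_th lam ?z ?z) (fib_om 0 lam ?z ?z L1 L2) 0 (- 1)"
    using inv(2) by (simp add: d embedded_chart_def)
  moreover have "rigid_coframe (coord d ` chart_dom d) (fib_th lam ?z ?z) (fib_om 0 lam ?z ?z L1 L2) 0 (- 1)"
    by (simp add: rigid_coframe_def fib_parallel)
  ultimately show "\<exists>th om s t. coframe (coord d ` chart_dom d) (gram d) th om s t
      \<and> rigid_coframe (coord d ` chart_dom d) th om s t" by blast
qed

subsection \<open>The three-sphere\<close>

definition emb :: "real^3 \<Rightarrow> real^4" where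
  "emb v = (\<chi> i. if i = 1 then v $ 1 else if i = 2 then v $ 2 else if i = 3 then v $ 3 else 0)"

abbreviation e4 :: "real^4" where "e4 \<equiv> axis 4 1"

definition lamS :: "real^3 \<Rightarrow> real" where
  "lamS x = 2 / (1 + x \<bullet> x)"

text \<open>The inverse of stereographic projection from the pole \<open>\<sigma> e4\<close>,
  \<sigma> being 1 or -1; most computations see the sign only through
  \<open>\<sigma> * \<sigma> = 1\<close>.\<close>

definition stereo :: "real \<Rightarrow> real^3 \<Rightarrow> real^4" where
  "stereo \<sigma> x = lamS x *\<^sub>R emb x + (\<sigma> * (1 - lamS x)) *\<^sub>R e4"

text \<open>The differential of \<open>stereo \<sigma>\<close> at \<open>x\<close>, rescaled to an isometry onto the tangent space of the sphere.\<close>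

definition En :: "real \<Rightarrow> real^3 \<Rightarrow> real^3 \<Rightarrow> real^4" where
  "En \<sigma> x v = emb v - (lamS x * (x \<bullet> v)) *\<^sub>R emb x + (\<sigma> * lamS x * (x \<bullet> v)) *\<^sub>R e4"

lemma lamS: "lamS x * (1 + x \<bullet> x) = 2" "lamS x > 0"
  and lamS_sq: "lamS x * (x \<bullet> x) = 2 - lamS x"
proof -
  have "1 + x \<bullet> x > 0" by (simp add: add_pos_nonneg)
  then show "lamS x * (1 + x \<bullet> x) = 2" "lamS x > 0"
    using less_imp_neq by (simp_all add: lamS_def field_simps)
  then show "lamS x * (x \<bullet> x) = 2 - lamS x" by (simp add: algebra_simps)
qed

lemma linear_emb: "linear emb"
  by (rule linearI) (auto simp: emb_def vec_eq_iff)

lemma bounded_linear_emb: "bounded_linear emb"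
  using linear_emb linear_conv_bounded_linear by blast

lemmas emb_linear = linear_add[OF linear_emb] linear_diff[OF linear_emb] linear_scale[OF linear_emb]

lemma emb_inner: "emb v \<bullet> emb w = v \<bullet> w" "emb v \<bullet> e4 = 0" "e4 \<bullet> emb v = 0" "e4 \<bullet> e4 = 1"
  by (simp_all add: emb_def inner_vec_def sum_4 sum_3 axis_def)

lemma emb_cases: obtains p c where "u = emb p + c *\<^sub>R e4"
proof
  show "u = emb (vector [u $ 1, u $ 2, u $ 3]) + (u $ 4) *\<^sub>R e4"
    by (simp add: emb_def vec_eq_iff forall_4 axis_def)
qed

lemma linear_En: "linear (En \<sigma> x)"
  by (rule linearI) (simp_all add: En_def emb_linear inner_add_right algebra_simps)

lemma En_inner:
  assumes "\<sigma> * \<sigma> = 1"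
  shows "En \<sigma> x v \<bullet> En \<sigma> x w = v \<bullet> w" "En \<sigma> x v \<bullet> stereo \<sigma> x = 0" "stereo \<sigma> x \<bullet> stereo \<sigma> x = 1"
proof -
  define l where "l = lamS x"
  have l: "l * (x \<bullet> x) = 2 - l" using lamS_sq[of x] by (simp add: l_def)
  have "En \<sigma> x v \<bullet> En \<sigma> x w = v \<bullet> w - 2 * l * (x \<bullet> v) * (x \<bullet> w)
      + l * (l * (x \<bullet> x)) * (x \<bullet> v) * (x \<bullet> w) + (\<sigma> * \<sigma>) * l * l * (x \<bullet> v) * (x \<bullet> w)"
    by (simp add: En_def l_def inner_add_left inner_add_right inner_diff_left inner_diff_right emb_inner
        inner_commute[of v x] algebra_simps)
  then show "En \<sigma> x v \<bullet> En \<sigma> x w = v \<bullet> w"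
    unfolding l assms by (simp add: algebra_simps)
  have "En \<sigma> x v \<bullet> stereo \<sigma> x = l * (x \<bullet> v) - l * (l * (x \<bullet> x)) * (x \<bullet> v)
      + (\<sigma> * \<sigma>) * l * (x \<bullet> v) * (1 - l)"
    by (simp add: En_def stereo_def l_def inner_add_left inner_add_right inner_diff_left emb_inner
        inner_commute[of v x] algebra_simps)
  then show "En \<sigma> x v \<bullet> stereo \<sigma> x = 0"
    unfolding l assms by (simp add: algebra_simps)
  have "stereo \<sigma> x \<bullet> stereo \<sigma> x = l * (l * (x \<bullet> x)) + (\<sigma> * \<sigma>) * (1 - l) * (1 - l)"
    by (simp add: stereo_def l_def inner_add_left inner_add_right emb_inner algebra_simps)
  then show "stereo \<sigma> x \<bullet> stereo \<sigma> x = 1"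
    unfolding l assms by (simp add: algebra_simps)
qed

text \<open>The tangent space and the position vector span the whole four-space, so every
  \<open>u\<close> splits into frame coordinates and a radial part.\<close>

lemma En_complete:
  assumes "\<sigma> * \<sigma> = 1"
  obtains a where "u = En \<sigma> x a + (u \<bullet> stereo \<sigma> x) *\<^sub>R stereo \<sigma> x"
proof -
  define l where "l = lamS x"
  have l: "l * (x \<bullet> x) = 2 - l" using lamS_sq[of x] by (simp add: l_def)
  obtain p c where u: "u = emb p + c *\<^sub>R e4" by (rule emb_cases)
  \<comment> \<open>The adjoint of \<open>En \<sigma> x\<close> applied to \<open>u\<close>, which
    gives the frame coordinates of the tangential part.\<close>
  define a where "a = p + (\<sigma> * l * c - l * (x \<bullet> p)) *\<^sub>R x"
  define k where "k = u \<bullet> stereo \<sigma> x"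
  have k: "k = l * (x \<bullet> p) + \<sigma> * (1 - l) * c"
    by (simp add: k_def u stereo_def l_def inner_add_left inner_add_right emb_inner inner_commute algebra_simps)
  have xa: "x \<bullet> a = (l - 1) * (x \<bullet> p) + \<sigma> * c * (2 - l)"
  proof -
    have "x \<bullet> a = x \<bullet> p + (\<sigma> * c - x \<bullet> p) * (l * (x \<bullet> x))"
      by (simp add: a_def inner_add_right algebra_simps)
    then show ?thesis unfolding l by (simp add: algebra_simps)
  qed
  have 1: "(\<sigma> * l * c - l * (x \<bullet> p)) - l * (x \<bullet> a) + k * l = 0"
    unfolding xa k by (simp add: algebra_simps)
  have 2: "\<sigma> * l * (x \<bullet> a) + k * (\<sigma> * (1 - l)) = c"
  proof -
    have "\<sigma> * l * (x \<bullet> a) + k * (\<sigma> * (1 - l)) = (\<sigma> * \<sigma>) * (l * c * (2 - l) + (1 - l) * (1 - l) * c)"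
      unfolding xa k by (simp add: algebra_simps)
    then show ?thesis by (simp add: assms algebra_simps)
  qed
  have "En \<sigma> x a + k *\<^sub>R stereo \<sigma> x = emb p + ((\<sigma> * l * c - l * (x \<bullet> p)) - l * (x \<bullet> a) + k * l) *\<^sub>R emb x
      + (\<sigma> * l * (x \<bullet> a) + k * (\<sigma> * (1 - l))) *\<^sub>R e4"
    by (simp add: En_def stereo_def l_def[symmetric]) (simp add: a_def emb_linear vec_eq_iff algebra_simps)
  then have "u = En \<sigma> x a + k *\<^sub>R stereo \<sigma> x"
    unfolding 1 2 by (simp add: u)
  then show thesis using that by (simp add: k_def)
qed

lemma has_derivative_lamS:
  "(lamS has_derivative (\<lambda>h. - (lamS x)\<^sup>2 * (x \<bullet> h))) (at x)"
proof -
  have d: "((\<lambda>x. 1 + x \<bullet> x) has_derivative (\<lambda>h. 2 * (x \<bullet> h))) (at x)"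
    by (auto intro!: derivative_eq_intros simp: inner_commute)
  have "1 + x \<bullet> x \<noteq> 0" using lamS(2)[of x] by (auto simp: lamS_def)
  from has_derivative_divide'[OF has_derivative_const d this, of 2]
  show ?thesis
    by (simp add: lamS_def[abs_def] power2_eq_square divide_inverse ac_simps)
qed

lemma smooth_lamS: "smooth_on UNIV lamS"
  unfolding lamS_def[abs_def]
proof (intro smooth_on_divide smooth_on_add smooth_on_inner smooth_on_const smooth_on_ident open_UNIV)
  show "1 + x \<bullet> x \<noteq> 0" for x :: "real^3" using lamS(2)[of x] by (auto simp: lamS_def)
qed

lemma has_derivative_stereo:
  "(stereo \<sigma> has_derivative (\<lambda>h. lamS x *\<^sub>R En \<sigma> x h)) (at x)"
proof -
  have "(stereo \<sigma> has_derivative (\<lambda>h. (lamS x *\<^sub>R emb h + (- (lamS x)\<^sup>2 * (x \<bullet> h)) *\<^sub>R emb x)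
      + (\<sigma> * (0 - (- (lamS x)\<^sup>2 * (x \<bullet> h)))) *\<^sub>R e4)) (at x)"
    unfolding stereo_def[abs_def]
    by (intro has_derivative_add has_derivative_scaleR has_derivative_lamS
        bounded_linear.has_derivative[OF bounded_linear_emb] has_derivative_ident
        bounded_linear.has_derivative[OF bounded_linear_scaleR_left]
        bounded_linear.has_derivative[OF bounded_linear_mult_right] has_derivative_diff has_derivative_const)
  then show ?thesis
    by (rule has_derivative_eq_rhs) (auto simp: En_def algebra_simps power2_eq_square)
qed

text \<open>The last summand is the second fundamental form of the sphere in \<open>\<real>\<^sup>4\<close>.\<close>

lemma has_derivative_En:
  assumes \<sigma>: "\<sigma> * \<sigma> = 1" and f: "(f has_derivative f') (at x)" and v: "(v has_derivative v') (at x)"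
  shows "((\<lambda>y. En \<sigma> (f y) (v y)) has_derivative (\<lambda>h.
    En \<sigma> (f x) (v' h + cross3 (cross3 (- lamS (f x) *\<^sub>R f x) (f' h)) (v x))
    - (lamS (f x) * (f' h \<bullet> v x)) *\<^sub>R stereo \<sigma> (f x))) (at x)"
proof -
  let ?l = "lamS (f x)"
  let ?l' = "\<lambda>h. - ?l\<^sup>2 * (f x \<bullet> f' h)"
  let ?q' = "\<lambda>h. ?l * (f x \<bullet> v' h + f' h \<bullet> v x) + ?l' h * (f x \<bullet> v x)"
  have dl: "((\<lambda>y. lamS (f y)) has_derivative ?l') (at x)"
    by (rule has_derivative_compose[OF f has_derivative_lamS])
  have dq: "((\<lambda>y. lamS (f y) * (f y \<bullet> v y)) has_derivative ?q') (at x)"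
    by (intro has_derivative_mult has_derivative_inner dl f v)
  have "((\<lambda>y. emb (v y) - (lamS (f y) * (f y \<bullet> v y)) *\<^sub>R emb (f y) + (\<sigma> * (lamS (f y) * (f y \<bullet> v y))) *\<^sub>R e4)
    has_derivative (\<lambda>h. emb (v' h) - ((?l * (f x \<bullet> v x)) *\<^sub>R emb (f' h) + ?q' h *\<^sub>R emb (f x))
      + (\<sigma> * ?q' h) *\<^sub>R e4)) (at x)"
    by (intro has_derivative_add has_derivative_diff has_derivative_scaleR dq f v
        bounded_linear.has_derivative[OF bounded_linear_emb]
        bounded_linear.has_derivative[OF bounded_linear_scaleR_left]
        bounded_linear.has_derivative[OF bounded_linear_mult_right])
  then have D: "((\<lambda>y. En \<sigma> (f y) (v y)) has_derivative (\<lambda>h. emb (v' h)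
      - ((?l * (f x \<bullet> v x)) *\<^sub>R emb (f' h) + ?q' h *\<^sub>R emb (f x)) + (\<sigma> * ?q' h) *\<^sub>R e4)) (at x)"
    by (simp add: En_def[abs_def] mult.assoc)
  show ?thesis
  proof (rule has_derivative_eq_rhs[OF D], rule ext)
    fix h
    define l p w k where "l = ?l" and "p = f x" and "w = f' h" and "k = v x"
    have l: "l * (p \<bullet> p) = 2 - l" using lamS_sq[of p] by (simp add: l_def p_def)
    \<comment> \<open>The conformal connection form with \<open>L = - l p\<close> acting on
      \<open>k\<close>; it supplies the Levi-Civita part of the derivative.\<close>
    have c: "cross3 (cross3 (- l *\<^sub>R p) w) k = - (l * (p \<bullet> k)) *\<^sub>R w + (l * (w \<bullet> k)) *\<^sub>R p"
    proof -
      have "cross3 (cross3 (- l *\<^sub>R p) w) k = - cross3 k (cross3 (- l *\<^sub>R p) w)"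
        by (rule cross_skew)
      also have "\<dots> = - (l * (p \<bullet> k)) *\<^sub>R w + (l * (w \<bullet> k)) *\<^sub>R p"
        by (simp add: Lagrange inner_commute)
      finally show ?thesis .
    qed
    define a where "a = v' h + cross3 (cross3 (- l *\<^sub>R p) w) k"
    have pa: "p \<bullet> a = p \<bullet> v' h - l * (p \<bullet> k) * (p \<bullet> w) + (2 - l) * (w \<bullet> k)"
    proof -
      have "p \<bullet> a = p \<bullet> v' h - l * (p \<bullet> k) * (p \<bullet> w) + (l * (p \<bullet> p)) * (w \<bullet> k)"
        unfolding a_def c by (simp add: inner_add_right inner_diff_right algebra_simps)
      then show ?thesis unfolding l .
    qed
    have ea: "emb a = emb (v' h) - (l * (p \<bullet> k)) *\<^sub>R emb w + (l * (w \<bullet> k)) *\<^sub>R emb p"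
      unfolding a_def c by (simp add: emb_linear)
    have 1: "- (l * (p \<bullet> v' h + w \<bullet> k) + - l\<^sup>2 * (p \<bullet> w) * (p \<bullet> k))
        = l * (w \<bullet> k) - l * (p \<bullet> a) - l * (w \<bullet> k) * l"
      unfolding pa by (simp add: power2_eq_square algebra_simps)
    have 2: "\<sigma> * (l * (p \<bullet> v' h + w \<bullet> k) + - l\<^sup>2 * (p \<bullet> w) * (p \<bullet> k))
        = \<sigma> * l * (p \<bullet> a) - l * (w \<bullet> k) * (\<sigma> * (1 - l))"
      unfolding pa by (simp add: power2_eq_square algebra_simps)
    have "emb (v' h) - ((l * (p \<bullet> k)) *\<^sub>R emb w + (l * (p \<bullet> v' h + w \<bullet> k) + - l\<^sup>2 * (p \<bullet> w) * (p \<bullet> k)) *\<^sub>R emb p)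
        + (\<sigma> * (l * (p \<bullet> v' h + w \<bullet> k) + - l\<^sup>2 * (p \<bullet> w) * (p \<bullet> k))) *\<^sub>R e4
      = emb (v' h) - (l * (p \<bullet> k)) *\<^sub>R emb w
        + (- (l * (p \<bullet> v' h + w \<bullet> k) + - l\<^sup>2 * (p \<bullet> w) * (p \<bullet> k))) *\<^sub>R emb p
        + (\<sigma> * (l * (p \<bullet> v' h + w \<bullet> k) + - l\<^sup>2 * (p \<bullet> w) * (p \<bullet> k))) *\<^sub>R e4"
      by (simp add: algebra_simps)
    also have "\<dots> = En \<sigma> p a - (l * (w \<bullet> k)) *\<^sub>R stereo \<sigma> p"
      unfolding 1 2 En_def stereo_def ea l_def[folded p_def, symmetric] by (simp add: algebra_simps)
    finally show "emb (v' h) - ((?l * (f x \<bullet> v x)) *\<^sub>R emb (f' h) + ?q' h *\<^sub>R emb (f x)) + (\<sigma> * ?q' h) *\<^sub>R e4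
      = En \<sigma> (f x) (v' h + cross3 (cross3 (- lamS (f x) *\<^sub>R f x) (f' h)) (v x))
        - (lamS (f x) * (f' h \<bullet> v x)) *\<^sub>R stereo \<sigma> (f x)"
      by (simp only: a_def l_def p_def w_def k_def)
  qed
qed

definition thS :: "real^3 \<Rightarrow> real^3^3" where
  "thS p = lamS p *\<^sub>R mat 1"

text \<open>The connection form of a conformal coframe; \<open>- lamS p *\<^sub>R p\<close> is the
  gradient of \<open>ln lamS\<close>.\<close>

definition omS :: "real^3 \<Rightarrow> real^3^3" where
  "omS p = cross_mat (- lamS p *\<^sub>R p)"

lemma Sphere3_chart:
  assumes "d \<in> atlas Sphere3"
  obtains \<sigma> where "\<sigma> * \<sigma> = 1" "chart_dom d = {p \<in> sphere 0 1. p $ 4 \<noteq> \<sigma>}"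
    "coord d ` chart_dom d = UNIV" "openin (top_of Sphere3) (chart_dom d)"
    "\<And>p. p \<in> chart_dom d \<Longrightarrow> stereo \<sigma> (coord d p) = p"
    "coframe UNIV (gram d) thS omS (- 1) (- 1)"
proof -
  let ?X = "\<lambda>\<sigma> p. (1 / (1 - \<sigma> * p $ 4)) *\<^sub>R vector [p $ 1, p $ 2, p $ 3] :: real^3"
  let ?A = "\<lambda>\<sigma>. {p \<in> sphere 0 1. p $ 4 \<noteq> \<sigma>} :: (real^4) set"
  have "d \<in> (\<lambda>\<sigma>. embedded_chart (?A \<sigma>) (?X \<sigma>)) ` {1, -1}"
    using assms by (simp only: Sphere3_def riem_space.simps)
  then obtain \<sigma> where s: "\<sigma> \<in> {1, -1 :: real}" and d: "d = embedded_chart (?A \<sigma>) (?X \<sigma>)"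
    by blast
  have s2: "\<sigma> * \<sigma> = 1" using s by auto
  have st4: "stereo \<sigma> x $ 4 = \<sigma> * (1 - lamS x)" for x
    by (simp add: stereo_def emb_def axis_def)
  have QA: "stereo \<sigma> x \<in> ?A \<sigma>" for x
    using En_inner(3)[OF s2, of x] lamS(2)[of x] s by (auto simp: st4 norm_eq_1)
  have XQ: "?X \<sigma> (stereo \<sigma> x) = x" for x
  proof -
    have "1 - \<sigma> * (\<sigma> * (1 - lamS x)) = lamS x" by (simp add: s2 mult.assoc[symmetric])
    then show ?thesis
      using lamS(2)[of x] by (simp add: st4 vec_eq_iff forall_3) (simp add: stereo_def emb_def axis_def)
  qed
  have QX: "stereo \<sigma> (?X \<sigma> p) = p" if "p \<in> ?A \<sigma>" for p
  proof -
    have p: "p $ 1 * p $ 1 + p $ 2 * p $ 2 + p $ 3 * p $ 3 + p $ 4 * p $ 4 = 1" "p $ 4 \<noteq> \<sigma>"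
      using that by (auto simp: norm_eq_1 inner_vec_def sum_4)
    define w where "w = 1 - \<sigma> * p $ 4"
    have w: "w \<noteq> 0" using p(2) s by (auto simp: w_def)
    have sw: "p $ 4 = \<sigma> * (1 - w)" by (simp add: w_def s2 mult.assoc[symmetric])
    have "w * w + (p $ 1 * p $ 1 + p $ 2 * p $ 2 + p $ 3 * p $ 3) = 2 * w"
      using p(1) s2 unfolding sw by algebra
    then have "1 + ?X \<sigma> p \<bullet> ?X \<sigma> p = 2 / w"
      using w by (simp add: w_def[symmetric] inner_vec_def sum_3 field_simps)
    then have "lamS (?X \<sigma> p) = w" using w by (simp add: lamS_def)
    then show ?thesis
      using w sw[symmetric] by (simp add: stereo_def w_def[symmetric] vec_eq_iff forall_4 emb_def axis_def)
  qed
  have inv: "inv_into (?A \<sigma>) (?X \<sigma>) = stereo \<sigma>" "?X \<sigma> ` ?A \<sigma> = UNIV"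
    by (rule inv_into_eqI[OF QA XQ QX]; assumption)+
  show thesis
  proof (rule that[OF s2])
    show dom: "chart_dom d = ?A \<sigma>" by (simp add: d embedded_chart_def)
    show "coord d ` chart_dom d = UNIV" using inv(2) by (simp add: d embedded_chart_def)
    show "stereo \<sigma> (coord d p) = p" if "p \<in> chart_dom d" for p
      using QX that by (simp add: d embedded_chart_def)
    have "open {p::real^4. p $ 4 \<noteq> \<sigma>}"
      by (intro open_Collect_neq continuous_intros)
    moreover have "?A \<sigma> = sphere 0 1 \<inter> {p. p $ 4 \<noteq> \<sigma>}" by auto
    ultimately show "openin (top_of Sphere3) (chart_dom d)"
      unfolding dom by (auto simp: Sphere3_def openin_open)
    show "coframe UNIV (gram d) thS omS (- 1) (- 1)"
      unfolding thS_def[abs_def] omS_def[abs_def]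
    proof (rule coframe_conformal[where L' = "\<lambda>p h. - (lamS p *\<^sub>R h + (- (lamS p)\<^sup>2 * (p \<bullet> h)) *\<^sub>R p)"])
      show "smooth_on UNIV lamS" by (rule smooth_lamS)
      show "smooth_on UNIV (\<lambda>p. - lamS p *\<^sub>R p)"
        by (intro smooth_on_scaleR smooth_on_minus smooth_lamS smooth_on_ident open_UNIV)
      fix p :: "real^3"
      show "lamS p \<noteq> 0" using lamS(2)[of p] by simp
      show "gram d p $ i $ j = (if i = j then (lamS p)\<^sup>2 else 0)" for i j
        unfolding d embedded_chart_def metric_chart.simps inv(1) has_derivative_partial[OF has_derivative_stereo]
        by (simp add: En_inner[OF s2] inner_axis_axis power2_eq_square)
      show "(lamS has_derivative (\<lambda>h. lamS p * ((- lamS p *\<^sub>R p) \<bullet> h))) (at p)"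
        by (rule has_derivative_eq_rhs[OF has_derivative_lamS]) (auto simp: power2_eq_square)
      show "((\<lambda>p. - lamS p *\<^sub>R p) has_derivative (\<lambda>h. - (lamS p *\<^sub>R h + (- (lamS p)\<^sup>2 * (p \<bullet> h)) *\<^sub>R p))) (at p)"
        using has_derivative_minus[OF has_derivative_scaleR[OF has_derivative_lamS has_derivative_ident], of p]
        by simp
      fix X Y :: "real^3"
      define l where "l = lamS p"
      have l: "l * (p \<bullet> p) = 2 - l" using lamS_sq[of p] by (simp add: l_def)
      have "cross3 (- (l *\<^sub>R X + (- l\<^sup>2 * (p \<bullet> X)) *\<^sub>R p)) Y - cross3 (- (l *\<^sub>R Y + (- l\<^sup>2 * (p \<bullet> Y)) *\<^sub>R p)) X
        + cross3 (cross3 (- l *\<^sub>R p) X) (cross3 (- l *\<^sub>R p) Y) = (l * (l * (p \<bullet> p)) - 2 * l) *\<^sub>R cross3 X Y"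
        by (simp add: vec_eq_iff forall_3 cross_components inner_vec_def sum_3 power2_eq_square algebra_simps)
      also have "\<dots> = (- 1 * l\<^sup>2) *\<^sub>R cross3 X Y"
        unfolding l by (simp add: power2_eq_square algebra_simps)
      finally show "cross3 (- (lamS p *\<^sub>R X + (- (lamS p)\<^sup>2 * (p \<bullet> X)) *\<^sub>R p)) Y
        - cross3 (- (lamS p *\<^sub>R Y + (- (lamS p)\<^sup>2 * (p \<bullet> Y)) *\<^sub>R p)) X
        + cross3 (cross3 (- lamS p *\<^sub>R p) X) (cross3 (- lamS p *\<^sub>R p) Y) = (- 1 * (lamS p)\<^sup>2) *\<^sub>R cross3 X Y"
        by (simp only: l_def)
    qed simp
  qed
qed

subsection \<open>Surfaces in the three-sphere\<close>

lemma constant_on_ball_if_partials_zero: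
  fixes W :: "real^2 \<Rightarrow> 'b::real_normed_vector"
  assumes d: "\<And>y. y \<in> ball x r \<Longrightarrow> W differentiable (at y)"
    and p: "\<And>y i. y \<in> ball x r \<Longrightarrow> partial i W y = 0" and y: "y \<in> ball x r"
  shows "W y = W x"
proof -
  have "(W has_derivative (\<lambda>h. 0)) (at y within ball x r)" if "y \<in> ball x r" for y
  proof -
    have D: "(W has_derivative frechet_derivative W (at y)) (at y)"
      using d[OF that] by (simp add: frechet_derivative_works[symmetric])
    have "frechet_derivative W (at y) h = 0" for h
      using linear_axis_expansion[OF has_derivative_linear[OF D], of h] p[OF that]
      by (simp add: partial_def)
    then show ?thesis using D has_derivative_at_withinI by (metis (no_types, lifting) ext)
  qed
  then obtain c where "\<And>y. y \<in> ball x r \<Longrightarrow> W y = c"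
    using has_derivative_zero_constant[OF convex_ball] by blast
  moreover have "x \<in> ball x r" using y by (metis centre_in_ball zero_le_dist le_less_trans mem_ball)
  ultimately show ?thesis using y by metis
qed

lemma partial_const: "partial i (\<lambda>_. c) x = 0"
  by (simp add: partial_def)

lemma differentiable_inner_const: "W differentiable (at x) \<Longrightarrow> (\<lambda>y. u \<bullet> W y) differentiable (at x)"
  unfolding differentiable_def using has_derivative_inner_right by blast

lemma smooth_on_En: "open S \<Longrightarrow> smooth_on S f \<Longrightarrow> smooth_on S (\<lambda>y. En \<sigma> (f y) w)"
  unfolding En_def
  by (intro smooth_on_add smooth_on_diff smooth_on_scaleR smooth_on_mult smooth_on_inner smooth_on_const
      smooth_on_linear[OF _ bounded_linear_emb] smooth_on_compose[OF _ open_UNIV _ _ smooth_lamS]) auto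

locale sphere_surf = surf UNIV H thS omS "- 1" "- 1" U f G
  for H :: "real^3 \<Rightarrow> real^3^3" and U :: "(real^2) set" and f :: "real^2 \<Rightarrow> real^3" and G :: "real^2 \<Rightarrow> real^2^2" +
  fixes \<sigma> :: real
  assumes \<sigma>: "\<sigma> * \<sigma> = 1"
begin

definition F :: "real^2 \<Rightarrow> real^4" where
  "F x = stereo \<sigma> (f x)"

text \<open>Frame components carried isometrically to vectors tangent to the sphere in four-space,
  where \<xi> and the position \<open>F\<close> can be added.\<close>

definition Ev :: "(real^2 \<Rightarrow> real^3) \<Rightarrow> real^2 \<Rightarrow> real^4" where
  "Ev v x = En \<sigma> (f x) (v x)"

lemma th_eq: "thS p *v X = lamS p *\<^sub>R X"
  by (simp add: thS_def scaleR_matrix_vector_assoc[symmetric])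

lemma e_eq: "e i x = lamS (f x) *\<^sub>R partial i f x"
  by (simp add: e_def hat_def th_eq)

lemma Ev_inner: "Ev v x \<bullet> Ev w x = v x \<bullet> w x" "Ev v x \<bullet> F x = 0" "F x \<bullet> Ev v x = 0" "F x \<bullet> F x = 1"
  using En_inner[OF \<sigma>] by (simp_all add: Ev_def F_def inner_commute)

lemma En_F: "En \<sigma> (f x) v \<bullet> En \<sigma> (f x) w = v \<bullet> w" "En \<sigma> (f x) v \<bullet> F x = 0"
    "F x \<bullet> En \<sigma> (f x) v = 0" "F x \<bullet> F x = 1"
  using En_inner[OF \<sigma>] by (simp_all add: F_def inner_commute)

lemma F_derivative:
  assumes x: "x \<in> U"
  shows "(F has_derivative (\<lambda>h. h $ 1 *\<^sub>R Ev (e 1) x + h $ 2 *\<^sub>R Ev (e 2) x)) (at x)"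
proof -
  let ?f' = "frechet_derivative f (at x)"
  have f': "(f has_derivative ?f') (at x)" by (rule smooth_on_has_derivative[OF open_U smooth_f x])
  have D: "(F has_derivative (\<lambda>h. lamS (f x) *\<^sub>R En \<sigma> (f x) (?f' h))) (at x)"
    unfolding F_def[abs_def] by (rule has_derivative_compose[OF f' has_derivative_stereo])
  have "lamS (f x) *\<^sub>R En \<sigma> (f x) (?f' h) = h $ 1 *\<^sub>R Ev (e 1) x + h $ 2 *\<^sub>R Ev (e 2) x" for h
    unfolding linear_axis_expansion[OF has_derivative_linear[OF f'], of h]
    by (simp add: sum_2 linear_add[OF linear_En] linear_scale[OF linear_En] Ev_def e_eq partial_def
        scaleR_add_right mult.commute)
  with D show ?thesis by simp
qed

lemma partial_F: "x \<in> U \<Longrightarrow> partial i F x = Ev (e i) x"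
  using has_derivative_partial[OF F_derivative, of x i] exhaust_2[of i] by (auto simp: axis_def)

text \<open>Gauss's formula for the sphere in four-space: the flat derivative is the Levi-Civita
  derivative plus a radial correction.\<close>

lemma Ev_derivative:
  assumes x: "x \<in> U" and v: "smooth_on U v"
  shows "Ev v differentiable (at x)" "partial i (Ev v) x = Ev (Dh i v) x - (e i x \<bullet> v x) *\<^sub>R F x"
proof -
  note D = has_derivative_En[OF \<sigma> smooth_on_has_derivative[OF open_U smooth_f x] smooth_on_has_derivative[OF open_U v x]]
  show "Ev v differentiable (at x)"
    using D by (auto simp: Ev_def[abs_def] differentiable_def)
  show "partial i (Ev v) x = Ev (Dh i v) x - (e i x \<bullet> v x) *\<^sub>R F x"
    using has_derivative_partial[OF D, of i]
    by (simp add: Ev_def[abs_def] F_def Dh_def a_def omS_def e_eq cross_mat_vec partial_def)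
qed

lemma partial_inner_const:
  assumes "W differentiable (at x)"
  shows "partial i (\<lambda>y. u \<bullet> W y) x = u \<bullet> partial i W x"
  using has_derivative_partial[OF has_derivative_inner_right[OF assms[unfolded frechet_derivative_works]]]
  by (simp add: partial_def)

lemma normal_direction:
  assumes "x \<in> U" "w \<bullet> e 1 x = 0" "w \<bullet> e 2 x = 0"
  defines "n \<equiv> cross3 (e 1 x) (e 2 x)"
  shows "(n \<bullet> n) *\<^sub>R w = (n \<bullet> w) *\<^sub>R n"
proof -
  have "cross3 w n = 0" using assms(2,3) by (simp add: n_def Lagrange)
  then have "cross3 n (cross3 w n) = 0" by simp
  then show ?thesis using Lagrange[of n w n] by simp
qed

text \<open>\<open>w\<close> holds the frame coordinates of the tangential part of \<open>u\<close>.
  Differentiating \<open>u \<bullet> F = k\<close> once makes it normal to the surface; a second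
  derivative, by Gauss's formula, fixes its pairing with \<open>Dh 1 (e 1)\<close>.\<close>

lemma hyperplane_data:
  assumes V: "open V" "V \<subseteq> U" "x \<in> V" and u: "norm u = 1" and k: "\<And>y. y \<in> V \<Longrightarrow> u \<bullet> F y = k"
  obtains w where "u = En \<sigma> (f x) w + k *\<^sub>R F x" "w \<bullet> e 1 x = 0" "w \<bullet> e 2 x = 0"
    "w \<bullet> Dh 1 (e 1) x = (e 1 x \<bullet> e 1 x) * k" "w \<bullet> w + k * k = 1"
proof -
  have x: "x \<in> U" using V by blast
  obtain w where w: "u = En \<sigma> (f x) w + k *\<^sub>R F x"
    using En_complete[OF \<sigma>, of u "f x"] k[OF V(3)] by (auto simp: F_def)
  have dF: "F differentiable (at y)" if "y \<in> U" for y
    using F_derivative[OF that] by (auto simp: differentiable_def)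
  have uE: "u \<bullet> Ev v x = w \<bullet> v x" for v
    unfolding w by (simp add: Ev_def inner_add_left En_F)
  have 1: "u \<bullet> Ev (e i) y = 0" if "y \<in> V" for i y
  proof -
    have y: "y \<in> U" using that V by blast
    have "partial i (\<lambda>y. u \<bullet> F y) y = partial i (\<lambda>y. k) y"
      by (rule partial_cong[OF V(1) that k])
         (assumption, rule differentiable_inner_const[OF dF[OF y]])
    then show ?thesis by (simp add: partial_inner_const[OF dF[OF y]] partial_F[OF y] partial_const)
  qed
  have "partial 1 (\<lambda>y. u \<bullet> Ev (e 1) y) x = partial 1 (\<lambda>y. 0) x"
    by (rule partial_cong[OF V(1,3) 1])
       (assumption, rule differentiable_inner_const[OF Ev_derivative(1)[OF x smooth_e]])
  then have "u \<bullet> partial 1 (Ev (e 1)) x = 0"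
    by (simp add: partial_inner_const[OF Ev_derivative(1)[OF x smooth_e]] partial_const)
  then have 2: "w \<bullet> Dh 1 (e 1) x = (e 1 x \<bullet> e 1 x) * k"
    by (simp add: Ev_derivative(2)[OF x smooth_e] inner_diff_right uE k[OF V(3)])
  have "u \<bullet> u = w \<bullet> w + k * k"
    by (subst (1 2) w) (simp add: inner_add_left inner_add_right En_F)
  then have 3: "w \<bullet> w + k * k = 1"
    using u by (simp add: norm_eq_1)
  show thesis
    by (rule that[OF w _ _ 2 3]) (use 1[OF V(3)] uE in auto)
qed

text \<open>
  On two different hyperplanes the second derivative of \<open>F\<close> would have no component along \<open>F\<close>, contrary
  to \<open>F\<^sub>1\<^sub>1 \<bullet> F = - |F\<^sub>1|\<^sup>2\<close>.
\<close>

lemma hyperplane_unique: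
  assumes V: "open V" "V \<subseteq> U" "x \<in> V" and u: "norm u = 1" "\<And>y. y \<in> V \<Longrightarrow> u \<bullet> F y = k"
    and u': "norm u' = 1" "\<And>y. y \<in> V \<Longrightarrow> u' \<bullet> F y = k'" and k: "k > 0" "k' \<ge> 0"
  shows "u' = u \<and> k' = k"
proof -
  have x: "x \<in> U" using V by blast
  obtain w where w: "u = En \<sigma> (f x) w + k *\<^sub>R F x" "w \<bullet> e 1 x = 0" "w \<bullet> e 2 x = 0"
    "w \<bullet> Dh 1 (e 1) x = (e 1 x \<bullet> e 1 x) * k" "w \<bullet> w + k * k = 1"
    by (rule hyperplane_data[OF V u])
  obtain w' where w': "u' = En \<sigma> (f x) w' + k' *\<^sub>R F x" "w' \<bullet> e 1 x = 0" "w' \<bullet> e 2 x = 0"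
    "w' \<bullet> Dh 1 (e 1) x = (e 1 x \<bullet> e 1 x) * k'" "w' \<bullet> w' + k' * k' = 1"
    by (rule hyperplane_data[OF V u'])
  define n where "n = cross3 (e 1 x) (e 2 x)"
  define q where "q = n \<bullet> n"
  define A where "A = n \<bullet> w"
  define A' where "A' = n \<bullet> w'"
  define b where "b = n \<bullet> Dh 1 (e 1) x"
  define g where "g = e 1 x \<bullet> e 1 x"
  have q: "q > 0" using normal_nz[OF x] by (simp add: q_def n_def)
  have g: "g > 0" using e_nz[OF x] by (simp add: g_def)
  have nw: "q *\<^sub>R w = A *\<^sub>R n" "q *\<^sub>R w' = A' *\<^sub>R n"
    using normal_direction[OF x w(2,3)] normal_direction[OF x w'(2,3)]
    by (simp_all add: q_def A_def A'_def n_def)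
  have Ab: "A * b = q * g * k" "A' * b = q * g * k'"
    using arg_cong[OF nw(1), of "\<lambda>v. v \<bullet> Dh 1 (e 1) x"] arg_cong[OF nw(2), of "\<lambda>v. v \<bullet> Dh 1 (e 1) x"]
    by (simp_all add: w(4) w'(4) b_def g_def)
  have ww: "q * (w \<bullet> w) = A * A" "q * (w' \<bullet> w') = A' * A'"
    using arg_cong[OF nw(1), of "\<lambda>v. v \<bullet> w"] arg_cong[OF nw(2), of "\<lambda>v. v \<bullet> w'"]
    by (simp_all add: A_def A'_def)
  \<comment> \<open>Eliminating \<open>c\<close> shows that \<open>B * B\<close> depends on the
    surface alone, so \<open>A\<close> and \<open>A'\<close> agree up to sign.\<close>
  have quad: "B * B * (q * g * g + b * b) = q * q * g * g" if "B * b = q * g * c" "B * B + q * (c * c) = q" for B c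
  proof -
    have "B * B * (q * g * g + b * b) = B * B * (q * g * g) + (B * b) * (B * b)"
      by (simp add: algebra_simps)
    also have "\<dots> = (B * B + q * (c * c)) * (q * g * g)"
      unfolding that(1) by (simp add: algebra_simps)
    finally show ?thesis unfolding that(2) by (simp add: algebra_simps)
  qed
  have AA: "A * A + q * (k * k) = q" "A' * A' + q * (k' * k') = q"
    by (metis distrib_left mult.right_neutral w(5) ww(1), metis distrib_left mult.right_neutral w'(5) ww(2))
  have "q * g * g + b * b > 0" using q g by (simp add: add_pos_nonneg)
  then have "A * A = A' * A'"
    using quad[OF Ab(1) AA(1)] quad[OF Ab(2) AA(2)]
    by (metis less_irrefl mult_right_cancel)
  then have "A' = A \<or> A' = - A" by (metis square_eq_iff)
  \<comment> \<open>The opposite sign would reverse the height, which the normalisation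
    \<open>k > 0\<close>, \<open>k' \<ge> 0\<close> excludes.\<close>
  moreover have "A' \<noteq> - A"
  proof
    assume "A' = - A"
    then have "q * g * k' = - (q * g * k)" using Ab by simp
    moreover have "q * g * k > 0" "q * g * k' \<ge> 0" using q g k by simp_all
    ultimately show False by simp
  qed
  ultimately have A: "A' = A" by simp
  then have "k' = k" using Ab q g by simp
  moreover have "w' = w" using nw A q by (metis less_irrefl scaleR_left_imp_eq)
  ultimately show ?thesis by (simp add: w(1) w'(1))
qed

text \<open>For constant \<open>h = \<eta>\<close> the vector \<open>\<xi> + \<eta> F\<close> has
  zero derivative: Weingarten's \<open>-h e i\<close> cancels against \<open>\<eta> e i\<close>, and
  Gauss's correction vanishes on a normal. Pairing with \<open>F\<close> gives \<eta>, hence a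
  hyperplane.\<close>

lemma biharmonic_imp_local_hyperplane:
  assumes us: "umbilic_surf UNIV H thS omS (- 1) (- 1) U f G \<xi> h"
    and 0: "\<And>y. y \<in> U \<Longrightarrow> bitension G H f y = 0" and x: "x \<in> U"
  obtains V u k where "open V" "x \<in> V" "V \<subseteq> U" "norm u = 1" "k \<in> {0, 1 / sqrt 2}"
    "\<And>y. y \<in> V \<Longrightarrow> u \<bullet> F y = k" "h x \<noteq> 0 \<Longrightarrow> k = 1 / sqrt 2"
proof -
  interpret umbilic_surf UNIV H thS omS "- 1" "- 1" U f G \<xi> h
    by (rule us)
  obtain r where r: "r > 0" "ball x r \<subseteq> U" using open_U x openE by blast
  let ?V = "ball x r"
  have V: "open ?V" "?V \<subseteq> U" "x \<in> ?V" using r by auto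
  have hdiff: "h differentiable (at y)" if "y \<in> ?V" for y
    using differentiable_U[OF smooth_h] that V by blast
  \<comment> \<open>The square comes first: its derivative vanishes without knowing where
    \<open>h\<close> is zero. A nonzero value at the centre then excludes zeros on the whole
    ball.\<close>
  have sq: "h y * h y = h x * h x" if "y \<in> ?V" for y
  proof (rule constant_on_ball_if_partials_zero[of x r "\<lambda>y. h y * h y", OF _ _ that])
    fix y i assume y: "y \<in> ?V"
    show "(\<lambda>y. h y * h y) differentiable (at y)" using hdiff[OF y] by simp
    show "partial i (\<lambda>y. h y * h y) y = 0"
      using has_derivative_partial[OF has_derivative_mult[OF hdiff[OF y, unfolded frechet_derivative_works]
          hdiff[OF y, unfolded frechet_derivative_works]], of i]
        biharmonic_tangential[of y i] 0 y V(2) by (auto simp: partial_def)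
  qed
  have h: "h y = h x" and hx: "h x = 0 \<or> h x * h x = 1" if "y \<in> ?V" for y
  proof -
    have "h y = h x \<and> (h x = 0 \<or> h x * h x = 1)" if "y \<in> ?V" for y
    proof (cases "h x = 0")
      case True
      then show ?thesis using sq[OF that] by simp
    next
      case False
      then have nz: "h y \<noteq> 0" if "y \<in> ?V" for y using sq[OF that] by auto
      have "bitension G H f y = 0" if "y \<in> ?V" for y using 0 that V(2) by blast
      then have "2 * (h x)\<^sup>2 = 2"
        using biharmonic_normal(1)[OF V nz] by simp
      moreover have "h y = h x"
      proof (rule constant_on_ball_if_partials_zero[OF _ _ that])
        show "h differentiable (at y)" if "y \<in> ?V" for y by (rule hdiff[OF that])
        show "partial i h y = 0" if "y \<in> ?V" for y i
          using biharmonic_tangential[of y i] 0 nz[OF that] V(2) that by auto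
      qed
      ultimately show ?thesis by (simp add: power2_eq_square)
    qed
    with that show "h y = h x" "h x = 0 \<or> h x * h x = 1" by blast+
  qed
  define \<eta> where "\<eta> = h x"
  define W where "W y = Ev \<xi> y + \<eta> *\<^sub>R F y" for y
  have W: "W y = W x" if "y \<in> ?V" for y
  proof (rule constant_on_ball_if_partials_zero[OF _ _ that])
    fix y i assume y: "y \<in> ?V"
    then have yU: "y \<in> U" using V by blast
    have D: "(W has_derivative (\<lambda>v. frechet_derivative (Ev \<xi>) (at y) v
        + \<eta> *\<^sub>R (v $ 1 *\<^sub>R Ev (e 1) y + v $ 2 *\<^sub>R Ev (e 2) y))) (at y)"
      unfolding W_def[abs_def]
      using Ev_derivative(1)[OF yU smooth_xi]
      by (intro has_derivative_add bounded_linear.has_derivative[OF bounded_linear_scaleR_right] F_derivative[OF yU])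
         (simp add: frechet_derivative_works[symmetric])
    then show "W differentiable (at y)" by (auto simp: differentiable_def)
    have "partial i W y = partial i (Ev \<xi>) y + \<eta> *\<^sub>R Ev (e i) y"
      using has_derivative_partial[OF D, of i] exhaust_2[of i] by (auto simp: partial_def axis_def)
    then show "partial i W y = 0"
      using h[OF y] normal_xi[OF yU, of i]
      by (simp add: Ev_derivative(2)[OF yU smooth_xi] Dh_xi[OF yU] Ev_def \<eta>_def inner_commute
          linear_scale[OF linear_En] linear_neg[OF linear_En])
  qed
  have WF: "W x \<bullet> F y = \<eta>" if "y \<in> ?V" for y
    using W[OF that, symmetric] by (simp add: W_def inner_add_left Ev_inner)
  have WW: "W x \<bullet> W x = 1 + \<eta> * \<eta>"
    using unit_xi[OF x] by (simp add: W_def inner_add_left inner_add_right Ev_inner)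
  show thesis
  proof (cases "\<eta> = 0")
    case True
    show thesis
    proof (rule that[OF V(1,3,2)])
      show "norm (W x) = 1" using WW True by (simp add: norm_eq_1)
      show "W x \<bullet> F y = 0" if "y \<in> ?V" for y using WF[OF that] True by simp
    qed (use True in \<open>auto simp: \<eta>_def\<close>)
  next
    case False
    then have \<eta>: "\<eta> * \<eta> = 1" using hx[OF V(3)] by (simp add: \<eta>_def)
    show thesis
    proof (rule that[OF V(1,3,2)])
      \<comment> \<open>\<open>1 / sqrt 2\<close> normalises a vector of squared length 2, and the
        sign \<eta> makes the height \<open>\<eta> * \<eta> / sqrt 2\<close> positive whichever
        normal was chosen.\<close>
      show "norm ((\<eta> / sqrt 2) *\<^sub>R W x) = 1"
        unfolding norm_eq_1 using WW \<eta> by simp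
      show "(\<eta> / sqrt 2) *\<^sub>R W x \<bullet> F y = 1 / sqrt 2" if "y \<in> ?V" for y
        using WF[OF that] \<eta> by simp
    qed auto
  qed
qed

text \<open>\<xi> is the tangential part of \<open>sqrt 2 u\<close>, whose component along
  \<open>F\<close> is 1; as \<open>sqrt 2 u\<close> has squared length 2, \<xi> has unit length.
  Differentiating the constant \<open>sqrt 2 u = \<xi> + F\<close> gives Weingarten's equation with
  \<open>h = 1\<close>.\<close>

lemma small_sphere_umbilic:
  assumes u: "norm u = 1" "\<And>y. y \<in> U \<Longrightarrow> u \<bullet> F y = 1 / sqrt 2"
  defines "\<xi> \<equiv> \<lambda>y. \<chi> k. sqrt 2 * (u \<bullet> En \<sigma> (f y) (axis k 1))"
  shows "umbilic_surf UNIV H thS omS (- 1) (- 1) U f G \<xi> (\<lambda>_. 1)"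
proof -
  have su: "sqrt 2 *\<^sub>R u = Ev \<xi> y + F y" if y: "y \<in> U" for y
  proof -
    have s: "(sqrt 2 *\<^sub>R u) \<bullet> F y = 1" by (simp add: u(2)[OF y])
    obtain w where w: "sqrt 2 *\<^sub>R u = En \<sigma> (f y) w + F y"
      using En_complete[OF \<sigma>, of "sqrt 2 *\<^sub>R u" "f y"] s by (auto simp: F_def)
    have "w $ k = \<xi> y $ k" for k
    proof -
      have "(sqrt 2 *\<^sub>R u) \<bullet> En \<sigma> (f y) (axis k 1) = w \<bullet> axis k 1"
        unfolding w by (simp add: inner_add_left En_F)
      then show ?thesis by (simp add: \<xi>_def inner_axis)
    qed
    then have "w = \<xi> y" by (simp add: vec_eq_iff)
    then show ?thesis using w by (simp add: Ev_def)
  qed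
  have sm: "smooth_on U \<xi>"
    unfolding \<xi>_def
    by (rule smooth_on_vecI[OF open_U])
       (simp, intro smooth_on_mult smooth_on_inner smooth_on_const smooth_on_En open_U smooth_f)
  have unit: "\<xi> y \<bullet> \<xi> y = 1" if y: "y \<in> U" for y
  proof -
    have "Ev \<xi> y = sqrt 2 *\<^sub>R u - F y" using su[OF y] by simp
    moreover have "sqrt 2 * (sqrt 2 - 1 / sqrt 2) = 1" by (simp add: right_diff_distrib)
    ultimately have "Ev \<xi> y \<bullet> Ev \<xi> y = 1"
      using u y by (simp add: inner_diff_left inner_diff_right Ev_inner inner_commute[of "F y" u] norm_eq_1)
    then show ?thesis by (simp add: Ev_inner)
  qed
  have dF: "F differentiable (at y)" if "y \<in> U" for y
    using F_derivative[OF that] by (auto simp: differentiable_def)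
  have normal: "\<xi> y \<bullet> e i y = 0" if y: "y \<in> U" for y i
  proof -
    have "partial i (\<lambda>y. u \<bullet> F y) y = partial i (\<lambda>y. 1 / sqrt 2) y"
      by (rule partial_cong[OF open_U y u(2)])
         (assumption, rule differentiable_inner_const[OF dF[OF y]])
    then have "(sqrt 2 *\<^sub>R u) \<bullet> Ev (e i) y = 0"
      by (simp add: partial_inner_const[OF dF[OF y]] partial_F[OF y] partial_const)
    then show ?thesis unfolding su[OF y] by (simp add: inner_add_left Ev_inner)
  qed
  have Dxi: "Dh i \<xi> y = - e i y" if y: "y \<in> U" for y i
  proof -
    have "partial i (\<lambda>y. Ev \<xi> y) y = partial i (\<lambda>y. sqrt 2 *\<^sub>R u - F y) y"
      using su by (intro partial_cong[OF open_U y] Ev_derivative(1)[OF y sm]) (auto simp: eq_diff_eq)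
    also have "\<dots> = - Ev (e i) y"
      using has_derivative_partial[OF has_derivative_diff[OF has_derivative_const F_derivative[OF y]], of i]
        exhaust_2[of i] by (auto simp: axis_def)
    finally have "Ev (Dh i \<xi>) y + Ev (e i) y = 0"
      using normal[OF y, of i] by (simp add: Ev_derivative(2)[OF y sm] inner_commute)
    then have "En \<sigma> (f y) (Dh i \<xi> y + e i y) = 0"
      by (simp add: Ev_def linear_add[OF linear_En])
    then have "(Dh i \<xi> y + e i y) \<bullet> (Dh i \<xi> y + e i y) = 0"
      by (metis En_inner(1)[OF \<sigma>] inner_zero_left)
    then show ?thesis by (simp add: eq_neg_iff_add_eq_0)
  qed
  show ?thesis
  proof unfold_locales
    show "smooth_on U \<xi>" by (rule sm)
    show "smooth_on U (\<lambda>_. 1 :: real)" by (rule smooth_on_const[OF open_U])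
    fix x i j assume x: "x \<in> U"
    show "\<xi> x \<bullet> \<xi> x = 1" by (rule unit[OF x])
    show "\<xi> x \<bullet> e i x = 0" by (rule normal[OF x])
    have "partial i (\<lambda>y. \<xi> y \<bullet> e j y) x = partial i (\<lambda>y. 0) x"
      by (rule partial_cong[OF open_U x]) (auto simp: normal intro!: differentiable_U smooth_on_inner open_U sm smooth_e x)
    then have "Dh i (e j) x \<bullet> \<xi> x = e i x \<bullet> e j x"
      using partial_inner[OF x sm smooth_e, of i j]
      by (simp add: partial_def Dxi[OF x] inner_commute[of "\<xi> x"])
    then have B\<xi>: "B i j x \<bullet> \<xi> x = e i x \<bullet> e j x"
      using normal[OF x]
      by (simp add: B_eq[OF x] inner_diff_left sum_2 inner_add_left inner_commute[of _ "\<xi> x"] inner_diff_right inner_add_right)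
    have "B i j x - (B i j x \<bullet> \<xi> x) *\<^sub>R \<xi> x = 0"
      by (rule eq_0_if_orthogonal_frame[OF normal_nz[OF x], of "\<xi> x"])
         (use unit[OF x] in \<open>auto simp: normal[OF x] B_normal[OF x] inner_diff_left\<close>)
    then show "B i j x = (1 * (e i x \<bullet> e j x)) *\<^sub>R \<xi> x"
      by (simp add: B\<xi>)
  qed
qed

lemma small_sphere_biharmonic:
  assumes u: "norm u = 1" "\<And>y. y \<in> U \<Longrightarrow> u \<bullet> F y = 1 / sqrt 2" and x: "x \<in> U"
  shows "bitension G H f x = 0"
    and "\<exists>\<zeta>. unit_normal H f x \<zeta> \<and> mean_curvature G H f x \<zeta> \<noteq> 0"
proof -
  let ?\<xi> = "\<lambda>y. \<chi> k. sqrt 2 * (u \<bullet> En \<sigma> (f y) (axis k 1))"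
  interpret umbilic_surf UNIV H thS omS "- 1" "- 1" U f G ?\<xi> "\<lambda>_. 1"
    by (rule small_sphere_umbilic[OF u])
  have p0: "partial i (\<lambda>_. c :: real) = (\<lambda>_. 0)" for i :: 2 and c
    by (simp add: partial_def fun_eq_iff)
  \<comment> \<open>For \<open>h = 1\<close> and \<open>s = t = -1\<close> the normal part is
    \<open>-4 + 4\<close>.\<close>
  have "hat (bitension G H f) x = 0"
    unfolding hat_bitension_umb[OF x] lap_def p0 Sop_def by (simp add: algebra_simps flip: scaleR_add_left)
  then show "bitension G H f x = 0"
    using lamS(2)[of "f x"] by (simp add: hat_def th_eq)
  let ?\<zeta> = "(1 / lamS (f x)) *\<^sub>R ?\<xi> x"
  have th: "thS (f x) *v ?\<zeta> = ?\<xi> x"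
    using lamS(2)[of "f x"] by (simp only: th_eq) simp
  have "unit_normal H f x ?\<zeta>"
    unfolding unit_normal_iff[OF x] th using unit_xi[OF x] normal_xi[OF x] by (simp add: inner_commute)
  moreover have "mean_curvature G H f x ?\<zeta> = 1"
    unfolding mean_curvature_eq[OF x] th using unit_xi[OF x] by simp
  ultimately show "\<exists>\<zeta>. unit_normal H f x \<zeta> \<and> mean_curvature G H f x \<zeta> \<noteq> 0"
    by (metis zero_neq_one)
qed

text \<open>\<open>L\<close> records the pairings with the tangent frame at \<open>F x\<close>. Its
  composition with \<open>F\<close> has the invertible derivative \<open>G x\<close> and so covers a
  neighbourhood of \<open>L (F x)\<close>; as \<open>L\<close> is injective on the small sphere near
  \<open>F x\<close>, points of the sphere over that neighbourhood lie on the surface.\<close>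

lemma small_sphere_image_open:
  assumes u: "norm u = 1" "\<And>y. y \<in> U \<Longrightarrow> u \<bullet> F y = 1 / sqrt 2" and x: "x \<in> U"
  obtains T where "open T" "F x \<in> T" "sphere 0 1 \<inter> {p. u \<bullet> p = 1 / sqrt 2} \<inter> T \<subseteq> F ` U"
proof -
  let ?S = "sphere 0 1 \<inter> {p. u \<bullet> p = 1 / sqrt 2} :: (real^4) set"
  define L where "L y = (vector [y \<bullet> Ev (e 1) x, y \<bullet> Ev (e 2) x] :: real^2)" for y
  have blL: "bounded_linear L"
    unfolding L_def[abs_def]
    by (rule linear_conv_bounded_linear[THEN iffD1], rule linearI)
       (auto simp: vec_eq_iff forall_2 inner_add_left)
  \<comment> \<open>For \<open>z = y - y'\<close> only normal components remain, and
    \<open>z \<bullet> u = 0\<close> relates them: \<open>|z|^2 = 2 \<zeta>^2\<close>. On the unit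
    sphere \<open>z \<bullet> (y + y') = 0\<close>, so the radius \<open>1/2\<close> yields
    \<open>4 \<zeta>^2 \<le> |z|^2\<close>, hence \<open>z = 0\<close>.\<close>
  have inj: "y = y'" if y: "y \<in> ?S" "y' \<in> ?S" "dist y (F x) < 1 / 2" "dist y' (F x) < 1 / 2" "L y = L y'" for y y'
  proof -
    define z where "z = y - y'"
    define \<zeta> where "\<zeta> = z \<bullet> F x"
    define n where "n = cross3 (e 1 x) (e 2 x)"
    define q where "q = n \<bullet> n"
    have q: "q > 0" using normal_nz[OF x] by (simp add: q_def n_def)
    obtain a where a: "z = En \<sigma> (f x) a + \<zeta> *\<^sub>R F x"
      using En_complete[OF \<sigma>, of z "f x"] by (auto simp: F_def \<zeta>_def)
    obtain c where c: "u = En \<sigma> (f x) c + (1 / sqrt 2) *\<^sub>R F x" "c \<bullet> e 1 x = 0" "c \<bullet> e 2 x = 0"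
      "c \<bullet> c + (1 / sqrt 2) * (1 / sqrt 2) = 1"
      by (rule hyperplane_data[OF open_U order_refl x u])
    have zE: "z \<bullet> Ev (e i) x = a \<bullet> e i x" for i
      unfolding a by (simp add: Ev_def inner_add_left En_F)
    have "z \<bullet> Ev (e 1) x = 0" "z \<bullet> Ev (e 2) x = 0"
      using y(5) by (simp_all add: L_def vec_eq_iff forall_2 z_def inner_diff_left)
    then have ae: "a \<bullet> e 1 x = 0" "a \<bullet> e 2 x = 0" by (simp_all add: zE)
    have na: "q *\<^sub>R a = (n \<bullet> a) *\<^sub>R n" and nc: "q *\<^sub>R c = (n \<bullet> c) *\<^sub>R n"
      using normal_direction[OF x ae] normal_direction[OF x c(2,3)] by (simp_all add: q_def n_def)
    have "z \<bullet> u = 0"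
      using y(1,2) by (simp add: z_def inner_diff_left inner_diff_right inner_commute)
    moreover have "z \<bullet> u = a \<bullet> c + \<zeta> / sqrt 2"
      unfolding a c(1) by (simp add: inner_add_left inner_add_right En_F)
    ultimately have ac: "a \<bullet> c = - (\<zeta> / sqrt 2)" by simp
    have cc: "c \<bullet> c = 1 / 2" using c(4) by simp
    have "(a \<bullet> a) * (c \<bullet> c) = (a \<bullet> c) * (a \<bullet> c)"
    proof -
      have "q * q * ((a \<bullet> a) * (c \<bullet> c)) = ((q *\<^sub>R a) \<bullet> a) * ((q *\<^sub>R c) \<bullet> c)" by simp
      also have "\<dots> = ((q *\<^sub>R a) \<bullet> c) * ((q *\<^sub>R c) \<bullet> a)"
        unfolding na nc by simp
      also have "\<dots> = q * q * ((a \<bullet> c) * (a \<bullet> c))" by (simp add: inner_commute)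
      finally show ?thesis using q by simp
    qed
    then have aa: "a \<bullet> a = \<zeta> * \<zeta>" unfolding ac cc by simp
    have zz: "z \<bullet> z = 2 * (\<zeta> * \<zeta>)"
    proof -
      have "z \<bullet> z = a \<bullet> a + \<zeta> * \<zeta>"
        by (subst (1 2) a) (simp add: inner_add_left inner_add_right En_F)
      then show ?thesis by (simp add: aa)
    qed
    have "z \<bullet> (y + y') = 0"
      using y(1,2) by (simp add: z_def inner_diff_left inner_diff_right inner_add_right inner_commute norm_eq_1)
    then have "2 * \<zeta> = z \<bullet> ((F x - y) + (F x - y'))"
      unfolding \<zeta>_def inner_add_right inner_diff_right by linarith
    also have "\<bar>\<dots>\<bar> \<le> norm z * norm ((F x - y) + (F x - y'))"
      by (rule Cauchy_Schwarz_ineq2)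
    also have "\<dots> \<le> norm z * 1"
    proof (intro mult_left_mono)
      have "norm ((F x - y) + (F x - y')) \<le> dist y (F x) + dist y' (F x)"
        using norm_triangle_ineq[of "F x - y" "F x - y'"] by (simp add: dist_norm norm_minus_commute)
      then show "norm ((F x - y) + (F x - y')) \<le> 1" using y(3,4) by simp
    qed simp
    finally have "(2 * \<zeta>)\<^sup>2 \<le> (norm z)\<^sup>2"
      by (intro abs_le_square_iff[THEN iffD1]) simp
    then have "\<zeta> * \<zeta> \<le> 0"
      unfolding power2_norm_eq_inner zz by (simp add: power2_eq_square)
    then have "z \<bullet> z = 0" unfolding zz by (smt (verit) zero_le_square)
    then show "y = y'" by (simp add: z_def)
  qed
  have cF: "continuous_on U F"
    by (intro continuous_at_imp_continuous_on ballI has_derivative_continuous[OF F_derivative])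
  define V where "V = U \<inter> F -` ball (F x) (1 / 2)"
  have V: "open V" unfolding V_def by (rule continuous_open_preimage[OF cF open_U open_ball])
  have xV: "x \<in> V" using x by (simp add: V_def)
  have D: "((\<lambda>y. L (F y)) has_derivative (*v) (G x)) (at x)"
    using bounded_linear.has_derivative[OF blL F_derivative[OF x]]
    by (rule has_derivative_eq_rhs)
       (auto simp: fun_eq_iff L_def vec_eq_iff forall_2 matrix_vector_mult_def sum_2 G_component[OF x]
         inner_add_left inner_add_right Ev_inner inner_commute)
  have "L (F x) \<in> interior ((\<lambda>y. L (F y)) ` V)"
  proof (rule sussmann_open_mapping[OF open_U _ x D])
    show "continuous_on U (\<lambda>y. L (F y))"
      using cF bounded_linear.continuous_on[OF blL] by blast
    show "bounded_linear ((*v) (matrix_inv (G x)))" by (rule matrix_vector_mul_bounded_linear)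
    show "(*v) (G x) \<circ> (*v) (matrix_inv (G x)) = id"
      by (auto simp: fun_eq_iff matrix_vector_mul_assoc matrix_inv_mult_right ginv_explicit[OF x])
    show "V \<subseteq> U" by (auto simp: V_def)
    show "x \<in> interior V" using V xV by (simp add: interior_open)
  qed
  then obtain T where T: "open T" "L (F x) \<in> T" "T \<subseteq> (\<lambda>y. L (F y)) ` V"
    unfolding interior_def by blast
  show thesis
  proof (rule that[of "ball (F x) (1 / 2) \<inter> L -` T"])
    show "open (ball (F x) (1 / 2) \<inter> L -` T)"
      by (intro continuous_open_preimage open_ball T linear_continuous_on blL)
    show "F x \<in> ball (F x) (1 / 2) \<inter> L -` T" using T by simp
    show "?S \<inter> (ball (F x) (1 / 2) \<inter> L -` T) \<subseteq> F ` U"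
    proof
      fix y assume y: "y \<in> ?S \<inter> (ball (F x) (1 / 2) \<inter> L -` T)"
      then obtain y' where y': "y' \<in> V" "L y = L (F y')" using T(3) by blast
      then have "y' \<in> U" "dist (F y') (F x) < 1 / 2" by (auto simp: V_def dist_commute)
      moreover have "F y' \<in> ?S"
        using u(2)[OF \<open>y' \<in> U\<close>] Ev_inner(4)[of y'] by (simp add: norm_eq_1)
      ultimately have "y = F y'"
        using y y' by (intro inj) (auto simp: dist_commute)
      then show "y \<in> F ` U" using \<open>y' \<in> U\<close> by blast
    qed
  qed
qed

end

section \<open>From charts to whole surfaces in the three-sphere\<close>

lemma Sphere3_surface_chart:
  assumes M: "surface M Sphere3 \<phi>" and c: "c \<in> atlas M" and d: "d \<in> atlas Sphere3"
  shows "\<exists>\<sigma>. sphere_surf (gram d) (loc_dom c d \<phi>) (loc_rep c d \<phi>) (gram c) \<sigma> \<and>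
    (\<forall>p. p \<in> chart_dom c \<longrightarrow> \<phi> p \<in> chart_dom d \<longrightarrow>
       coord c p \<in> loc_dom c d \<phi> \<and> sphere_surf.F (loc_rep c d \<phi>) \<sigma> (coord c p) = \<phi> p)"
proof -
  obtain \<sigma> where \<sigma>: "\<sigma> * \<sigma> = 1" "coord d ` chart_dom d = UNIV" "openin (top_of Sphere3) (chart_dom d)"
    "\<And>p. p \<in> chart_dom d \<Longrightarrow> stereo \<sigma> (coord d p) = p"
    "coframe UNIV (gram d) thS omS (- 1) (- 1)"
    using Sphere3_chart[OF d] by metis
  have "surf UNIV (gram d) thS omS (- 1) (- 1) (loc_dom c d \<phi>) (loc_rep c d \<phi>) (gram c)"
    using surf_in_charts[OF M c d \<sigma>(3)] \<sigma>(2,5) by simp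
  then have S: "sphere_surf (gram d) (loc_dom c d \<phi>) (loc_rep c d \<phi>) (gram c) \<sigma>"
    using \<sigma>(1) by (simp add: sphere_surf_def sphere_surf_axioms_def)
  moreover have "coord c p \<in> loc_dom c d \<phi> \<and> sphere_surf.F (loc_rep c d \<phi>) \<sigma> (coord c p) = \<phi> p"
    if p: "p \<in> chart_dom c" "\<phi> p \<in> chart_dom d" for p
  proof -
    have "chart_inv c (coord c p) = p"
      by (rule surface_chart_facts(5)[OF M c d \<sigma>(3) p(1)])
    then show ?thesis
      using p \<sigma>(4)[OF p(2)] unfolding sphere_surf.F_def[OF S] by (auto simp: loc_dom_def loc_rep_def)
  qed
  ultimately show ?thesis by blast
qed

lemma Sphere3_surface_point:
  assumes M: "surface M Sphere3 \<phi>" and p: "p \<in> topspace (top_of M)"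
  obtains c d where "c \<in> atlas M" "d \<in> atlas Sphere3" "p \<in> chart_dom c" "\<phi> p \<in> chart_dom d"
proof -
  have "p \<in> (\<Union>c\<in>atlas M. chart_dom c)"
    using M p by (simp add: surface_def riemannian_manifold_def)
  then obtain c where c: "c \<in> atlas M" "p \<in> chart_dom c" by blast
  have "\<phi> p \<in> topspace (top_of Sphere3)"
    using M p unfolding surface_def smooth_map_def continuous_map_def by (simp add: Pi_iff)
  then have "\<phi> p \<in> sphere 0 1" by (simp add: Sphere3_def)
  then have "\<exists>d\<in>atlas Sphere3. \<phi> p \<in> chart_dom d"
    by (cases "\<phi> p $ 4 = 1") (simp_all add: Sphere3_def embedded_chart_def)
  then show thesis using that c by blast
qed

lemma Sphere3_proper_biharmonic_imp:
  assumes M: "surface M Sphere3 \<phi>" and umb: "totally_umbilical M Sphere3 \<phi>"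
    and pb: "proper_biharmonic M Sphere3 \<phi>"
  shows "part_of_small_sphere M \<phi>"
proof -
  have rm: "riemannian_manifold M" and conn: "connected_space (top_of M)"
    using M by (simp_all add: surface_def)
  have od: "openin (top_of Sphere3) (chart_dom d)" if "d \<in> atlas Sphere3" for d
    using Sphere3_chart[OF that] by metis
  \<comment> \<open>An open piece in the hyperplane with unit normal \<open>u\<close> and height
    \<open>k\<close>; height 0 is the totally geodesic case.\<close>
  define hyp where "hyp W u k \<longleftrightarrow> openin (top_of M) W \<and> norm u = 1 \<and> k \<in> {0, 1 / sqrt 2} \<and> (\<forall>q\<in>W. u \<bullet> \<phi> q = k)"
    for W and u :: "real^4" and k
  \<comment> \<open>The parameter \<open>h\<close> serves two uses: 0 at arbitrary points, and a
    nonzero mean curvature at one point, which fixes the height \<open>1 / sqrt 2\<close>.\<close>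
  have local: "\<exists>W u k. hyp W u k \<and> p \<in> W \<and> (h \<noteq> 0 \<longrightarrow> k = 1 / sqrt 2)"
    if c: "c \<in> atlas M" and d: "d \<in> atlas Sphere3" and p: "p \<in> chart_dom c" "\<phi> p \<in> chart_dom d"
      and h: "h = 0 \<or> (\<exists>\<zeta>. unit_normal (gram d) (loc_rep c d \<phi>) (coord c p) \<zeta>
         \<and> h = mean_curvature (gram c) (gram d) (loc_rep c d \<phi>) (coord c p) \<zeta>)" for c d p h
  proof -
    obtain \<sigma> where S: "sphere_surf (gram d) (loc_dom c d \<phi>) (loc_rep c d \<phi>) (gram c) \<sigma>"
      and F: "\<And>p. p \<in> chart_dom c \<Longrightarrow> \<phi> p \<in> chart_dom d \<Longrightarrow>
       coord c p \<in> loc_dom c d \<phi> \<and> sphere_surf.F (loc_rep c d \<phi>) \<sigma> (coord c p) = \<phi> p"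
      using Sphere3_surface_chart[OF M c d] by auto
    interpret sphere_surf "gram d" "loc_dom c d \<phi>" "loc_rep c d \<phi>" "gram c" \<sigma> by (rule S)
    have us: "umbilic_surf UNIV (gram d) thS omS (- 1) (- 1)
        (loc_dom c d \<phi>) (loc_rep c d \<phi>) (gram c) xi0 h0"
      by (rule umbilic_surfI) (use umb c d in \<open>auto simp: totally_umbilical_def\<close>)
    have 0: "bitension (gram c) (gram d) (loc_rep c d \<phi>) y = 0" if "y \<in> loc_dom c d \<phi>" for y
      using pb c d that by (auto simp: proper_biharmonic_def biharmonic_map_def)
    have x: "coord c p \<in> loc_dom c d \<phi>" using F p by blast
    obtain V u k where V: "open V" "coord c p \<in> V" "V \<subseteq> loc_dom c d \<phi>" "norm u = 1" "k \<in> {0, 1 / sqrt 2}"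
      "\<And>y. y \<in> V \<Longrightarrow> u \<bullet> F y = k" "h0 (coord c p) \<noteq> 0 \<Longrightarrow> k = 1 / sqrt 2"
      using biharmonic_imp_local_hyperplane[OF us 0 x] by metis
    let ?W = "(chart_dom c \<inter> \<phi> -` chart_dom d) \<inter> {q \<in> chart_dom c. coord c q \<in> V}"
    have "openin (top_of M) ?W"
      using surface_chart_facts(6)[OF M c d od[OF d]] riemannian_chart_open(2)[OF rm c V(1)]
      by (rule openin_Int)
    moreover have "u \<bullet> \<phi> q = k" if "q \<in> ?W" for q
      using V(6)[of "coord c q"] F[of q] that by auto
    moreover have "h \<noteq> 0 \<Longrightarrow> h0 (coord c p) \<noteq> 0"
      using h umbilic_surf.mean_curvature_eq[OF us x] by auto
    ultimately have "hyp ?W u k \<and> p \<in> ?W \<and> (h \<noteq> 0 \<longrightarrow> k = 1 / sqrt 2)"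
      using V p unfolding hyp_def by blast
    then show ?thesis by blast
  qed
  have unique: "u' = u \<and> k' = 1 / sqrt 2"
    if h: "hyp W u (1 / sqrt 2)" "hyp W' u' k'" and q: "q \<in> W" "q \<in> W'" for W W' u u' k' q
  proof -
    have "q \<in> topspace (top_of M)" using h(1) q(1) openin_subset unfolding hyp_def by blast
    then obtain c d where c: "c \<in> atlas M" and d: "d \<in> atlas Sphere3" and qc: "q \<in> chart_dom c" "\<phi> q \<in> chart_dom d"
      by (rule Sphere3_surface_point[OF M])
    obtain \<sigma> where S: "sphere_surf (gram d) (loc_dom c d \<phi>) (loc_rep c d \<phi>) (gram c) \<sigma>"
      and F: "\<And>p. p \<in> chart_dom c \<Longrightarrow> \<phi> p \<in> chart_dom d \<Longrightarrow>
       coord c p \<in> loc_dom c d \<phi> \<and> sphere_surf.F (loc_rep c d \<phi>) \<sigma> (coord c p) = \<phi> p"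
      using Sphere3_surface_chart[OF M c d] by auto
    interpret sphere_surf "gram d" "loc_dom c d \<phi>" "loc_rep c d \<phi>" "gram c" \<sigma> by (rule S)
    let ?X = "(chart_dom c \<inter> \<phi> -` chart_dom d) \<inter> (W \<inter> W')"
    have "openin (top_of M) ?X"
      using openin_Int[OF surface_chart_facts(6)[OF M c d od[OF d]] openin_Int[of _ W W']] h
      unfolding hyp_def by blast
    then have "open (coord c ` ?X)" by (rule riemannian_chart_open(1)[OF rm c]) blast
    moreover have "coord c ` ?X \<subseteq> loc_dom c d \<phi>" using F by blast
    moreover have "coord c q \<in> coord c ` ?X" using q qc by blast
    moreover have "u \<bullet> F y = 1 / sqrt 2" "u' \<bullet> F y = k'" if "y \<in> coord c ` ?X" for y
      using that F h unfolding hyp_def by force+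
    ultimately show ?thesis
      using h unfolding hyp_def by (intro hyperplane_unique[of "coord c ` ?X" "coord c q"]) auto
  qed
  obtain c d x \<zeta> where c: "c \<in> atlas M" and d: "d \<in> atlas Sphere3" and x: "x \<in> loc_dom c d \<phi>"
    and \<zeta>: "unit_normal (gram d) (loc_rep c d \<phi>) x \<zeta>" "mean_curvature (gram c) (gram d) (loc_rep c d \<phi>) x \<zeta> \<noteq> 0"
    using pb unfolding proper_biharmonic_def minimal_def by blast
  obtain p0 where p0: "p0 \<in> chart_dom c" "\<phi> p0 \<in> chart_dom d" "x = coord c p0"
    using x by (auto simp: loc_dom_def)
  obtain W0 u where W0: "hyp W0 u (1 / sqrt 2)" "p0 \<in> W0"
    using local[OF c d p0(1,2), of "mean_curvature (gram c) (gram d) (loc_rep c d \<phi>) x \<zeta>"] \<zeta> p0(3) by metis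
  \<comment> \<open>All open pieces in the hyperplane found at \<open>p0\<close>. An admissible
    piece that meets \<open>A\<close> lies in the same hyperplane by uniqueness, so the complement
    is open too and connectedness applies.\<close>
  define A where "A = \<Union>{W. hyp W u (1 / sqrt 2)}"
  have A: "openin (top_of M) A" unfolding A_def hyp_def by auto
  have "openin (top_of M) (topspace (top_of M) - A)"
  proof (subst openin_subopen, intro ballI)
    fix p assume p: "p \<in> topspace (top_of M) - A"
    then obtain c d where "c \<in> atlas M" "d \<in> atlas Sphere3" "p \<in> chart_dom c" "\<phi> p \<in> chart_dom d"
      by (metis DiffD1 Sphere3_surface_point[OF M])
    from local[OF this, of 0] obtain W u' k' where W: "hyp W u' k'" "p \<in> W" by auto
    have "W \<inter> A = {}"
    proof (rule ccontr)
      assume "W \<inter> A \<noteq> {}"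
      then obtain q W' where "q \<in> W" "q \<in> W'" "hyp W' u (1 / sqrt 2)" by (auto simp: A_def)
      then have "hyp W u (1 / sqrt 2)" using unique W(1) by metis
      then show False using W(2) p by (auto simp: A_def)
    qed
    moreover have "openin (top_of M) W" using W(1) by (simp add: hyp_def)
    ultimately show "\<exists>T. openin (top_of M) T \<and> p \<in> T \<and> T \<subseteq> topspace (top_of M) - A"
      using W(2) openin_subset by blast
  qed
  then have "closedin (top_of M) A" using A openin_subset by (simp add: closedin_def)
  then have "A = topspace (top_of M)"
    using conn A W0 unfolding connected_space_clopen_in A_def by blast
  then have all: "u \<bullet> \<phi> p = 1 / sqrt 2" if "p \<in> topspace (top_of M)" for p
    using that unfolding A_def hyp_def by blast
  have u: "norm u = 1" using W0 by (simp add: hyp_def)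
  let ?S = "sphere 0 1 \<inter> {p. u \<bullet> p = 1 / sqrt 2}"
  have "openin (top_of_set ?S) (\<phi> ` topspace (top_of M))"
  proof (subst openin_subopen, intro ballI)
    fix y assume "y \<in> \<phi> ` topspace (top_of M)"
    then obtain p where p: "p \<in> topspace (top_of M)" "y = \<phi> p" by blast
    obtain c d where c: "c \<in> atlas M" and d: "d \<in> atlas Sphere3" and pc: "p \<in> chart_dom c" "\<phi> p \<in> chart_dom d"
      by (rule Sphere3_surface_point[OF M p(1)])
    obtain \<sigma> where S: "sphere_surf (gram d) (loc_dom c d \<phi>) (loc_rep c d \<phi>) (gram c) \<sigma>"
      and F: "\<And>p. p \<in> chart_dom c \<Longrightarrow> \<phi> p \<in> chart_dom d \<Longrightarrow>
       coord c p \<in> loc_dom c d \<phi> \<and> sphere_surf.F (loc_rep c d \<phi>) \<sigma> (coord c p) = \<phi> p"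
      using Sphere3_surface_chart[OF M c d] by auto
    interpret sphere_surf "gram d" "loc_dom c d \<phi>" "loc_rep c d \<phi>" "gram c" \<sigma> by (rule S)
    have sub: "chart_dom c \<subseteq> topspace (top_of M)"
      using rm c openin_subset unfolding riemannian_manifold_def by blast
    have FU: "\<exists>q\<in>topspace (top_of M). F y = \<phi> q" if "y \<in> loc_dom c d \<phi>" for y
      using that F sub by (force simp: loc_dom_def)
    then have uF: "u \<bullet> F y = 1 / sqrt 2" if "y \<in> loc_dom c d \<phi>" for y using that all by metis
    have "coord c p \<in> loc_dom c d \<phi>" using F pc by blast
    then obtain T where T: "open T" "F (coord c p) \<in> T" "?S \<inter> T \<subseteq> F ` loc_dom c d \<phi>"
      using small_sphere_image_open[OF u uF] by metis
    have "y \<in> ?S \<inter> T"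
      using T(2) F[OF pc] Ev_inner(4)[of "coord c p"] all[OF p(1)] p(2) by (simp add: norm_eq_1)
    moreover have "?S \<inter> T \<subseteq> \<phi> ` topspace (top_of M)" using T(3) FU by fastforce
    ultimately show "\<exists>T. openin (top_of_set ?S) T \<and> y \<in> T \<and> T \<subseteq> \<phi> ` topspace (top_of M)"
      using openin_open_Int[OF T(1)] by blast
  qed
  then show ?thesis using u unfolding part_of_small_sphere_def by blast
qed

text \<open>Being in the hyperplane is all that each pair of charts has to know. As \<open>M\<close>
  is nonempty, nonzero mean curvature is attained somewhere and minimality fails.\<close>

lemma Sphere3_small_sphere_imp:
  assumes M: "surface M Sphere3 \<phi>" and part: "part_of_small_sphere M \<phi>"
  shows "proper_biharmonic M Sphere3 \<phi>"
proof -
  obtain u where u: "norm u = 1" and "openin (top_of_set (sphere 0 1 \<inter> {p. u \<bullet> p = 1 / sqrt 2})) (\<phi> ` topspace (top_of M))"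
    using part unfolding part_of_small_sphere_def by blast
  then have all: "u \<bullet> \<phi> p = 1 / sqrt 2" if "p \<in> topspace (top_of M)" for p
    using openin_subset that by fastforce
  have charts: "bitension (gram c) (gram d) (loc_rep c d \<phi>) x = 0 \<and> (\<exists>\<zeta>. unit_normal (gram d) (loc_rep c d \<phi>) x \<zeta>
      \<and> mean_curvature (gram c) (gram d) (loc_rep c d \<phi>) x \<zeta> \<noteq> 0)"
    if c: "c \<in> atlas M" and d: "d \<in> atlas Sphere3" and x: "x \<in> loc_dom c d \<phi>" for c d x
  proof -
    obtain \<sigma> where S: "sphere_surf (gram d) (loc_dom c d \<phi>) (loc_rep c d \<phi>) (gram c) \<sigma>"
      and F: "\<And>p. p \<in> chart_dom c \<Longrightarrow> \<phi> p \<in> chart_dom d \<Longrightarrow>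
       coord c p \<in> loc_dom c d \<phi> \<and> sphere_surf.F (loc_rep c d \<phi>) \<sigma> (coord c p) = \<phi> p"
      using Sphere3_surface_chart[OF M c d] by auto
    interpret sphere_surf "gram d" "loc_dom c d \<phi>" "loc_rep c d \<phi>" "gram c" \<sigma> by (rule S)
    have sub: "chart_dom c \<subseteq> topspace (top_of M)"
      using M c openin_subset unfolding surface_def riemannian_manifold_def by blast
    have "u \<bullet> F y = 1 / sqrt 2" if "y \<in> loc_dom c d \<phi>" for y
      using that F sub all by (force simp: loc_dom_def)
    then show ?thesis using small_sphere_biharmonic[OF u _ x] by blast
  qed
  obtain p where "p \<in> topspace (top_of M)" using M unfolding surface_def by blast
  then obtain c d where "c \<in> atlas M" "d \<in> atlas Sphere3" "p \<in> chart_dom c" "\<phi> p \<in> chart_dom d"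
    by (rule Sphere3_surface_point[OF M])
  moreover from this have "coord c p \<in> loc_dom c d \<phi>" by (auto simp: loc_dom_def)
  ultimately have "\<not> minimal M Sphere3 \<phi>"
    using charts unfolding minimal_def by blast
  then show ?thesis
    using charts M by (simp add: proper_biharmonic_def biharmonic_map_def surface_def)
qed

theorem theorem3p4:
  fixes M :: "('m, 2) riem_space"
  shows
    "(\<forall>\<phi>. surface M Sphere3 \<phi> \<and> totally_umbilical M Sphere3 \<phi> \<longrightarrow>
        (proper_biharmonic M Sphere3 \<phi> \<longleftrightarrow> part_of_small_sphere M \<phi>)) \<and>
     (\<forall>N \<in> {Euclidean3, Hyperbolic3, H2_times_R, Sol} \<union>
            {BCV 0 l | l. l \<noteq> 0} \<union> {BCV m l | m l. m < 0 \<and> l \<noteq> 0}.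
        \<forall>\<phi>. surface M N \<phi> \<and> totally_umbilical M N \<phi> \<longrightarrow> \<not> proper_biharmonic M N \<phi>) \<and>
     (\<forall>\<phi>. surface M S2_times_R \<phi> \<and> totally_umbilical M S2_times_R \<phi> \<longrightarrow>
        \<not> proper_biharmonic M S2_times_R \<phi>)"
proof (intro conjI allI impI ballI)
  fix \<phi> assume M: "surface M Sphere3 \<phi> \<and> totally_umbilical M Sphere3 \<phi>"
  then show "proper_biharmonic M Sphere3 \<phi> \<longleftrightarrow> part_of_small_sphere M \<phi>"
    using Sphere3_proper_biharmonic_imp Sphere3_small_sphere_imp by blast
next
  fix N \<phi>
  assume N: "N \<in> {Euclidean3, Hyperbolic3, H2_times_R, Sol} \<union>
            {BCV 0 l | l. l \<noteq> 0} \<union> {BCV m l | m l. m < 0 \<and> l \<noteq> 0}"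
    and M: "surface M N \<phi> \<and> totally_umbilical M N \<phi>"
  from N consider "N = Euclidean3" | "N = Hyperbolic3" | "N = H2_times_R" | "N = Sol"
    | m l where "N = BCV m l" "m \<le> 0" "l \<noteq> 0" by fastforce
  then show "\<not> proper_biharmonic M N \<phi>"
    using M Euclidean3_rigid Hyperbolic3_rigid H2_times_R_rigid Sol_rigid BCV_rigid by cases blast+
next
  fix \<phi> assume "surface M S2_times_R \<phi> \<and> totally_umbilical M S2_times_R \<phi>"
  then show "\<not> proper_biharmonic M S2_times_R \<phi>"
    using S2_times_R_rigid by blast
qed

end
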